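(* Let $D=\{|T|<r_D\}$, $0<r_D\le+\infty$, over $K$. Let $\mathcal C$ be a full subcategory of $d\text{-}\mathrm{Mod}(\mathscr O(D)[T^{-1}])$, consisting of differential equations on $D( *0)$, such that for all $\mathcal F,\mathcal G\in\mathcal C$ the differential equation $\mathrm{Hom}(\mathcal F,\mathcal G)$ (internal Hom) is free, has finite-dimensional de Rham cohomology on $D( *0)$, and satisfies $\chi_{\mathrm{dR}}(D( *0),\mathrm{Hom}(\mathcal F,\mathcal G))=0$. Then the restriction functor $$\mathrm{Res}:\mathcal C\longrightarrow d\text{-}\mathrm{Mod}(K((T))),\qquad \mathcal F\mapsto\mathcal F\otimes K((T)),$$ is fully faithful. Moreover, for $\mathcal F,\mathcal G\in\mathcal C$ with images $F=\mathcal F\otimes K((T))$, $G=\mathcal G\otimes K((T))$, the natural map of Yoneda extension groups $$\mathrm{Ext}_{d\text{-}\mathrm{Mod}(\mathscr O(D)[T^{-1}])}(\mathcal F,\mathcal G)\xrightarrow{\ \sim\ }\mathrm{Ext}_{d\text{-}\mathrm{Mod}(K((T)))}(F,G)$$ is an isomorphism. In particular, if $\mathcal C$ is stable by extensions in $d\text{-}\mathrm{Mod}(\mathscr O(D)[T^{-1}])$, then its essential image is stable by extensions in $d\text{-}\mathrm{Mod}(K((T)))$.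
   Context: $K$ is a field of characteristic $0$, complete for a non-archimedean (possibly trivial) absolute value; $D$ is a Berkovich open disk. A differential equation on $D( *0)$ is a locally free module of finite rank over the sheaf $\mathscr O_D[*0]$ of functions meromorphic at $0$ and holomorphic elsewhere, with a connection; equivalently a finitely generated projective $\mathscr O(D)[T^{-1}]$-module with a connection. Its de Rham cohomology $\mathrm H^0_{\mathrm{dR}},\mathrm H^1_{\mathrm{dR}}$ is the kernel and cokernel of $\nabla(d/dT)$ on global sections, $\chi_{\mathrm{dR}}=\dim\mathrm H^0_{\mathrm{dR}}-\dim\mathrm H^1_{\mathrm{dR}}$. For a ring $R$ with derivation $d$ (here $d=d/dT$), $d\text{-}\mathrm{Mod}(R)$ is the category of $R$-modules with a connection $\nabla$ satisfying the Leibniz rule with respect to $d$, with $R$-linear maps commuting with the connections as morphisms. $\mathrm{Ext}(M,N)$ is the group of equivalence classes of exact sequences $0\to N\to E\to M\to0$ in $d\text{-}\mathrm{Mod}(R)$. A subcategory is stable by extensions if, for every exact sequence in $d\text{-}\mathrm{Mod}(R)$ whose outer terms belong to it, the middle term belongs to it. *)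

theory Defs
  imports
    "Jordan_Normal_Form.VS_Connect"
    "HOL-Algebra.AbelCoset"
    "HOL-Algebra.Free_Abelian_Groups"
    "HOL-Computational_Algebra.Formal_Laurent_Series"
    "HOL-Library.Extended_Real"
    "HOL-Analysis.Abstract_Metric_Spaces"
begin

section \<open>Functions on the disk\<close>

definition complete_nonarch_abs :: "('k::field \<Rightarrow> real) \<Rightarrow> bool" where
  "complete_nonarch_abs v \<longleftrightarrow>
     (\<forall>x. 0 \<le> v x) \<and> (\<forall>x. v x = 0 \<longleftrightarrow> x = 0) \<and>
     (\<forall>x y. v (x * y) = v x * v y) \<and>
     (\<forall>x y. v (x + y) \<le> max (v x) (v y)) \<and>
     Metric_space.mcomplete UNIV (\<lambda>x y. v (x - y))"

text \<open>The global functions on \<open>{|T| < r}\<close> are the power series converging on every closed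
  disk of radius \<open>\<rho> < r\<close>.\<close>

definition disk_functions :: "('k::field \<Rightarrow> real) \<Rightarrow> ereal \<Rightarrow> 'k fps set" where
  "disk_functions v r =
     {f. \<forall>\<rho>>0. ereal \<rho> < r \<longrightarrow> (\<lambda>n. v (fps_nth f n) * \<rho> ^ n) \<longlonglongrightarrow> 0}"

text \<open>The localisation of the ring of functions on the disk at \<open>T\<close>, formed inside \<open>K((T))\<close>.\<close>

definition punctured_ring :: "('k::field \<Rightarrow> real) \<Rightarrow> ereal \<Rightarrow> 'k fls ring" where
  "punctured_ring v r =
     class_ring \<lparr> carrier := {fps_to_fls f * fls_X_inv ^ n | f n. f \<in> disk_functions v r} \<rparr>"

section \<open>Differential modules\<close>

text \<open>The \<open>ring\<close> part of a \<open>module\<close> record only serves as an additive group; its fields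
  \<open>mult\<close> and \<open>one\<close> are irrelevant.\<close>

record ('r, 'm) dmodule = "('r, 'm) module" +
  nabla :: "'m \<Rightarrow> 'm"

definition dmod :: "'r ring \<Rightarrow> ('r \<Rightarrow> 'r) \<Rightarrow> ('r, 'm) dmodule \<Rightarrow> bool" where
  "dmod R d M \<longleftrightarrow> Module.module R M \<and>
     nabla M \<in> carrier M \<rightarrow> carrier M \<and>
     (\<forall>x\<in>carrier M. \<forall>y\<in>carrier M. nabla M (x \<oplus>\<^bsub>M\<^esub> y) = nabla M x \<oplus>\<^bsub>M\<^esub> nabla M y) \<and>
     (\<forall>a\<in>carrier R. \<forall>x\<in>carrier M.
        nabla M (a \<odot>\<^bsub>M\<^esub> x) = d a \<odot>\<^bsub>M\<^esub> x \<oplus>\<^bsub>M\<^esub> a \<odot>\<^bsub>M\<^esub> nabla M x)"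

definition lin_maps ::
  "'r ring \<Rightarrow> ('r, 'm, 'a) module_scheme \<Rightarrow> ('r, 'n, 'b) module_scheme \<Rightarrow> ('m \<Rightarrow> 'n) set" where
  "lin_maps R M N = LinearCombinations.module_hom R M N \<inter> extensional (carrier M)"

definition dmod_hom :: "'r ring \<Rightarrow> ('r, 'm) dmodule \<Rightarrow> ('r, 'n) dmodule \<Rightarrow> ('m \<Rightarrow> 'n) set" where
  "dmod_hom R M N = {f \<in> lin_maps R M N. \<forall>x\<in>carrier M. f (nabla M x) = nabla N (f x)}"

definition dmod_isomorphic :: "'r ring \<Rightarrow> ('r, 'm) dmodule \<Rightarrow> ('r, 'n) dmodule \<Rightarrow> bool" where
  "dmod_isomorphic R M N \<longleftrightarrow> (\<exists>f\<in>dmod_hom R M N. bij_betw f (carrier M) (carrier N))"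

definition internal_hom ::
  "'r ring \<Rightarrow> ('r, 'm) dmodule \<Rightarrow> ('r, 'n) dmodule \<Rightarrow> ('r, 'm \<Rightarrow> 'n) dmodule" where
  "internal_hom R M N =
     \<lparr> carrier = lin_maps R M N, monoid.mult = undefined, one = undefined,
       ring.zero = (\<lambda>x\<in>carrier M. \<zero>\<^bsub>N\<^esub>),
       ring.add = (\<lambda>f g. \<lambda>x\<in>carrier M. f x \<oplus>\<^bsub>N\<^esub> g x),
       module.smult = (\<lambda>a f. \<lambda>x\<in>carrier M. a \<odot>\<^bsub>N\<^esub> f x),
       nabla = (\<lambda>f. \<lambda>x\<in>carrier M. nabla N (f x) \<ominus>\<^bsub>N\<^esub> f (nabla M x)) \<rparr>"

definition prod_dmod :: "('r, 'm) dmodule \<Rightarrow> ('r, 'n) dmodule \<Rightarrow> ('r, 'm \<times> 'n) dmodule" where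
  "prod_dmod M N =
     \<lparr> carrier = carrier M \<times> carrier N, monoid.mult = undefined, one = undefined,
       ring.zero = (\<zero>\<^bsub>M\<^esub>, \<zero>\<^bsub>N\<^esub>),
       ring.add = (\<lambda>(x, y) (x', y'). (x \<oplus>\<^bsub>M\<^esub> x', y \<oplus>\<^bsub>N\<^esub> y')),
       module.smult = (\<lambda>a (x, y). (a \<odot>\<^bsub>M\<^esub> x, a \<odot>\<^bsub>N\<^esub> y)),
       nabla = (\<lambda>(x, y). (nabla M x, nabla N y)) \<rparr>"

definition quot_dmod :: "('r, 'm) dmodule \<Rightarrow> 'm set \<Rightarrow> ('r, 'm set) dmodule" where
  "quot_dmod M S =
     \<lparr> carrier = a_rcosets\<^bsub>M\<^esub> S, monoid.mult = undefined, one = undefined,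
       ring.zero = S,
       ring.add = (\<lambda>X Y. X <+>\<^bsub>M\<^esub> Y),
       module.smult = (\<lambda>a X. \<Union>x\<in>X. S +>\<^bsub>M\<^esub> (a \<odot>\<^bsub>M\<^esub> x)),
       nabla = (\<lambda>X. \<Union>x\<in>X. S +>\<^bsub>M\<^esub> nabla M x) \<rparr>"

definition free_module :: "'r ring \<Rightarrow> ('r, 'm, 'a) module_scheme \<Rightarrow> bool" where
  "free_module R M \<longleftrightarrow>
     (\<exists>B\<subseteq>carrier M. \<not> LinearCombinations.module.lin_dep R M B \<and> LinearCombinations.module.span R M B = carrier M)"

definition power_module :: "'r ring \<Rightarrow> nat \<Rightarrow> ('r, nat \<Rightarrow> 'r) module" where
  "power_module R n =
     \<lparr> carrier = {..<n} \<rightarrow>\<^sub>E carrier R, monoid.mult = undefined, one = undefined,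
       ring.zero = (\<lambda>i\<in>{..<n}. \<zero>\<^bsub>R\<^esub>),
       ring.add = (\<lambda>x y. \<lambda>i\<in>{..<n}. x i \<oplus>\<^bsub>R\<^esub> y i),
       module.smult = (\<lambda>a x. \<lambda>i\<in>{..<n}. a \<otimes>\<^bsub>R\<^esub> x i) \<rparr>"

text \<open>Finitely generated projective: a direct summand of some \<open>R\<^sup>n\<close>.\<close>

definition fg_projective :: "'r ring \<Rightarrow> ('r, 'm, 'a) module_scheme \<Rightarrow> bool" where
  "fg_projective R M \<longleftrightarrow>
     (\<exists>n. \<exists>s\<in>lin_maps R M (power_module R n). \<exists>q\<in>lin_maps R (power_module R n) M.
        \<forall>x\<in>carrier M. q (s x) = x)"

definition diff_eq :: "('k::field \<Rightarrow> real) \<Rightarrow> ereal \<Rightarrow> ('k fls, 'm) dmodule \<Rightarrow> bool" where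
  "diff_eq v r M \<longleftrightarrow>
     dmod (punctured_ring v r) fls_deriv M \<and> fg_projective (punctured_ring v r) M"

section \<open>De Rham cohomology\<close>

text \<open>The connection is not linear over the function ring, only over the constants.\<close>

definition const_scalars :: "('k::field fls, 'm) dmodule \<Rightarrow> ('k, 'm) dmodule" where
  "const_scalars M =
     \<lparr> carrier = carrier M, monoid.mult = monoid.mult M, one = one M,
       ring.zero = ring.zero M, ring.add = ring.add M,
       module.smult = (\<lambda>c. module.smult M (fls_const c)), nabla = nabla M \<rparr>"

definition H0_dR :: "('k::field fls, 'm) dmodule \<Rightarrow> ('k, 'm) dmodule" where
  "H0_dR M = (const_scalars M) \<lparr> carrier := {x \<in> carrier M. nabla M x = \<zero>\<^bsub>M\<^esub>} \<rparr>"

definition H1_dR :: "('k::field fls, 'm) dmodule \<Rightarrow> ('k, 'm set) dmodule" where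
  "H1_dR M = quot_dmod (const_scalars M) (nabla M ` carrier M)"

definition finite_dim_dR :: "('k::field fls, 'm) dmodule \<Rightarrow> bool" where
  "finite_dim_dR M \<longleftrightarrow>
     vectorspace.fin_dim class_ring (H0_dR M) \<and> vectorspace.fin_dim class_ring (H1_dR M)"

definition chi_dR :: "('k::field fls, 'm) dmodule \<Rightarrow> int" where
  "chi_dR M =
     int (vectorspace.dim class_ring (H0_dR M)) - int (vectorspace.dim class_ring (H1_dR M))"

section \<open>Scalar extension\<close>

text \<open>For a subring \<open>R\<close> of \<open>A\<close>, the tensor product of \<open>A\<close> and \<open>M\<close> over \<open>R\<close> is the free abelian
  group on \<open>A \<times> M\<close> modulo the bilinearity relations.\<close>

definition tensor_pre :: "'r ring \<Rightarrow> ('r, 'm) dmodule \<Rightarrow> ('r \<times> 'm \<Rightarrow>\<^sub>0 int) monoid" where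
  "tensor_pre A M = free_Abelian_group (carrier A \<times> carrier M)"

definition tensor_rel :: "'r ring \<Rightarrow> 'r ring \<Rightarrow> ('r, 'm) dmodule \<Rightarrow> ('r \<times> 'm \<Rightarrow>\<^sub>0 int) set" where
  "tensor_rel A R M = generate (tensor_pre A M)
     ({frag_of (a \<oplus>\<^bsub>A\<^esub> b, x) - frag_of (a, x) - frag_of (b, x) | a b x.
         a \<in> carrier A \<and> b \<in> carrier A \<and> x \<in> carrier M} \<union>
      {frag_of (a, x \<oplus>\<^bsub>M\<^esub> y) - frag_of (a, x) - frag_of (a, y) | a x y.
         a \<in> carrier A \<and> x \<in> carrier M \<and> y \<in> carrier M} \<union>
      {frag_of (a \<otimes>\<^bsub>A\<^esub> c, x) - frag_of (a, c \<odot>\<^bsub>M\<^esub> x) | a c x.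
         a \<in> carrier A \<and> c \<in> carrier R \<and> x \<in> carrier M})"

text \<open>The map to \<open>A \<otimes> M\<close> induced on cosets by a map \<open>t\<close> on generators.\<close>

definition tensor_lift ::
  "'r ring \<Rightarrow> 'r ring \<Rightarrow> ('r, 'm) dmodule \<Rightarrow> ('b \<Rightarrow> ('r \<times> 'm \<Rightarrow>\<^sub>0 int)) \<Rightarrow>
   ('b \<Rightarrow>\<^sub>0 int) set \<Rightarrow> ('r \<times> 'm \<Rightarrow>\<^sub>0 int) set" where
  "tensor_lift A R M t X = (\<Union>w\<in>X. tensor_rel A R M #>\<^bsub>tensor_pre A M\<^esub> frag_extend t w)"

definition base_change ::
  "'r ring \<Rightarrow> 'r ring \<Rightarrow> ('r \<Rightarrow> 'r) \<Rightarrow> ('r, 'm) dmodule \<Rightarrow> ('r, ('r \<times> 'm \<Rightarrow>\<^sub>0 int) set) dmodule" where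
  "base_change A R d M =
     \<lparr> carrier = rcosets\<^bsub>tensor_pre A M\<^esub> tensor_rel A R M, monoid.mult = undefined, one = undefined,
       ring.zero = tensor_rel A R M,
       ring.add = (\<lambda>X Y. X <#>\<^bsub>tensor_pre A M\<^esub> Y),
       module.smult = (\<lambda>a. tensor_lift A R M (\<lambda>(b, x). frag_of (a \<otimes>\<^bsub>A\<^esub> b, x))),
       nabla = tensor_lift A R M (\<lambda>(b, x). frag_of (d b, x) + frag_of (b, nabla M x)) \<rparr>"

definition base_change_hom ::
  "'r ring \<Rightarrow> 'r ring \<Rightarrow> ('r \<Rightarrow> 'r) \<Rightarrow> ('r, 'm) dmodule \<Rightarrow> ('r, 'n) dmodule \<Rightarrow> ('m \<Rightarrow> 'n) \<Rightarrow>
   ('r \<times> 'm \<Rightarrow>\<^sub>0 int) set \<Rightarrow> ('r \<times> 'n \<Rightarrow>\<^sub>0 int) set" where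
  "base_change_hom A R d M N f =
     (\<lambda>X\<in>carrier (base_change A R d M). tensor_lift A R N (\<lambda>(b, x). frag_of (b, f x)) X)"

section \<open>Extensions\<close>

definition short_exact ::
  "'r ring \<Rightarrow> ('r \<Rightarrow> 'r) \<Rightarrow> ('r, 'n) dmodule \<Rightarrow> ('r, 'e) dmodule \<Rightarrow> ('r, 'm) dmodule \<Rightarrow>
   ('n \<Rightarrow> 'e) \<Rightarrow> ('e \<Rightarrow> 'm) \<Rightarrow> bool" where
  "short_exact R d N E M i p \<longleftrightarrow>
     dmod R d N \<and> dmod R d E \<and> dmod R d M \<and>
     i \<in> dmod_hom R N E \<and> p \<in> dmod_hom R E M \<and>
     inj_on i (carrier N) \<and>
     i ` carrier N = {e \<in> carrier E. p e = \<zero>\<^bsub>M\<^esub>} \<and>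
     p ` carrier E = carrier M"

definition stable_by_extensions ::
  "'r ring \<Rightarrow> ('r \<Rightarrow> 'r) \<Rightarrow> ('r, 'm) dmodule set \<Rightarrow> bool" where
  "stable_by_extensions R d C \<longleftrightarrow>
     (\<forall>N E M i p. short_exact R d N E M i p \<and> N \<in> C \<and> M \<in> C \<longrightarrow> E \<in> C)"

definition essential_image ::
  "'r ring \<Rightarrow> 'r ring \<Rightarrow> ('r \<Rightarrow> 'r) \<Rightarrow> ('r, 'm) dmodule set \<Rightarrow> ('r, 'y) dmodule set" where
  "essential_image A R d C =
     {Y. dmod A d Y \<and> (\<exists>M\<in>C. dmod_isomorphic A (base_change A R d M) Y)}"

type_synonym ('r, 'n, 'e, 'm) extension = "('r, 'e) dmodule \<times> ('n \<Rightarrow> 'e) \<times> ('e \<Rightarrow> 'm)"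

definition extensions ::
  "'r ring \<Rightarrow> ('r \<Rightarrow> 'r) \<Rightarrow> ('r, 'm) dmodule \<Rightarrow> ('r, 'n) dmodule \<Rightarrow>
   ('r, 'n, 'e, 'm) extension set" where
  "extensions R d M N = {(E, i, p). short_exact R d N E M i p}"

definition ext_equiv ::
  "'r ring \<Rightarrow> ('r, 'm) dmodule \<Rightarrow> ('r, 'n) dmodule \<Rightarrow>
   ('r, 'n, 'e, 'm) extension \<Rightarrow> ('r, 'n, 'f, 'm) extension \<Rightarrow> bool" where
  "ext_equiv R M N = (\<lambda>(E, i, p) (E', i', p').
     \<exists>h\<in>dmod_hom R E E'. bij_betw h (carrier E) (carrier E') \<and>
       (\<forall>x\<in>carrier N. h (i x) = i' x) \<and> (\<forall>e\<in>carrier E. p' (h e) = p e))"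

text \<open>The middle term of an extension of \<open>M\<close> by \<open>N\<close> has the cardinality of \<open>N \<times> M\<close>. Hence every
  extension is equivalent to one with middle term of type \<open>'n \<times> 'm\<close>, and it is enough to form
  equivalence classes over that type.\<close>

definition ext_class ::
  "'r ring \<Rightarrow> ('r \<Rightarrow> 'r) \<Rightarrow> ('r, 'm) dmodule \<Rightarrow> ('r, 'n) dmodule \<Rightarrow>
   ('r, 'n, 'e, 'm) extension \<Rightarrow> ('r, 'n, 'n \<times> 'm, 'm) extension set" where
  "ext_class R d M N x = {y \<in> extensions R d M N. ext_equiv R M N x y}"

text \<open>Baer sum: the fibre product over \<open>M\<close> modulo the antidiagonal copy of \<open>N\<close>.\<close>

definition baer_sum ::
  "('r, 'm) dmodule \<Rightarrow> ('r, 'n) dmodule \<Rightarrow>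
   ('r, 'n, 'e, 'm) extension \<Rightarrow> ('r, 'n, 'f, 'm) extension \<Rightarrow>
   ('r, 'n, ('e \<times> 'f) set, 'm) extension" where
  "baer_sum M N = (\<lambda>(E, i, p) (E', i', p').
     let P = (prod_dmod E E') \<lparr> carrier := {(e, e') \<in> carrier E \<times> carrier E'. p e = p' e'} \<rparr>;
         S = (\<lambda>x. (i x, \<ominus>\<^bsub>E'\<^esub> i' x)) ` carrier N;
         Q = quot_dmod P S
     in (Q, \<lambda>x\<in>carrier N. S +>\<^bsub>P\<^esub> (i x, \<zero>\<^bsub>E'\<^esub>),
            \<lambda>X\<in>carrier Q. the_elem ((\<lambda>(e, e'). p e) ` X)))"

definition split_extension ::
  "('r, 'm) dmodule \<Rightarrow> ('r, 'n) dmodule \<Rightarrow> ('r, 'n, 'n \<times> 'm, 'm) extension" where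
  "split_extension M N =
     (prod_dmod N M, \<lambda>x\<in>carrier N. (x, \<zero>\<^bsub>M\<^esub>), \<lambda>e\<in>carrier (prod_dmod N M). snd e)"

definition Ext ::
  "'r ring \<Rightarrow> ('r \<Rightarrow> 'r) \<Rightarrow> ('r, 'm) dmodule \<Rightarrow> ('r, 'n) dmodule \<Rightarrow>
   ('r, 'n, 'n \<times> 'm, 'm) extension set monoid" where
  "Ext R d M N =
     \<lparr> carrier = ext_class R d M N ` (extensions R d M N :: ('r, 'n, 'n \<times> 'm, 'm) extension set),
       monoid.mult = (\<lambda>X Y. \<Union>x\<in>X. \<Union>y\<in>Y. ext_class R d M N (baer_sum M N x y)),
       one = ext_class R d M N (split_extension M N) \<rparr>"

definition ext_base_change ::
  "'r ring \<Rightarrow> 'r ring \<Rightarrow> ('r \<Rightarrow> 'r) \<Rightarrow> ('r, 'm) dmodule \<Rightarrow> ('r, 'n) dmodule \<Rightarrow>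
   ('r, 'n, 'n \<times> 'm, 'm) extension set \<Rightarrow>
   ('r, ('r \<times> 'n \<Rightarrow>\<^sub>0 int) set, ('r \<times> 'n \<Rightarrow>\<^sub>0 int) set \<times> ('r \<times> 'm \<Rightarrow>\<^sub>0 int) set,
     ('r \<times> 'm \<Rightarrow>\<^sub>0 int) set) extension set" where
  "ext_base_change A R d M N X =
     (\<Union>(E, i, p)\<in>X. ext_class A d (base_change A R d M) (base_change A R d N)
        (base_change A R d E, base_change_hom A R d N E i, base_change_hom A R d E M p))"

section \<open>Restriction to the formal punctured disk\<close>

abbreviation Res ::
  "('k::field \<Rightarrow> real) \<Rightarrow> ereal \<Rightarrow> ('k fls, 'm) dmodule \<Rightarrow>
   ('k fls, ('k fls \<times> 'm \<Rightarrow>\<^sub>0 int) set) dmodule" where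
  "Res v r \<equiv> base_change class_ring (punctured_ring v r) fls_deriv"

abbreviation Res_hom ::
  "('k::field \<Rightarrow> real) \<Rightarrow> ereal \<Rightarrow> ('k fls, 'm) dmodule \<Rightarrow> ('k fls, 'n) dmodule \<Rightarrow> ('m \<Rightarrow> 'n) \<Rightarrow>
   ('k fls \<times> 'm \<Rightarrow>\<^sub>0 int) set \<Rightarrow> ('k fls \<times> 'n \<Rightarrow>\<^sub>0 int) set" where
  "Res_hom v r \<equiv> base_change_hom class_ring (punctured_ring v r) fls_deriv"

end

theory Submission
  imports Defs "HOL-Library.Function_Algebras"
begin

text \<open>Write \<open>R\<close> for the functions on the punctured disk and \<open>A = K((T))\<close>. For \<open>F, G\<close> in the category, morphisms
  and extensions are computed by the kernel and the cokernel of \<open>\<nabla>\<close> on \<open>Hom(F, G)\<close>, over \<open>R\<close> as well as over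
  \<open>A\<close>; for extensions this uses that \<open>F\<close> is projective. So it suffices to compare these kernels and cokernels.

  Over \<open>A\<close>, the map \<open>\<nabla>\<close> differs from a \<open>K\<close>-linear bijection by a map of finite rank with values in
  \<open>Hom\<^sub>R(F, G)\<close>: filter \<open>Hom\<^sub>A\<close> by submodules with cyclic quotients generated by elements of \<open>Hom\<^sub>R\<close>, and reduce
  to a scalar differential operator, which acts on \<open>A\<close> as a triangular operator whose diagonal is a nonzero
  polynomial in the exponent. Hence the index over \<open>A\<close> is zero and \<open>H\<^sup>1\<close> over \<open>R\<close> maps onto \<open>H\<^sup>1\<close> over \<open>A\<close>,
  while \<open>H\<^sup>0\<close> injects. As the index over \<open>R\<close> vanishes too, all four dimensions agree and both maps are
  isomorphisms.\<close>

text \<open>Nothing is known beforehand about dimensions over K((T)), so none is formed there. The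
  vanishing of the index enters in another guise: a K-linear bijection plus a map of finite rank is
  injective once it is surjective. The obstacle is to keep the finite-rank terms inside Hom over the
  disk, where the hypothesis on the Euler characteristic speaks. The generators of the filtration
  are therefore taken in that Hom, and the scalar operators are corrected at finitely many exponents
  only, by monomials, which are functions on the punctured disk. Characteristic zero bounds the
  number of exceptional exponents: a nonzero polynomial over K has finitely many integer roots. The
  modules are projective, so all coordinates refer to dual bases, whose members may satisfy
  relations. Extensions are handled through cocycles: these are elements of Hom, and they make sense
  for a middle term of any type, which matters because products, Baer quotients and tensor products
  all live on different types.\<close>

no_notation index_mat (infixl "$$" 100)
notation fls_nth (infixl "$$" 75)

section \<open>Scalar differential operators on Laurent series\<close>

text \<open>The bounds \<open>a\<close> and \<open>b\<close> may lie below the orders of the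
  factors: if either is strict, both sides of the second identity vanish.\<close>

lemma fls_mult_nth_below:
  fixes f g :: "'a::comm_ring_1 fls"
  assumes "\<And>i. i < a \<Longrightarrow> f $$ i = 0" and "\<And>i. i < b \<Longrightarrow> g $$ i = 0"
  shows "i < a + b \<Longrightarrow> (f * g) $$ i = 0" and "(f * g) $$ (a + b) = f $$ a * g $$ b"
proof -
  have "(i < a + b \<longrightarrow> (f * g) $$ i = 0) \<and> (f * g) $$ (a + b) = f $$ a * g $$ b"
  proof (cases "f = 0 \<or> g = 0")
    case False
    then have ab: "a \<le> fls_subdegree f" "b \<le> fls_subdegree g"
      using assms by (auto intro!: fls_subdegree_geI)
    show ?thesis
    proof (cases "a = fls_subdegree f \<and> b = fls_subdegree g")
      case False
      with ab have "a + b < fls_subdegree f + fls_subdegree g"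
        and "a < fls_subdegree f \<or> b < fls_subdegree g" by linarith+
      then show ?thesis by (auto simp: fls_times_nth_eq0)
    qed (auto simp: fls_times_nth_eq0)
  qed auto
  then show "i < a + b \<Longrightarrow> (f * g) $$ i = 0" "(f * g) $$ (a + b) = f $$ a * g $$ b" by auto
qed

text \<open>Each differentiation contributes the current exponent and lowers it by one; the rising
  factorial is the product of the exponents from \<open>n + i\<close> down to
  \<open>n + 1\<close>.\<close>

lemma funpow_fls_deriv_nth:
  "((fls_deriv ^^ i) f) $$ n = pochhammer (of_int n + 1) i * f $$ (n + int i)"
proof (induction i arbitrary: n)
  case (Suc i)
  have "pochhammer (of_int n + 1) (Suc i) = (of_int n + 1) * pochhammer (of_int (n+1) + 1 :: 'a) i"
    by (simp add: pochhammer_rec add_ac)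
  with Suc[of "n + 1"] show ?case by (simp add: add_ac mult_ac)
qed simp

lemma degree_pochhammer_X:
  "degree (pochhammer [:0, 1::'a::idom:] i) = i \<and> coeff (pochhammer [:0, 1::'a:] i) i = 1"
proof (induction i)
  case (Suc i)
  define q where "q = pCons (of_nat i) (1::'a poly)"
  have q: "degree q = 1" "coeff q 1 = 1" by (simp_all add: q_def)
  have e: "pochhammer [:0, 1::'a:] (Suc i) = pochhammer [:0, 1::'a:] i * q"
    by (simp add: pochhammer_Suc of_nat_poly one_pCons q_def del: mult_pCons_right)
  have "pochhammer [:0, 1::'a:] i \<noteq> 0" "q \<noteq> 0" using Suc q by auto
  then have "degree (pochhammer [:0, 1::'a:] (Suc i)) = Suc i"
    unfolding e using Suc q by (simp add: degree_mult_eq)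
  moreover have "coeff (pochhammer [:0, 1::'a:] (Suc i)) (Suc i) = 1"
    unfolding e using coeff_mult_degree_sum[of "pochhammer [:0, 1::'a:] i" q] Suc q by simp
  ultimately show ?case by blast
qed simp

lemma poly_pochhammer_X: "poly (pochhammer [:0, 1:] i) x = pochhammer (x::'a::idom) i"
  by (induction i) (simp_all add: pochhammer_Suc algebra_simps)

text \<open>The rising factorials are monic of pairwise distinct degrees, so the last nonzero
  \<open>a m\<close> survives as the coefficient of degree \<open>m\<close> and the combination is a
  nonzero polynomial. In characteristic zero distinct integers give distinct arguments, so finitely
  many roots account for finitely many integers.\<close>

lemma finite_zeros_sum_pochhammer:
  fixes a :: "nat \<Rightarrow> 'a::field_char_0"
  assumes "i \<le> k" "a i \<noteq> 0"
  shows "finite {j::int. (\<Sum>i\<le>k. a i * pochhammer (of_int j + c) i) = 0}"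
proof -
  define p where "p = (\<Sum>i\<le>k. smult (a i) (pochhammer [:0, 1:] i))"
  define m where "m = Max {i. i \<le> k \<and> a i \<noteq> 0}"
  have fin: "finite {i. i \<le> k \<and> a i \<noteq> 0}" by simp
  have m: "m \<le> k" "a m \<noteq> 0" using Max_in[OF fin] assms unfolding m_def by blast+
  have top: "a i = 0" if "i \<le> k" "m < i" for i
    using Max_ge[OF fin, of i] that unfolding m_def by fastforce
  have "coeff p m = (\<Sum>i\<le>k. a i * coeff (pochhammer [:0, 1:] i) m)"
    by (simp add: p_def coeff_sum)
  also have "\<dots> = (\<Sum>i\<in>{m}. a i * coeff (pochhammer [:0, 1:] i) m)"
  proof (rule sum.mono_neutral_right)
    show "\<forall>i\<in>{..k} - {m}. a i * coeff (pochhammer [:0, 1:] i) m = 0"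
    proof
      fix i assume "i \<in> {..k} - {m}"
      then consider "i \<le> k" "m < i" | "i < m" by force
      then show "a i * coeff (pochhammer [:0, 1:] i) m = 0"
        by cases (simp_all add: top coeff_eq_0 degree_pochhammer_X)
    qed
  qed (use m in auto)
  also have "\<dots> = a m" using degree_pochhammer_X[of m, where 'a = 'a] by simp
  finally have "p \<noteq> 0" using m by auto
  then have "finite {x. poly p x = 0}" by (rule poly_roots_finite)
  then have "finite ((\<lambda>j::int. of_int j + c) -` {x. poly p x = 0})"
    by (rule finite_vimageI) (auto intro: injI)
  then show ?thesis
    by (simp add: p_def poly_sum poly_pochhammer_X vimage_def)
qed

text \<open>\<open>P\<close> raises every lower bound for the order by \<open>s\<close> and
  multiplies the coefficient sitting there by a nonzero factor, so an equation can be solved one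
  coefficient at a time, upwards from the lowest exponent. The limit is taken coefficientwise, since
  coefficient \<open>i\<close> of \<open>P f\<close> sees only the exponents of \<open>f\<close> up
  to \<open>i - s\<close>.\<close>

lemma triangular_bij:
  fixes P :: "'k::field fls \<Rightarrow> 'k fls"
  assumes add: "\<And>f g. P (f + g) = P f + P g"
    and scale: "\<And>c f. P (fls_const c * f) = fls_const c * P f"
    and below: "\<And>f j i. (\<And>i. i < j \<Longrightarrow> f $$ i = 0) \<Longrightarrow> i < j + s \<Longrightarrow> P f $$ i = 0"
    and diag: "\<And>f j. (\<And>i. i < j \<Longrightarrow> f $$ i = 0) \<Longrightarrow> P f $$ (j + s) = \<phi> j * f $$ j"
    and nz: "\<And>j. \<phi> j \<noteq> 0"
  shows "bij P"
proof (rule bijI)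
  have zero: "P 0 = 0" using scale[of 0 0] by simp
  have minus: "P (- f) = - P f" for f using add[of f "- f"] zero by (simp add: eq_neg_iff_add_eq_0 add.commute)
  have diff: "P (f - g) = P f - P g" for f g using add[of f "- g"] minus by simp
  show "inj P"
  proof (rule injI)
    fix f g assume "P f = P g"
    then have *: "P (f - g) = 0" by (simp add: diff)
    have "\<phi> (fls_subdegree (f - g)) * (f - g) $$ (fls_subdegree (f - g)) = 0"
      using diag[of "fls_subdegree (f - g)" "f - g", OF fls_eq0_below_subdegree] unfolding * by simp
    with nz show "f = g" by (metis eq_iff_diff_eq_0 mult_eq_0_iff nth_fls_subdegree_zero_iff)
  qed
  show "surj P"
  proof (rule surjI)
    fix b :: "'k fls"
    define j0 where "j0 = fls_subdegree b - s"
    \<comment> \<open>Stage \<open>n\<close> adds the monomial of exponent \<open>j0 + n\<close>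
      whose image cancels the coefficient of the error \<open>b - P f\<close> at
      \<open>j0 + n + s\<close>; the denominator is the diagonal entry there.\<close>
    define a where "a = rec_nat 0 (\<lambda>n f. f + fls_const ((b - P f) $$ (j0 + int n + s) / \<phi> (j0 + int n)) *
      fls_X_intpow (j0 + int n))"
    define c where "c n = (b - P (a n)) $$ (j0 + int n + s) / \<phi> (j0 + int n)" for n
    have a0: "a 0 = 0" and aS: "a (Suc n) = a n + fls_const (c n) * fls_X_intpow (j0 + int n)" for n
      by (simp_all add: a_def c_def)
    define f where "f = fls_shift (- j0) (fps_to_fls (Abs_fps c))"
    have fn: "f $$ i = (if i < j0 then 0 else c (nat (i - j0)))" for i
      by (simp add: f_def)
    have an: "a n $$ i = (if i < j0 + int n then f $$ i else 0)" for n i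
    proof (induction n)
      case (Suc n)
      have "(fls_const (c n) * fls_X_intpow (j0 + int n)) $$ i = (if i = j0 + int n then c n else 0)"
        by (simp add: fls_X_intpow_times_conv_shift)
      with Suc show ?case by (auto simp: aS fn)
    qed (simp add: a0 fn)
    have bn: "(b - P (a n)) $$ i = 0" if "i < j0 + int n + s" for n i
      using that
    proof (induction n arbitrary: i)
      case 0 then show ?case by (simp add: a0 zero j0_def)
    next
      case (Suc n)
      let ?X = "fls_X_intpow (j0 + int n) :: 'k fls"
      have X: "P ?X $$ i = 0" if "i < j0 + int n + s" for i
        by (rule below[OF _ that]) simp
      have X': "P ?X $$ (j0 + int n + s) = \<phi> (j0 + int n)"
        by (subst diag) auto
      have e: "(b - P (a (Suc n))) $$ i = (b - P (a n)) $$ i - c n * P ?X $$ i"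
        by (simp add: aS add scale)
      show ?case
      proof (cases "i = j0 + int n + s")
        case True
        then show ?thesis unfolding e using X' nz by (simp add: c_def)
      next
        case False
        then have "i < j0 + int n + s" using Suc.prems by simp
        then show ?thesis unfolding e using X Suc.IH by simp
      qed
    qed
    \<comment> \<open>For \<open>n\<close> so large that \<open>i < j0 + n + s\<close>, the image of
      the tail \<open>f - a n\<close> does not reach coefficient \<open>i\<close>, and the error of
      \<open>a n\<close> already vanishes there.\<close>
    have "(P f - b) $$ i = 0" for i
    proof -
      define n where "n = nat (i - j0 - s + 1)"
      have n: "i < j0 + int n + s" by (simp add: n_def)
      have "P (f - a n) $$ i = 0"
        by (rule below[OF _ n]) (simp add: an)
      with bn[OF n] show ?thesis by (simp add: diff)
    qed
    then show "P f = b" by (simp add: fls_eq_iff)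
  qed
qed

text \<open>The coefficients stand inside the derivatives because the operator arises by repeated
  integration by parts, as a formal adjoint. It is triangular, and its diagonal is a polynomial in
  the exponent, the indicial polynomial. At the finitely many integer roots the added sum supplies
  the diagonal entry 1.\<close>

lemma differential_operator_bij:
  fixes c :: "nat \<Rightarrow> 'k::field_char_0 fls"
  assumes "l \<le> k" "c l \<noteq> 0"
  defines "P \<equiv> \<lambda>f. \<Sum>i\<le>k. (- 1) ^ i * (fls_deriv ^^ i) (c i * f)"
  shows "\<exists>Z s. finite Z \<and> bij (\<lambda>f. P f + (\<Sum>j\<in>Z. fls_const (f $$ j) * fls_X_intpow (j + s)))"
proof -
  \<comment> \<open>The least shift of the order among the nonzero terms. Only the terms attaining
    it contribute to the diagonal, and at least one does.\<close>
  define s where "s = Min ((\<lambda>i. fls_subdegree (c i) - int i) ` {i. i \<le> k \<and> c i \<noteq> 0})"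
  have c0: "c i $$ n = 0" if "i \<le> k" "n < s + int i" for i n
  proof (cases "c i = 0")
    case False
    then have "s \<le> fls_subdegree (c i) - int i"
      unfolding s_def using that by (intro Min_le) auto
    with that show ?thesis by simp
  qed simp
  have "s \<in> (\<lambda>i. fls_subdegree (c i) - int i) ` {i. i \<le> k \<and> c i \<noteq> 0}"
    unfolding s_def using assms by (intro Min_in) auto
  then obtain i0 where i0: "i0 \<le> k" "c i0 \<noteq> 0" "s = fls_subdegree (c i0) - int i0" by auto
  define a where "a i = (- 1) ^ i * c i $$ (s + int i)" for i
  have a0: "a i0 \<noteq> 0" using i0 by (simp add: a_def)
  \<comment> \<open>The indicial polynomial. An \<open>i\<close>-th derivative that lands on
    exponent \<open>j + s\<close> carries the rising factorial starting at
    \<open>j + s + 1\<close>.\<close>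
  define \<phi> where "\<phi> j = (\<Sum>i\<le>k. a i * pochhammer (of_int j + of_int (s + 1)) i)" for j :: int
  define Z where "Z = {j. \<phi> j = 0}"
  have fin: "finite Z"
    using finite_zeros_sum_pochhammer[of i0 k a, OF i0(1) a0] by (simp add: Z_def \<phi>_def)
  have Pn: "P f $$ n = (\<Sum>i\<le>k. (- 1) ^ i * (pochhammer (of_int n + 1) i * (c i * f) $$ (n + int i)))" for f n
  proof -
    have "((- 1) ^ i * g) $$ n = (- 1) ^ i * (g $$ n)" for i and g :: "'k fls"
      by (induction i) auto
    then show ?thesis by (simp add: P_def fls_nth_sum funpow_fls_deriv_nth)
  qed
  have mult: "(c i * f) $$ n = 0" if "i \<le> k" "\<And>i. i < j \<Longrightarrow> f $$ i = 0" "n < s + int i + j" for i f j n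
    by (rule fls_mult_nth_below(1)[OF _ that(2,3)]) (rule c0[OF that(1)])
  have mult': "(c i * f) $$ (s + int i + j) = c i $$ (s + int i) * f $$ j"
    if "i \<le> k" "\<And>i. i < j \<Longrightarrow> f $$ i = 0" for i f j
    by (rule fls_mult_nth_below(2)[OF _ that(2)]) (rule c0[OF that(1)])
  \<comment> \<open>On the exponents in \<open>Z\<close> this is multiplication by the monomial of
    exponent \<open>s\<close>; it adds 1 to the diagonal exactly where \<phi> vanishes.\<close>
  define F where "F f = (\<Sum>j\<in>Z. fls_const (f $$ j) * fls_X_intpow (j + s))" for f :: "'k fls"
  have Fn: "F f $$ n = (if n - s \<in> Z then f $$ (n - s) else 0)" for f n
  proof -
    have "F f $$ n = (\<Sum>j\<in>Z. if j = n - s then f $$ j else 0)"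
      unfolding F_def fls_nth_sum
      by (rule sum.cong) (auto simp: fls_X_intpow_times_conv_shift)
    then show ?thesis using fin by simp
  qed
  have "bij (\<lambda>f. P f + F f)"
  proof (rule triangular_bij[where s = s and \<phi> = "\<lambda>j. if j \<in> Z then 1 else \<phi> j"])
    fix f j and i :: int assume f: "\<And>i. i < j \<Longrightarrow> f $$ i = (0::'k)" and i: "i < j + s"
    have "P f $$ i = 0" unfolding Pn
    proof (rule sum.neutral, safe)
      fix l assume "l \<le> k"
      then have "(c l * f) $$ (i + int l) = 0" using i by (intro mult[OF _ f]) auto
      then show "(- 1) ^ l * (pochhammer (of_int i + 1) l * (c l * f) $$ (i + int l)) = 0" by simp
    qed
    then show "(P f + F f) $$ i = 0" using f i by (simp add: Fn)
  next
    fix f j assume f: "\<And>i. i < j \<Longrightarrow> f $$ i = (0::'k)"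
    have "P f $$ (j + s) = (\<Sum>i\<le>k. a i * pochhammer (of_int j + of_int (s + 1)) i * f $$ j)"
      unfolding Pn
    proof (rule sum.cong, safe)
      fix l assume "l \<le> k"
      then have "(c l * f) $$ (j + s + int l) = c l $$ (s + int l) * f $$ j"
        using mult'[OF _ f, of l] by (simp add: add_ac)
      then show "(- 1) ^ l * (pochhammer (of_int (j + s) + 1) l * (c l * f) $$ (j + s + int l)) =
          a l * pochhammer (of_int j + of_int (s + 1)) l * f $$ j"
        by (simp add: a_def add_ac mult_ac)
    qed
    then have "P f $$ (j + s) = \<phi> j * f $$ j" by (simp add: \<phi>_def sum_distrib_right)
    then show "(P f + F f) $$ (j + s) = (if j \<in> Z then 1 else \<phi> j) * f $$ j"
      by (simp add: Fn Z_def)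
  next
    have d: "(fls_deriv ^^ i) (f + g) = (fls_deriv ^^ i) f + (fls_deriv ^^ i) g" for i and f g :: "'k fls"
      by (simp add: fls_eq_iff funpow_fls_deriv_nth algebra_simps)
    have "P (f + g) = P f + P g" "F (f + g) = F f + F g" for f g
      by (simp_all add: P_def d distrib_left sum.distrib fls_eq_iff Fn)
    then show "P (f + g) + F (f + g) = P f + F f + (P g + F g)" for f g
      by (simp add: add_ac)
    have d: "(fls_deriv ^^ i) (fls_const x * f) = fls_const x * (fls_deriv ^^ i) f" for i x and f :: "'k fls"
      by (simp add: fls_eq_iff funpow_fls_deriv_nth)
    have "F (fls_const x * f) = fls_const x * F f" for x f
      by (simp add: fls_eq_iff Fn)
    moreover have "P (fls_const x * f) = fls_const x * P f" for x f
    proof -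
      have "(- 1) ^ i * (fls_deriv ^^ i) (c i * (fls_const x * f)) =
          fls_const x * ((- 1) ^ i * (fls_deriv ^^ i) (c i * f))" for i
        by (simp only: mult.left_commute[of "c i" "fls_const x"] d mult.left_commute[of "(- 1) ^ i"])
      then show ?thesis by (simp only: P_def sum_distrib_left)
    qed
    ultimately show "P (fls_const x * f) + F (fls_const x * f) = fls_const x * (P f + F f)" for x f
      by (simp add: distrib_left)
  qed (auto simp: Z_def)
  with fin show ?thesis unfolding F_def by blast
qed

section \<open>Connections over Laurent series\<close>

text \<open>If \<open>h\<close> killed a nonzero \<open>x\<close>, extend \<open>x\<close> to a
  basis \<open>B\<close> of the span: the images of \<open>B - {x}\<close> alone would already
  generate it, and they are too few. Linearity is asked on the span only, because the maps to which
  this is applied are controlled only on a submodule of the ambient type.\<close>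

lemma (in vector_space) surjective_on_span_imp_injective:
  assumes fin: "finite T"
    and add: "\<And>x y. x \<in> span T \<Longrightarrow> y \<in> span T \<Longrightarrow> h (x + y) = h x + h y"
    and sc: "\<And>a x. x \<in> span T \<Longrightarrow> h (scale a x) = scale a (h x)"
    and surj: "h ` span T = span T"
    and x: "x \<in> span T" "h x = 0"
  shows "x = 0"
proof (rule ccontr)
  assume "x \<noteq> 0"
  then have "independent {x}" by simp
  then obtain B where B: "{x} \<subseteq> B" "B \<subseteq> span T" "independent B" "span T \<subseteq> span B"
    using maximal_independent_subset_extend[of "{x}" "span T"] x by blast
  have finB: "finite B" using independent_span_bound[OF fin B(3) B(2)] by simp
  have h0: "h 0 = 0" using sc[OF x(1), of 0] by simp
  have "h z \<in> span (h ` (B - {x}))" if "z \<in> span T" for z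
  proof -
    have "z \<in> span B" using that B by blast
    then have "z \<in> span T \<and> h z \<in> span (h ` (B - {x}))"
    proof (induction rule: span_induct_alt)
      case base then show ?case by (simp add: h0 span_zero)
    next
      case (step c b y)
      then have b: "b \<in> span T" using B by blast
      have "h b \<in> span (h ` (B - {x}))"
        using x step(1) by (cases "b = x") (auto intro: span_base simp: span_zero)
      then show ?case using step b by (simp add: add sc span_add span_scale)
    qed
    then show ?thesis by simp
  qed
  then have "h ` span T \<subseteq> span (h ` (B - {x}))" by blast
  then have "B \<subseteq> span (h ` (B - {x}))" using B(2) unfolding surj by (rule subset_trans[rotated])
  then have "card B \<le> card (h ` (B - {x}))"
    using independent_span_bound[OF finite_imageI[OF finite_Diff[OF finB]] B(3)] by simp
  also have "\<dots> \<le> card (B - {x})" using finB by (intro card_image_le) auto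
  also have "\<dots> < card B" using finB B(1) by (intro card_Diff1_less) auto
  finally show False by simp
qed

text \<open>\<open>V\<close> stands for Hom over K((T)) and \<open>VR\<close> for the image of Hom
  over the disk, both inside an ambient vector space. Of the module structure of \<open>VR\<close>
  only stability under monomials is kept, these being the coefficients that occur in the finite-rank
  corrections. The generators \<open>G\<close> of \<open>V\<close> lie in \<open>VR\<close>, so the
  filtration can be built from elements defined over the disk.\<close>

locale laurent_connection = vector_space scale
  for scale :: "'k::field_char_0 fls \<Rightarrow> 'v::ab_group_add \<Rightarrow> 'v" (infixr "\<star>" 75) +
  fixes V VR G :: "'v set" and nab :: "'v \<Rightarrow> 'v"
  assumes V_sub: "subspace V"
    and nab_V: "x \<in> V \<Longrightarrow> nab x \<in> V"
    and nab_add: "x \<in> V \<Longrightarrow> y \<in> V \<Longrightarrow> nab (x + y) = nab x + nab y"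
    and nab_scale: "x \<in> V \<Longrightarrow> nab (a \<star> x) = fls_deriv a \<star> x + a \<star> nab x"
    and VR_V: "VR \<subseteq> V"
    and VR_0: "0 \<in> VR"
    and VR_add: "x \<in> VR \<Longrightarrow> y \<in> VR \<Longrightarrow> x + y \<in> VR"
    and VR_mon: "x \<in> VR \<Longrightarrow> (fls_const c * fls_X_intpow j) \<star> x \<in> VR"
    and VR_nab: "x \<in> VR \<Longrightarrow> nab x \<in> VR"
    and fin_G: "finite G" and G_VR: "G \<subseteq> VR" and G_span: "V \<subseteq> span G"
begin

text \<open>Scalars restricted to the constants, over which \<open>nab\<close> is linear; finite
  rank is meant with respect to this structure.\<close>

sublocale K: vector_space "\<lambda>c x. fls_const c \<star> x"
  by unfold_locales (simp_all add: scale_right_distrib fls_plus_const[symmetric] scale_left_distrib)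

lemma VR_const: "x \<in> VR \<Longrightarrow> fls_const c \<star> x \<in> VR"
  using VR_mon[of x c 0] by simp

lemma VR_spanK: "X \<subseteq> VR \<Longrightarrow> x \<in> K.span X \<Longrightarrow> x \<in> VR"
  by (erule K.span_induct_alt) (auto intro: VR_0 VR_add VR_const)

lemma V_0: "0 \<in> V" and V_add: "x \<in> V \<Longrightarrow> y \<in> V \<Longrightarrow> x + y \<in> V"
  and V_scale: "x \<in> V \<Longrightarrow> a \<star> x \<in> V" and V_diff: "x \<in> V \<Longrightarrow> y \<in> V \<Longrightarrow> x - y \<in> V"
  and V_neg: "x \<in> V \<Longrightarrow> - x \<in> V"
  using V_sub by (simp_all add: subspace_0 subspace_add subspace_scale subspace_diff subspace_neg)

lemma V_sum: "(\<And>i. i \<in> I \<Longrightarrow> f i \<in> V) \<Longrightarrow> sum f I \<in> V"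
  using V_sub by (rule subspace_sum)

lemma nab_0: "nab 0 = 0"
  using nab_add[of 0 0] V_0 by simp

lemma nab_neg: "x \<in> V \<Longrightarrow> nab (- x) = - nab x"
  using nab_add[of x "- x"] nab_0 V_neg by (simp add: eq_neg_iff_add_eq_0 add.commute)

lemma nab_diff: "x \<in> V \<Longrightarrow> y \<in> V \<Longrightarrow> nab (x - y) = nab x - nab y"
  using nab_add[of x "- y"] nab_neg V_neg by simp

lemma nab_sum: "(\<And>i. i \<in> I \<Longrightarrow> f i \<in> V) \<Longrightarrow> nab (sum f I) = (\<Sum>i\<in>I. nab (f i))"
  by (induction I rule: infinite_finite_induct) (simp_all add: nab_0 nab_add V_sum)

lemma nab_const: "x \<in> V \<Longrightarrow> nab (fls_const c \<star> x) = fls_const c \<star> nab x"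
  by (simp add: nab_scale)

text \<open>Index zero in a form that passes to extensions: \<open>nab\<close> is a bijection of
  \<open>W\<close> up to a K-linear map of finite rank. As the values of that map lie in the span of
  finitely many elements of \<open>VR\<close>, every element of \<open>W\<close> is congruent to one
  of \<open>VR\<close> modulo the image of \<open>nab\<close>.\<close>

definition fredholm :: "'v set \<Rightarrow> bool" where
  "fredholm W \<longleftrightarrow> subspace W \<and> W \<subseteq> V \<and> nab ` W \<subseteq> W \<and>
    (\<exists>X F. finite X \<and> X \<subseteq> W \<inter> VR \<and> (\<forall>x\<in>W. F x \<in> K.span X) \<and>
      (\<forall>x\<in>W. \<forall>y\<in>W. F (x + y) = F x + F y) \<and>
      (\<forall>c. \<forall>x\<in>W. F (fls_const c \<star> x) = fls_const c \<star> F x) \<and>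
      bij_betw (\<lambda>x. nab x - F x) W W)"

lemma fredholm_0: "fredholm {0}"
proof -
  have "bij_betw (\<lambda>x. nab x - 0) {0} {0}" by (simp add: bij_betw_def nab_0)
  then show ?thesis unfolding fredholm_def
    using V_0 nab_0 by (auto intro!: exI[of _ "{}"] exI[of _ "\<lambda>_. 0"])
qed

text \<open>An element \<open>m\<close> outside \<open>W\<close> generates over \<open>W\<close> a submodule with basis \<open>m, \<nabla> m, \<dots>, \<nabla>\<^sup>q m\<close>.
  Modulo \<open>W\<close> and the image of the span \<open>Y\<close> of the first \<open>q\<close> of these elements, \<open>\<nabla>(z \<nabla>\<^sup>q m)\<close> is
  \<open>P z \<cdot> m\<close> for a scalar differential operator \<open>P\<close> of order \<open>q + 1\<close>; \<open>P\<close> is bijective up to an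
  operator of finite rank.\<close>

lemma fredholm_step:
  assumes W: "fredholm W" and m: "m \<in> VR" "m \<notin> W"
  shows "\<exists>W'. fredholm W' \<and> W \<subseteq> W' \<and> m \<in> W'"
proof -
  from W have Wsub: "subspace W" and WV: "W \<subseteq> V" and Wnab: "nab ` W \<subseteq> W"
    by (simp_all add: fredholm_def)
  from W obtain X F where X: "finite X" "X \<subseteq> W \<inter> VR" and FX: "\<And>x. x \<in> W \<Longrightarrow> F x \<in> K.span X"
    and F_add: "\<And>x y. x \<in> W \<Longrightarrow> y \<in> W \<Longrightarrow> F (x + y) = F x + F y"
    and F_const: "\<And>c x. x \<in> W \<Longrightarrow> F (fls_const c \<star> x) = fls_const c \<star> F x"
    and F_bij: "bij_betw (\<lambda>x. nab x - F x) W W"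
    unfolding fredholm_def by (elim conjE exE) (rule that, auto)
  note W_simps = subspace_0[OF Wsub] subspace_add[OF Wsub] subspace_scale[OF Wsub]
    subspace_diff[OF Wsub] subspace_neg[OF Wsub]
  define e where "e i = (nab ^^ i) m" for i
  have e0: "e 0 = m" and eS: "e (Suc i) = nab (e i)" for i by (simp_all add: e_def)
  have eVR: "e i \<in> VR" for i by (induction i) (auto simp: e0 eS m intro: VR_nab)
  then have eV: "e i \<in> V" for i using VR_V by blast
  define L where "L n y = (\<Sum>i<n. y i \<star> e i)" for n :: nat and y :: "nat \<Rightarrow> 'k fls"
  have LV: "L n y \<in> V" for n y unfolding L_def by (intro V_sum V_scale eV)
  have L_add: "L n y + L n y' = L n (\<lambda>i. y i + y' i)" for n y y'
    by (simp add: L_def scale_left_distrib sum.distrib)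
  have L_diff: "L n y - L n y' = L n (\<lambda>i. y i - y' i)" for n y y'
    by (simp add: L_def scale_left_diff_distrib sum_subtractf)
  have L_scale: "a \<star> L n y = L n (\<lambda>i. a * y i)" for n y a
    by (simp add: L_def scale_sum_right)
  have L_single: "a \<star> e i = L n (\<lambda>j. if j = i then a else 0)" if "i < n" for a i n
  proof -
    have "L n (\<lambda>j. if j = i then a else 0) = (\<Sum>j<n. if j = i then a \<star> e j else 0)"
      unfolding L_def by (rule sum.cong) auto
    with that show ?thesis by simp
  qed
  define U where "U n = {w + L n y | w y. w \<in> W}" for n
  have U_sub: "subspace (U n)" for n
    unfolding subspace_def
  proof (intro conjI ballI allI)
    have "0 = 0 + L n (\<lambda>_. 0)" by (simp add: L_def)
    then show "0 \<in> U n" using W_simps(1) unfolding U_def by blast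
  next
    fix x x' assume "x \<in> U n" "x' \<in> U n"
    then obtain w y w' y' where *: "w \<in> W" "w' \<in> W" "x = w + L n y" "x' = w' + L n y'"
      unfolding U_def by blast
    then have "x + x' = (w + w') + L n (\<lambda>i. y i + y' i)" by (simp flip: L_add)
    then show "x + x' \<in> U n" using * W_simps(2) unfolding U_def by blast
  next
    fix a x assume "x \<in> U n"
    then obtain w y where *: "w \<in> W" "x = w + L n y" unfolding U_def by blast
    then have "a \<star> x = a \<star> w + L n (\<lambda>i. a * y i)" by (simp add: scale_right_distrib L_scale)
    then show "a \<star> x \<in> U n" using * W_simps(3) unfolding U_def by blast
  qed
  have W_U: "W \<subseteq> U n" for n
  proof
    fix w assume "w \<in> W"
    moreover have "w = w + L n (\<lambda>_. 0)" by (simp add: L_def)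
    ultimately show "w \<in> U n" unfolding U_def by blast
  qed
  have e_U: "e i \<in> U n" if "i < n" for i n
    using L_single[OF that, of 1] W_simps(1) unfolding U_def by force
  have UV: "U n \<subseteq> V" for n unfolding U_def using WV LV V_add by blast
  \<comment> \<open>Otherwise all iterated derivatives of \<open>m\<close> would be independent over
    K((T)), which the finite set \<open>G\<close> spanning \<open>V\<close> forbids.\<close>
  have "\<exists>n. e n \<in> U n"
  proof (rule ccontr)
    assume "\<nexists>n. e n \<in> U n"
    then have not: "e n \<notin> U n" for n by blast
    have indep: "independent (e ` {..<n}) \<and> card (e ` {..<n}) = n" for n
    proof (induction n)
      case (Suc n)
      have "span (e ` {..<n}) \<subseteq> U n"
        using e_U U_sub by (intro span_minimal) auto
      with not have n: "e n \<notin> span (e ` {..<n})" by blast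
      then have "e n \<notin> e ` {..<n}" by (rule contra_subsetD[OF span_superset])
      moreover have "e ` {..<Suc n} = insert (e n) (e ` {..<n})" by (auto simp: lessThan_Suc)
      ultimately show ?case using Suc n independent_insertI[OF n] by simp
    qed (simp add: independent_empty)
    have "card (e ` {..<Suc (card G)}) \<le> card G"
      using independent_span_bound[OF fin_G, of "e ` {..<Suc (card G)}"] indep[of "Suc (card G)"]
        eV G_span by blast
    with indep[of "Suc (card G)"] show False by simp
  qed
  \<comment> \<open>Minimality makes \<open>e 0\<close>, ..., \<open>e (k - 1)\<close> independent
    modulo \<open>W\<close>, and membership at \<open>k\<close> makes \<open>U k\<close> stable
    under \<open>nab\<close>. As \<open>m\<close> is not in \<open>W\<close>, \<open>k\<close> is
    positive.\<close>
  define k where "k = (LEAST n. e n \<in> U n)"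
  have k_min: "e i \<notin> U i" if "i < k" for i
    using not_less_Least[of i "\<lambda>n. e n \<in> U n"] that by (auto simp: k_def)
  have k: "e k \<in> U k" using LeastI_ex[OF \<open>\<exists>n. e n \<in> U n\<close>] by (simp add: k_def)
  have "k \<noteq> 0"
  proof
    assume "k = 0"
    with k m(2) show False by (simp add: U_def L_def e0)
  qed
  then obtain q where q: "k = Suc q" by (cases k) auto
  from k obtain u c where u: "u \<in> W" and ek: "e k = u + L k c" unfolding U_def by blast
  have indep: "y i = 0" if "w \<in> W" "w + L k y = 0" "i < k" for w y i
  proof (rule ccontr)
    assume "y i \<noteq> 0"
    define n where "n = Max {i. i < k \<and> y i \<noteq> 0}"
    have fin: "finite {i. i < k \<and> y i \<noteq> 0}" by simp
    have n: "n < k" "y n \<noteq> 0" using Max_in[OF fin] \<open>y i \<noteq> 0\<close> \<open>i < k\<close> unfolding n_def by blast+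
    have top: "y j = 0" if "j < k" "n < j" for j
      using Max_ge[OF fin, of j] that unfolding n_def by fastforce
    have "L k y = L (Suc n) y"
      unfolding L_def using n top by (intro sum.mono_neutral_right) auto
    also have "\<dots> = L n y + y n \<star> e n" by (simp add: L_def)
    finally have "y n \<star> e n = - (w + L n y)"
      using that(2) by (simp add: algebra_simps eq_neg_iff_add_eq_0)
    moreover have "w + L n y \<in> U n" using that(1) unfolding U_def by blast
    ultimately have "y n \<star> e n \<in> U n" using subspace_neg[OF U_sub] by metis
    then have "inverse (y n) \<star> (y n \<star> e n) \<in> U n" using subspace_scale[OF U_sub] by blast
    with n k_min show False by simp
  qed
  have L_sum: "(\<Sum>i\<in>I. L n (y i)) = L n (\<lambda>j. \<Sum>i\<in>I. y i j)" for I :: "nat set" and n y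
    unfolding L_def by (subst sum.swap) (simp add: scale_sum_left)
  have nab_L: "nab (L n y) = (\<Sum>i<n. fls_deriv (y i) \<star> e i + y i \<star> e (Suc i))" for n y
    unfolding L_def by (subst nab_sum) (auto simp: nab_scale eV eS V_scale)
  have nab_U: "nab x \<in> U k" if "x \<in> U k" for x
  proof -
    from that obtain w y where x: "w \<in> W" "x = w + L k y" unfolding U_def by blast
    have "e i \<in> U k" if "i \<le> k" for i using k e_U that by (cases "i = k") auto
    then have "nab (L k y) \<in> U k" unfolding nab_L
      by (intro subspace_sum[OF U_sub] subspace_add[OF U_sub] subspace_scale[OF U_sub]) auto
    moreover have "nab w \<in> U k" using x Wnab W_U by blast
    ultimately show ?thesis using x WV LV by (auto simp: nab_add intro!: subspace_add[OF U_sub])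
  qed
  \<comment> \<open>Integration by parts: \<open>a \<star> e (n + 1)\<close> is
    \<open>nab (a \<star> e n)\<close> minus \<open>fls_deriv a \<star> e n\<close>. Iteration moves
    the whole term onto \<open>m\<close> with alternating signs, modulo derivatives of combinations
    of \<open>e 0\<close>, ..., \<open>e (q - 1)\<close>.\<close>
  have red: "\<exists>\<eta>. a \<star> e n = ((- 1) ^ n * (fls_deriv ^^ n) a) \<star> m + nab (L q \<eta>)" if "n \<le> q" for a n
    using that
  proof (induction n arbitrary: a)
    case 0
    have "nab (L q (\<lambda>_. 0)) = 0" by (simp add: L_def nab_0)
    then show ?case by (intro exI[of _ "\<lambda>_. 0"]) (simp add: e0)
  next
    case (Suc n)
    then obtain \<eta> where \<eta>: "fls_deriv a \<star> e n = ((- 1) ^ n * (fls_deriv ^^ n) (fls_deriv a)) \<star> m + nab (L q \<eta>)"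
      by (meson Suc_leD)
    from Suc have y: "a \<star> e n = L q (\<lambda>j. if j = n then a else 0)" (is "_ = L q ?y") by (intro L_single) simp
    have "nab (L q ?y) = fls_deriv a \<star> e n + a \<star> e (Suc n)"
      unfolding y[symmetric] using eV eS by (simp add: nab_scale)
    then have "a \<star> e (Suc n) = - (((- 1) ^ n * (fls_deriv ^^ n) (fls_deriv a)) \<star> m) + (nab (L q ?y) - nab (L q \<eta>))"
      using \<eta> by simp
    also have "nab (L q ?y) - nab (L q \<eta>) = nab (L q (\<lambda>j. ?y j - \<eta> j))"
      by (simp add: nab_diff[symmetric] LV L_diff)
    also have "- (((- 1) ^ n * (fls_deriv ^^ n) (fls_deriv a)) \<star> m) = ((- 1) ^ Suc n * (fls_deriv ^^ Suc n) a) \<star> m"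
      by (simp add: funpow_swap1)
    finally show ?case by blast
  qed
  then have "\<forall>a. \<forall>n\<in>{..q}. \<exists>\<eta>. a \<star> e n = ((- 1) ^ n * (fls_deriv ^^ n) a) \<star> m + nab (L q \<eta>)"
    by auto
  then obtain h where h: "\<And>a n. n \<le> q \<Longrightarrow> a \<star> e n = ((- 1) ^ n * (fls_deriv ^^ n) a) \<star> m + nab (L q (h a n))"
    unfolding bchoice_iff choice_iff by auto
  have L_red: "L k y = (\<Sum>i<k. (- 1) ^ i * (fls_deriv ^^ i) (y i)) \<star> m + nab (L q (\<lambda>j. \<Sum>i<k. h (y i) i j))" for y
  proof -
    have "L k y = (\<Sum>i<k. ((- 1) ^ i * (fls_deriv ^^ i) (y i)) \<star> m + nab (L q (h (y i) i)))"
      unfolding L_def[of k] using h q by (intro sum.cong) auto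
    then show ?thesis by (simp add: sum.distrib scale_sum_left nab_sum LV flip: L_sum)
  qed
  \<comment> \<open>The coefficient -1 at index \<open>k\<close> encodes the Leibniz term
    \<open>fls_deriv z \<star> e q\<close>: integration by parts turns it into (-1)^q times the
    derivative of \<open>z\<close> of order \<open>q + 1 = k\<close>. In particular \<open>P\<close>
    has a nonzero coefficient, as the bijectivity of its correction requires.\<close>
  define P where "P z = (\<Sum>i\<le>k. (- 1) ^ i * (fls_deriv ^^ i) ((c(k := - 1)) i * z))" for z
  have "\<exists>\<eta>. nab (z \<star> e q) = z \<star> u + P z \<star> m + nab (L q \<eta>)" for z
  proof -
    have dneg: "(fls_deriv ^^ i) (- z) = - (fls_deriv ^^ i) z" for i and z :: "'k fls"
      by (simp add: fls_eq_iff funpow_fls_deriv_nth)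
    have "nab (z \<star> e q) = fls_deriv z \<star> e q + z \<star> (u + L k c)"
      using ek by (simp add: nab_scale eV q eS)
    also have "\<dots> = z \<star> u + (fls_deriv z \<star> e q + L k (\<lambda>i. z * c i))"
      by (simp add: scale_right_distrib L_scale)
    also have "fls_deriv z \<star> e q + L k (\<lambda>i. z * c i) =
        ((- 1) ^ q * (fls_deriv ^^ q) (fls_deriv z) + (\<Sum>i<k. (- 1) ^ i * (fls_deriv ^^ i) (z * c i))) \<star> m
          + (nab (L q (h (fls_deriv z) q)) + nab (L q (\<lambda>j. \<Sum>i<k. h (z * c i) i j)))"
      unfolding L_red h[OF order.refl, of "fls_deriv z"] by (simp add: scale_left_distrib)
    also have "(- 1) ^ q * (fls_deriv ^^ q) (fls_deriv z) + (\<Sum>i<k. (- 1) ^ i * (fls_deriv ^^ i) (z * c i)) = P z"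
      unfolding P_def using q
      by (simp add: lessThan_Suc_atMost[symmetric] dneg funpow_swap1 mult.commute[of z] add.commute)
    finally show ?thesis
      by (auto simp: nab_add[symmetric] LV L_add add.assoc)
  qed
  then obtain g where g: "\<And>z. nab (z \<star> e q) = z \<star> u + P z \<star> m + nab (L q (g z))" by metis
  \<comment> \<open>Two decompositions of \<open>U k\<close> are used. For values: \<open>W\<close>,
    the multiples of \<open>m\<close>, and the image under \<open>nab\<close> of the span of
    \<open>e 0\<close>, ..., \<open>e (q - 1)\<close>. For arguments: \<open>W\<close>, the
    multiples of \<open>e q\<close>, and that span itself. From the second to the first,
    \<open>nab\<close> is triangular with diagonal blocks \<open>nab\<close> on \<open>W\<close>,
    \<open>P\<close>, and the identity.\<close>
  have dec_ex: "\<exists>w b \<eta>. w \<in> W \<and> x = w + b \<star> m + nab (L q \<eta>)" if "x \<in> U k" for x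
    using that L_red unfolding U_def by (force simp: add.assoc)
  have coord_ex: "\<exists>w z y. w \<in> W \<and> x = w + z \<star> e q + L q y" if "x \<in> U k" for x
  proof -
    from that obtain w y where "w \<in> W" "x = w + L k y" unfolding U_def by blast
    moreover have "L k y = y q \<star> e q + L q y" by (simp add: L_def q)
    ultimately show ?thesis by (auto simp: add.assoc)
  qed
  have coord_0: "w = 0 \<and> z = 0 \<and> L q y = 0" if "w \<in> W" "w + z \<star> e q + L q y = 0" for w z y
  proof -
    define y' where "y' i = (if i < q then y i else z)" for i
    have "L q y' = L q y" unfolding L_def by (rule sum.cong) (auto simp: y'_def)
    then have "L k y' = z \<star> e q + L q y" by (simp add: L_def q y'_def)
    with that have "w + L k y' = 0" by (simp add: add.assoc)
    from indep[OF that(1) this] have y'0: "y' i = 0" if "i \<le> q" for i using that q by simp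
    have "z = 0" using y'0[of q] by (simp add: y'_def)
    moreover have "L q y' = 0" using y'0 by (simp add: L_def)
    ultimately show ?thesis using that \<open>L q y' = L q y\<close> by simp
  qed
  have dec_0: "w = 0 \<and> b = 0 \<and> L q \<eta> = 0" if "w \<in> W" "w + b \<star> m + nab (L q \<eta>) = 0" for w b \<eta>
  proof -
    define y where "y i = (if i < q then \<eta> i else 0)" for i
    have Ly: "L q y = L q \<eta>" unfolding L_def by (rule sum.cong) (auto simp: y_def)
    \<comment> \<open>The coefficient of \<open>e i\<close> in
      \<open>b \<star> m + nab (L q \<eta>)\<close>: it is \<open>y (i - 1)\<close>, with
      \<open>b\<close> in that place for \<open>i = 0\<close>, plus the derivative of
      \<open>y i\<close>. The default \<open>y q = 0\<close> makes the formula valid at the top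
      index.\<close>
    define z where "z i = (case i of 0 \<Rightarrow> b | Suc j \<Rightarrow> y j) + fls_deriv (y i)" for i
    have "L k z = (\<Sum>i<Suc q. (case i of 0 \<Rightarrow> b | Suc j \<Rightarrow> y j) \<star> e i) + (\<Sum>i<Suc q. fls_deriv (y i) \<star> e i)"
      unfolding L_def q z_def by (simp only: scale_left_distrib sum.distrib)
    also have "(\<Sum>i<Suc q. (case i of 0 \<Rightarrow> b | Suc j \<Rightarrow> y j) \<star> e i) = b \<star> m + (\<Sum>i<q. y i \<star> e (Suc i))"
      by (subst sum.lessThan_Suc_shift) (simp add: e0)
    also have "(\<Sum>i<Suc q. fls_deriv (y i) \<star> e i) = (\<Sum>i<q. fls_deriv (y i) \<star> e i)"
      by (simp add: y_def)
    finally have "L k z = b \<star> m + nab (L q \<eta>)"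
      unfolding Ly[symmetric] nab_L by (simp add: sum.distrib add_ac)
    with that have "w + L k z = 0" by (simp add: add.assoc)
    from indep[OF that(1) this] have z0: "z i = 0" if "i \<le> q" for i using that q by simp
    \<comment> \<open>Downward from \<open>y q = 0\<close>: once \<open>y (i + 1)\<close> vanishes,
      so does its derivative, and the vanishing coefficient of \<open>e (i + 1)\<close> leaves
      \<open>y i = 0\<close>.\<close>
    have y0: "j \<le> q \<Longrightarrow> y (q - j) = 0" for j
    proof (induction j)
      case 0 show ?case by (simp add: y_def)
    next
      case (Suc j)
      then obtain i where i: "q - j = Suc i" "q - Suc j = i" by (metis Suc_diff_Suc Suc_le_lessD)
      with Suc have "z (Suc i) = 0" "y (Suc i) = 0" by (auto intro!: z0)
      then show ?case by (simp add: z_def i)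
    qed
    have "y i = 0" if "i \<le> q" for i using y0[of "q - i"] that by simp
    moreover from this have "b = 0" using z0[of 0] by (simp add: z_def)
    ultimately have "L q y = 0" "b = 0" by (simp_all add: L_def)
    with that Ly show ?thesis by (simp add: nab_0)
  qed
  have coord_eq: "w = w' \<and> z = z' \<and> L q y = L q y'"
    if "w \<in> W" "w' \<in> W" "w + z \<star> e q + L q y = w' + z' \<star> e q + L q y'" for w w' z z' y y'
  proof -
    have "(w - w') + (z - z') \<star> e q + L q (\<lambda>i. y i - y' i) = 0"
      using that(3) by (simp add: scale_left_diff_distrib algebra_simps flip: L_diff)
    from coord_0[OF _ this] show ?thesis using that W_simps(4) by (simp flip: L_diff)
  qed
  have dec_eq: "w = w' \<and> b = b' \<and> L q y = L q y'"
    if "w \<in> W" "w' \<in> W" "w + b \<star> m + nab (L q y) = w' + b' \<star> m + nab (L q y')" for w w' b b' y y'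
  proof -
    have "(w - w') + (b - b') \<star> m + nab (L q (\<lambda>i. y i - y' i)) = 0"
      using that(3) by (simp add: scale_left_diff_distrib nab_diff LV algebra_simps flip: L_diff)
    from dec_0[OF _ this] show ?thesis using that W_simps(4) by (simp flip: L_diff)
  qed
  from coord_ex obtain wc zc yc
    where wc: "\<And>x. x \<in> U k \<Longrightarrow> wc x \<in> W" and coord: "\<And>x. x \<in> U k \<Longrightarrow> x = wc x + zc x \<star> e q + L q (yc x)"
    by metis
  have coordI: "wc x = w \<and> zc x = z \<and> L q (yc x) = L q y"
    if "x \<in> U k" "w \<in> W" "x = w + z \<star> e q + L q y" for x w z y
    by (rule coord_eq) (use that coord wc in metis)+
  have U_I: "w + z \<star> e q + L q y \<in> U k" if "w \<in> W" for w z y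
  proof -
    have "e q \<in> U k" "e i \<in> U k" if "i < q" for i using that q by (auto intro!: e_U)
    moreover have "L q y \<in> U k" unfolding L_def using calculation
      by (intro subspace_sum[OF U_sub] subspace_scale[OF U_sub]) auto
    moreover have "e q \<in> U k" using q by (intro e_U) auto
    ultimately show ?thesis using that W_U by (intro subspace_add[OF U_sub] subspace_scale[OF U_sub]) auto
  qed
  have coord_add: "wc (x + x') = wc x + wc x' \<and> zc (x + x') = zc x + zc x'" if "x \<in> U k" "x' \<in> U k" for x x'
  proof -
    have "x + x' = (wc x + wc x') + (zc x + zc x') \<star> e q + L q (\<lambda>i. yc x i + yc x' i)"
      using arg_cong2[OF coord[OF that(1)] coord[OF that(2)], of "(+)"]
      by (simp add: scale_left_distrib add_ac flip: L_add)
    from coordI[OF subspace_add[OF U_sub that] W_simps(2)[OF wc wc] this] that show ?thesis by blast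
  qed
  have coord_scale: "wc (a \<star> x) = a \<star> wc x \<and> zc (a \<star> x) = a * zc x" if "x \<in> U k" for a x
  proof -
    have "a \<star> x = a \<star> wc x + (a * zc x) \<star> e q + L q (\<lambda>i. a * yc x i)"
      using arg_cong[OF coord[OF that], of "\<lambda>x. a \<star> x"] by (simp add: scale_right_distrib flip: L_scale)
    from coordI[OF subspace_scale[OF U_sub that] W_simps(3)[OF wc[OF that]] this] show ?thesis by blast
  qed
  obtain Z s where Z: "finite Z" and bijP: "bij (\<lambda>f. P f + (\<Sum>j\<in>Z. fls_const (f $$ j) * fls_X_intpow (j + s)))"
    using differential_operator_bij[of k k "c(k := - 1)"] unfolding P_def by auto
  define Q where "Q f = (\<Sum>j\<in>Z. fls_const (f $$ j) * fls_X_intpow (j + s))" for f :: "'k fls"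
  note bijP = bijP[folded Q_def]
  \<comment> \<open>The finite-rank map of \<open>W\<close> acts on the \<open>W\<close>-component,
    while the correction of \<open>P\<close> acts on the coordinate of \<open>e q\<close> and lands
    on monomial multiples of \<open>m\<close>, hence in \<open>VR\<close>. With the minus sign the
    middle diagonal block of \<open>nab - F'\<close> becomes \<open>P + Q\<close>.\<close>
  define F' where "F' x = F (wc x) - Q (zc x) \<star> m" for x
  define N where "N x = nab x - F' x" for x
  have N_eq: "N x = (nab (wc x) - F (wc x) + zc x \<star> u) + (P (zc x) + Q (zc x)) \<star> m +
      nab (L q (\<lambda>i. g (zc x) i + yc x i))" if "x \<in> U k" for x
  proof -
    have wV: "wc x \<in> V" using wc[OF that] WV by blast
    have "nab x = nab (wc x + zc x \<star> e q + L q (yc x))" using coord[OF that] by simp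
    also have "\<dots> = nab (wc x) + nab (zc x \<star> e q) + nab (L q (yc x))"
      using wV by (simp add: nab_add V_add V_scale eV LV)
    finally show ?thesis
      by (simp add: N_def F'_def g nab_add LV scale_left_distrib algebra_simps flip: L_add)
  qed
  have N_W: "nab (wc x) - F (wc x) + zc x \<star> u \<in> W" if "x \<in> U k" for x
    using wc[OF that] bij_betw_imp_surj_on[OF F_bij] u W_simps by blast
  have XW: "K.span X \<subseteq> W"
  proof
    fix x assume "x \<in> K.span X"
    then show "x \<in> W" by (induction rule: K.span_induct_alt) (use X W_simps in auto)
  qed
  have mU: "m \<in> U k" using e_U[of 0 k] q e0 by simp
  show ?thesis
  proof (intro exI conjI)
    show "W \<subseteq> U k" by (rule W_U)
    show "m \<in> U k" by (rule mU)
    have "bij_betw N (U k) (U k)"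
      unfolding bij_betw_def
    proof
      show "inj_on N (U k)"
      proof
        fix x x' assume x: "x \<in> U k" "x' \<in> U k" and N: "N x = N x'"
        have *: "nab (wc x) - F (wc x) + zc x \<star> u = nab (wc x') - F (wc x') + zc x' \<star> u"
            "P (zc x) + Q (zc x) = P (zc x') + Q (zc x')"
            "L q (\<lambda>i. g (zc x) i + yc x i) = L q (\<lambda>i. g (zc x') i + yc x' i)"
          using dec_eq[OF N_W[OF x(1)] N_W[OF x(2)] N[unfolded N_eq[OF x(1)] N_eq[OF x(2)]]] by simp_all
        from *(2) have z: "zc x = zc x'" by (rule injD[OF bij_is_inj[OF bijP]])
        with *(1) have "nab (wc x) - F (wc x) = nab (wc x') - F (wc x')" by simp
        then have w: "wc x = wc x'" by (rule inj_onD[OF bij_betw_imp_inj_on[OF F_bij] _ wc wc]) (rule x)+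
        from *(3) z have "L q (yc x) = L q (yc x')" by (simp flip: L_add)
        with w z show "x = x'" using coord[OF x(1)] coord[OF x(2)] by simp
      qed
      show "N ` U k = U k"
      proof
        show "N ` U k \<subseteq> U k"
        proof (rule image_subsetI)
          fix x assume x: "x \<in> U k"
          have "F (wc x) \<in> U k" using FX[OF wc[OF x]] XW W_U by blast
          then show "N x \<in> U k" unfolding N_def F'_def using nab_U[OF x] mU
            by (intro subspace_diff[OF U_sub] subspace_scale[OF U_sub])
        qed
        show "U k \<subseteq> N ` U k"
        proof
          fix x assume "x \<in> U k"
          from dec_ex[OF this] obtain wb b \<zeta> where x: "wb \<in> W" "x = wb + b \<star> m + nab (L q \<zeta>)" by blast
          \<comment> \<open>Back substitution along the triangular form: the coordinate of
            \<open>e q\<close> is found from \<open>b\<close>, then the \<open>W\<close>-component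
            after removing \<open>z \<star> u\<close>, then the remaining coordinates after removing
            \<open>g z\<close>.\<close>
          obtain z where z: "P z + Q z = b" using surjD[OF bij_is_surj[OF bijP], of b] by blast
          have "wb - z \<star> u \<in> W" using x u W_simps by blast
          then have "wb - z \<star> u \<in> (\<lambda>x. nab x - F x) ` W"
            using bij_betw_imp_surj_on[OF F_bij] by simp
          then obtain w where w: "w \<in> W" "nab w - F w = wb - z \<star> u" by auto
          define x' where "x' = w + z \<star> e q + L q (\<lambda>i. \<zeta> i - g z i)"
          have x'U: "x' \<in> U k" unfolding x'_def using w(1) by (rule U_I)
          from coordI[OF x'U w(1) x'_def] have c: "wc x' = w" "zc x' = z"
            "L q (yc x') = L q (\<lambda>i. \<zeta> i - g z i)" by auto
          have "N x' = x" by (simp add: N_eq[OF x'U] c w z x flip: L_add L_diff)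
          with x'U show "x \<in> N ` U k" by blast
        qed
      qed
    qed
    moreover have "F' x \<in> K.span (X \<union> (\<lambda>j. fls_X_intpow (j + s) \<star> m) ` Z)" if "x \<in> U k" for x
    proof -
      have "F (wc x) \<in> K.span (X \<union> (\<lambda>j. fls_X_intpow (j + s) \<star> m) ` Z)"
        using FX[OF wc[OF that]] K.span_mono[of X] by blast
      moreover have "Q (zc x) \<star> m = (\<Sum>j\<in>Z. fls_const (zc x $$ j) \<star> (fls_X_intpow (j + s) \<star> m))"
        by (simp add: Q_def scale_sum_left)
      moreover have "\<dots> \<in> K.span (X \<union> (\<lambda>j. fls_X_intpow (j + s) \<star> m) ` Z)"
        by (intro K.span_sum K.span_scale K.span_base) auto
      ultimately show ?thesis by (simp add: F'_def K.span_diff)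
    qed
    moreover have "F' (x + y) = F' x + F' y" if "x \<in> U k" "y \<in> U k" for x y
    proof -
      have "Q (a + b) = Q a + Q b" for a b
        by (simp add: Q_def sum.distrib distrib_right flip: fls_plus_const)
      then show ?thesis using that by (simp add: F'_def coord_add F_add wc scale_left_distrib)
    qed
    moreover have "F' (fls_const a \<star> x) = fls_const a \<star> F' x" if "x \<in> U k" for a x
    proof -
      have "Q (fls_const a * z) = fls_const a * Q z" for z
        by (simp add: Q_def sum_distrib_left mult.assoc[symmetric])
      then show ?thesis using that by (simp add: F'_def coord_scale F_const wc scale_right_diff_distrib)
    qed
    moreover have "finite (X \<union> (\<lambda>j. fls_X_intpow (j + s) \<star> m) ` Z)" using X Z by simp
    moreover have "X \<union> (\<lambda>j. fls_X_intpow (j + s) \<star> m) ` Z \<subseteq> U k \<inter> VR"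
    proof (intro Un_least image_subsetI)
      show "X \<subseteq> U k \<inter> VR" using X(2) W_U by blast
      show "fls_X_intpow (j + s) \<star> m \<in> U k \<inter> VR" for j
        using VR_mon[OF m(1), of 1 "j + s"] subspace_scale[OF U_sub mU] by simp
    qed
    ultimately show "fredholm (U k)"
      unfolding fredholm_def N_def using U_sub UV nab_U
      by (intro conjI exI[of _ "X \<union> (\<lambda>j. fls_X_intpow (j + s) \<star> m) ` Z"] exI[of _ F']) auto
  qed
qed

text \<open>The generators are adjoined one at a time; each is already present or enlarges the
  submodule by a step. A submodule of \<open>V\<close> containing all of \<open>G\<close> is
  \<open>V\<close>.\<close>

lemma fredholm_V: "fredholm V"
proof -
  have "\<exists>W. fredholm W \<and> G' \<subseteq> W" if "G' \<subseteq> G" for G'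
    using finite_subset[OF that fin_G] that
  proof (induction G' rule: finite_induct)
    case empty
    then show ?case using fredholm_0 by blast
  next
    case (insert g G')
    then obtain W where W: "fredholm W" "G' \<subseteq> W" by auto
    have "g \<in> VR" using insert G_VR by auto
    show ?case
    proof (cases "g \<in> W")
      case False
      from fredholm_step[OF W(1) \<open>g \<in> VR\<close> this] W(2) show ?thesis by fastforce
    qed (use W in auto)
  qed
  then obtain W where W: "fredholm W" "G \<subseteq> W" by blast
  then have "subspace W" "W \<subseteq> V" by (simp_all add: fredholm_def)
  with W(2) have "span G \<subseteq> W" by (simp add: span_minimal)
  with G_span \<open>W \<subseteq> V\<close> have "W = V" by blast
  with W show ?thesis by simp
qed

text \<open>Surjectivity in degree one holds because \<open>\<nabla>\<close> differs from a bijection by a map into \<open>VR\<close>. For the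
  rest, let \<open>\<kappa>\<^sup>*\<close> be functionals dual to \<open>\<kappa>\<close>: the map \<open>\<nabla> + \<Sum>\<^sub>j \<kappa>\<^sup>*\<^sub>j c\<^sub>j\<close> is surjective, hence injective, being
  a bijection plus a map of finite rank.\<close>

theorem comparison:
  fixes \<kappa> c :: "nat \<Rightarrow> 'v" and p :: nat
  assumes \<kappa>: "\<And>j. j < p \<Longrightarrow> \<kappa> j \<in> VR" "\<And>j. j < p \<Longrightarrow> nab (\<kappa> j) = 0"
    and indep: "\<And>\<mu>. (\<Sum>j<p. fls_const (\<mu> j) \<star> \<kappa> j) = 0 \<Longrightarrow> \<forall>j<p. \<mu> j = 0"
    and c: "\<And>j. j < p \<Longrightarrow> c j \<in> VR"
    and gen: "\<And>x. x \<in> VR \<Longrightarrow> \<exists>\<mu>. \<exists>y\<in>VR. x = (\<Sum>j<p. fls_const (\<mu> j) \<star> c j) + nab y"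
  shows "x \<in> V \<Longrightarrow> nab x = 0 \<Longrightarrow> x \<in> VR"
    and "y \<in> V \<Longrightarrow> nab y \<in> VR \<Longrightarrow> \<exists>z\<in>VR. nab z = nab y"
    and "x \<in> V \<Longrightarrow> \<exists>z\<in>VR. \<exists>y\<in>V. x = z + nab y"
proof -
  from fredholm_V obtain X F where X: "finite X" "X \<subseteq> V \<inter> VR" and FX: "\<And>x. x \<in> V \<Longrightarrow> F x \<in> K.span X"
    and F_add: "\<And>x y. x \<in> V \<Longrightarrow> y \<in> V \<Longrightarrow> F (x + y) = F x + F y"
    and F_const: "\<And>c x. x \<in> V \<Longrightarrow> F (fls_const c \<star> x) = fls_const c \<star> F x"
    and F_bij: "bij_betw (\<lambda>x. nab x - F x) V V"
    unfolding fredholm_def by (elim conjE exE) (rule that, auto)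
  have FVR: "F x \<in> VR" if "x \<in> V" for x
    using VR_spanK[OF _ FX[OF that]] X by blast
  have surj1: "\<exists>z\<in>VR. \<exists>y\<in>V. x = z + nab y" if "x \<in> V" for x
  proof -
    from that have "x \<in> (\<lambda>x. nab x - F x) ` V" using bij_betw_imp_surj_on[OF F_bij] by simp
    then obtain y where y: "y \<in> V" "x = nab y - F y" by auto
    have "x = fls_const (- 1) \<star> F y + nab y" using y by simp
    with VR_const[OF FVR[OF y(1)], of "- 1"] y(1) show ?thesis by blast
  qed
  then show "x \<in> V \<Longrightarrow> \<exists>z\<in>VR. \<exists>y\<in>V. x = z + nab y" .
  interpret KK: vector_space_pair "\<lambda>c x. fls_const c \<star> x" "(*) :: 'k \<Rightarrow> 'k \<Rightarrow> 'k"
    by unfold_locales (simp_all add: algebra_simps)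
  have inj: "inj_on \<kappa> {..<p}"
  proof (rule inj_onI, rule ccontr)
    fix i j assume ij: "i \<in> {..<p}" "j \<in> {..<p}" "\<kappa> i = \<kappa> j" "i \<noteq> j"
    let ?\<mu> = "\<lambda>l. if l = i then 1 else if l = j then - 1 else (0::'k)"
    have "(\<Sum>l<p. fls_const (?\<mu> l) \<star> \<kappa> l) = (\<Sum>l\<in>{i, j}. fls_const (?\<mu> l) \<star> \<kappa> l)"
      using ij by (intro sum.mono_neutral_right) auto
    also have "\<dots> = 0" using ij by simp
    finally show False using indep[of ?\<mu>, THEN spec, of i, THEN mp] ij by simp
  qed
  have "K.independent (\<kappa> ` {..<p})"
  proof (rule K.independent_if_scalars_zero)
    fix f x assume f: "(\<Sum>x\<in>\<kappa> ` {..<p}. fls_const (f x) \<star> x) = 0" and x: "x \<in> \<kappa> ` {..<p}"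
    then show "f x = 0" using indep[of "\<lambda>j. f (\<kappa> j)"] by (auto simp: sum.reindex[OF inj])
  qed simp
  have "\<exists>g. Vector_Spaces.linear (\<lambda>c x. fls_const c \<star> x) (*) g \<and> (\<forall>i<p. g (\<kappa> i) = (if i = j then 1 else 0))" for j
  proof -
    obtain g where g: "Vector_Spaces.linear (\<lambda>c x. fls_const c \<star> x) (*) g"
        "\<forall>x\<in>\<kappa> ` {..<p}. g x = (if j < p \<and> x = \<kappa> j then 1 else 0)"
      using KK.linear_independent_extend[OF \<open>K.independent (\<kappa> ` {..<p})\<close>,
          of "\<lambda>x. if j < p \<and> x = \<kappa> j then 1 else 0"] by (elim exE conjE) (rule that)
    have "g (\<kappa> i) = (if i = j then 1 else 0)" if "i < p" for i
      using g(2) that inj_onD[OF inj, of i j] by auto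
    with g(1) show ?thesis by blast
  qed
  then obtain \<kappa>' where \<kappa>'_lin: "\<And>j. Vector_Spaces.linear (\<lambda>c x. fls_const c \<star> x) (*) (\<kappa>' j)"
    and \<kappa>'\<kappa>: "\<And>i j. i < p \<Longrightarrow> \<kappa>' j (\<kappa> i) = (if i = j then 1 else 0)" by metis
  have \<kappa>'_add: "\<kappa>' j (x + y) = \<kappa>' j x + \<kappa>' j y" and \<kappa>'_const: "\<kappa>' j (fls_const a \<star> x) = a * \<kappa>' j x" for j x y a
    using \<kappa>'_lin[of j] by (simp_all add: KK.linear_add KK.linear_scale)
  have \<kappa>'_sum: "\<kappa>' j (\<Sum>i\<in>I. f i) = (\<Sum>i\<in>I. \<kappa>' j (f i))" for j f and I :: "nat set"
    using \<kappa>'_lin[of j] by (rule KK.linear_sum)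
  have \<kappa>V: "\<kappa> j \<in> V" and cV: "c j \<in> V" if "j < p" for j using \<kappa> c VR_V that by blast+
  define N where "N x = nab x - F x" for x
  \<comment> \<open>\<open>E\<close> collects all terms of finite rank: \<open>N\<close> is
    bijective, and \<open>N + E\<close> is \<open>nab\<close> plus the sum of the \<open>c j\<close>
    weighted by the functionals dual to \<kappa>.\<close>
  define E where "E x = F x + (\<Sum>j<p. fls_const (\<kappa>' j x) \<star> c j)" for x
  define T where "T = X \<union> c ` {..<p}"
  have TV: "T \<subseteq> V" using X cV by (auto simp: T_def)
  have spanT: "K.span T \<subseteq> V"
  proof
    fix x assume "x \<in> K.span T"
    then show "x \<in> V" by (induction rule: K.span_induct_alt) (use TV V_0 V_add V_scale in auto)
  qed
  have ET: "E x \<in> K.span T" if "x \<in> V" for x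
    unfolding E_def
  proof (intro K.span_add K.span_sum K.span_scale)
    show "F x \<in> K.span T" using FX[OF that] K.span_mono[of X T] by (auto simp: T_def)
    show "c j \<in> K.span T" if "j \<in> {..<p}" for j using that by (auto intro: K.span_base simp: T_def)
  qed
  have NE: "N x + E x = nab x + (\<Sum>j<p. fls_const (\<kappa>' j x) \<star> c j)" for x
    by (simp add: N_def E_def)
  have nab_\<kappa>: "nab (\<Sum>j<p. fls_const (\<mu> j) \<star> \<kappa> j) = 0" for \<mu>
    by (subst nab_sum) (auto simp: \<kappa>V V_scale nab_const \<kappa>)
  have \<kappa>'_comb: "\<kappa>' i (\<Sum>j<p. fls_const (\<mu> j) \<star> \<kappa> j) = \<mu> i" if "i < p" for \<mu> i
    using that by (simp add: \<kappa>'_sum \<kappa>'_const \<kappa>'\<kappa> if_distrib[of "(*) _"] cong: if_cong)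
  have \<kappa>VV: "(\<Sum>j<p. fls_const (\<mu> j) \<star> \<kappa> j) \<in> V" for \<mu> by (intro V_sum V_scale \<kappa>V) simp
  have surj: "\<exists>y\<in>V. N y + E y = x" if x: "x \<in> V" for x
  proof -
    from surj1[OF x] obtain z y where zy: "z \<in> VR" "y \<in> V" "x = z + nab y" by blast
    from gen[OF zy(1)] obtain \<mu> y' where y': "y' \<in> VR" "z = (\<Sum>j<p. fls_const (\<mu> j) \<star> c j) + nab y'" by blast
    then have y'V: "y' \<in> V" using VR_V by blast
    \<comment> \<open>A horizontal correction: adding it leaves \<open>nab\<close> unchanged and
      brings the functionals to the values \<mu>, so that the weighted sum of the \<open>c j\<close>
      is exactly the one occurring in \<open>z\<close>.\<close>
    define k where "k = (\<Sum>j<p. fls_const (\<mu> j - \<kappa>' j (y + y')) \<star> \<kappa> j)"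
    have kV: "k \<in> V" unfolding k_def by (rule \<kappa>VV)
    have nk: "nab k = 0" unfolding k_def by (rule nab_\<kappa>)
    have "\<kappa>' j (y + y' + k) = \<mu> j" if "j < p" for j
      unfolding \<kappa>'_add[of j "y + y'"] k_def \<kappa>'_comb[OF that] by simp
    then have "N (y + y' + k) + E (y + y' + k) = x"
      unfolding NE using zy y' y'V kV nk by (simp add: nab_add V_add)
    then show ?thesis using zy y'V kV V_add by blast
  qed
  have N_add: "N (x + y) = N x + N y" and E_add: "E (x + y) = E x + E y" if "x \<in> V" "y \<in> V" for x y
    using that by (simp_all add: N_def E_def nab_add F_add \<kappa>'_add scale_left_distrib sum.distrib flip: fls_plus_const)
  have N_const: "N (fls_const a \<star> x) = fls_const a \<star> N x" if "x \<in> V" for x a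
    using that by (simp add: N_def nab_const F_const scale_right_diff_distrib)
  have E_const: "E (fls_const a \<star> x) = fls_const a \<star> E x" if "x \<in> V" for x a
    using that by (simp add: E_def F_const \<kappa>'_const scale_right_distrib scale_sum_right)
  have N_bij: "bij_betw N V V" using F_bij by (simp add: N_def[abs_def])
  \<comment> \<open>\<open>N + E\<close> is \<open>h\<close> after \<open>N\<close>. Since
    \<open>h\<close> is the identity plus a map into the finite-dimensional span of
    \<open>T\<close>, it preserves that span; surjectivity of \<open>N + E\<close> makes
    \<open>h\<close> surjective there, hence injective, and injectivity returns to
    \<open>N + E\<close>.\<close>
  define h where "h x = x + E (inv_into V N x)" for x
  have Ninv: "inv_into V N x \<in> V" "N (inv_into V N x) = x" if "x \<in> V" for x
    using that N_bij by (auto simp: bij_betw_def inv_into_into f_inv_into_f)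
  have Ninv_eq: "inv_into V N (N x) = x" if "x \<in> V" for x
    using N_bij that by (simp add: bij_betw_def inv_into_f_f)
  have h_inj: "x = 0" if "x \<in> K.span T" "h x = 0" for x
  proof (rule K.surjective_on_span_imp_injective[of T h])
    show "finite T" using X by (simp add: T_def)
    show "h ` K.span T = K.span T"
    proof
      show "h ` K.span T \<subseteq> K.span T"
        using ET Ninv spanT by (auto simp: h_def intro!: K.span_add)
      show "K.span T \<subseteq> h ` K.span T"
      proof
        fix t assume t: "t \<in> K.span T"
        then obtain y where y: "y \<in> V" "N y + E y = t" using surj spanT by blast
        then have "N y = t - E y" by (simp add: eq_diff_eq)
        then have "N y \<in> K.span T" using t ET[OF y(1)] by (simp add: K.span_diff)
        moreover have "h (N y) = t" using y by (simp add: h_def Ninv_eq)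
        ultimately show "t \<in> h ` K.span T" by blast
      qed
    qed
  next
    fix x y assume "x \<in> K.span T" "y \<in> K.span T"
    then have xy: "x \<in> V" "y \<in> V" using spanT by blast+
    have "inv_into V N (x + y) = inv_into V N x + inv_into V N y"
      using xy Ninv N_add Ninv_eq V_add by metis
    then show "h (x + y) = h x + h y" using xy by (simp add: h_def E_add Ninv)
  next
    fix a x assume "x \<in> K.span T"
    then have x: "x \<in> V" using spanT by blast
    have "inv_into V N (fls_const a \<star> x) = fls_const a \<star> inv_into V N x"
      using x Ninv N_const Ninv_eq V_scale by metis
    then show "h (fls_const a \<star> x) = fls_const a \<star> h x" using x by (simp add: h_def E_const Ninv scale_right_distrib)
  qed (use that in auto)
  have inj_V: "x = 0" if "x \<in> V" "N x + E x = 0" for x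
  proof -
    have "N x = fls_const (- 1) \<star> E x" using that(2) by (simp add: eq_neg_iff_add_eq_0)
    then have "N x \<in> K.span T" using K.span_scale[OF ET[OF that(1)]] by metis
    moreover have "h (N x) = 0" using that by (simp add: h_def Ninv_eq)
    ultimately have "N x = 0" by (rule h_inj)
    moreover have "N 0 = 0" using N_const[of 0 0] V_0 by simp
    ultimately show ?thesis using Ninv_eq[OF that(1)] Ninv_eq[OF V_0] by simp
  qed
  \<comment> \<open>On \<open>x - k - l\<close> the functionals take the values -\<mu> while the
    derivative is that of \<open>x\<close>, so \<open>N + E\<close> kills it. Evaluating the
    functionals on \<open>x = k + l\<close> then forces \<mu> to vanish, and \<open>l\<close> with
    it. Thus no nontrivial combination of the \<open>c j\<close> is a derivative, and horizontal
    elements are combinations of \<kappa>.\<close>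
  have key: "x = k \<and> (\<forall>j<p. \<mu> j = 0)"
    if x: "x \<in> V" "nab x = (\<Sum>j<p. fls_const (\<mu> j) \<star> c j)" "k = (\<Sum>j<p. fls_const (\<kappa>' j x) \<star> \<kappa> j)" for x \<mu> k
  proof -
    define l where "l = (\<Sum>j<p. fls_const (\<mu> j) \<star> \<kappa> j)"
    have V: "k \<in> V" "l \<in> V" unfolding that(3) l_def by (rule \<kappa>VV)+
    have nkl: "nab k = 0" "nab l = 0" unfolding that(3) l_def by (rule nab_\<kappa>)+
    have "\<kappa>' j (x - k - l) = - \<mu> j" if "j < p" for j
    proof -
      have "\<kappa>' j x = \<kappa>' j (x - k - l) + (\<kappa>' j k + \<kappa>' j l)"
        unfolding \<kappa>'_add[symmetric] by simp
      moreover have "\<kappa>' j k = \<kappa>' j x" "\<kappa>' j l = \<mu> j"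
        unfolding x(3) l_def by (rule \<kappa>'_comb[OF that])+
      ultimately show ?thesis by (simp add: eq_neg_iff_add_eq_0)
    qed
    then have "N (x - k - l) + E (x - k - l) = 0"
      unfolding NE using x V nkl by (simp add: nab_diff V_diff sum_negf)
    then have xkl: "x = k + l" using inj_V V x V_diff by (metis diff_diff_eq eq_iff_diff_eq_0)
    have "\<mu> j = 0" if "j < p" for j
    proof -
      have "\<kappa>' j x = \<kappa>' j k + \<kappa>' j l" unfolding xkl by (rule \<kappa>'_add)
      moreover have "\<kappa>' j k = \<kappa>' j x" "\<kappa>' j l = \<mu> j"
        unfolding x(3) l_def by (rule \<kappa>'_comb[OF that])+
      ultimately show ?thesis by simp
    qed
    then show ?thesis using xkl by (simp add: l_def)
  qed
  show "x \<in> VR" if "x \<in> V" "nab x = 0"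
  proof -
    have "x = (\<Sum>j<p. fls_const (\<kappa>' j x) \<star> \<kappa> j)" using key[OF that(1), of "\<lambda>_. 0"] that(2) by simp
    also have "\<dots> \<in> K.span (\<kappa> ` {..<p})" by (intro K.span_sum K.span_scale K.span_base) auto
    finally show ?thesis using VR_spanK[of "\<kappa> ` {..<p}"] \<kappa> by blast
  qed
  show "\<exists>z\<in>VR. nab z = nab y" if y: "y \<in> V" "nab y \<in> VR"
  proof -
    from gen[OF y(2)] obtain \<mu> z where z: "z \<in> VR" "nab y = (\<Sum>j<p. fls_const (\<mu> j) \<star> c j) + nab z" by blast
    have "z \<in> V" using z VR_V by blast
    then have "nab (y - z) = (\<Sum>j<p. fls_const (\<mu> j) \<star> c j)" using y z by (simp add: nab_diff)
    from key[OF V_diff[OF y(1) \<open>z \<in> V\<close>] this refl] have "\<forall>j<p. \<mu> j = 0" by blast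
    with z show ?thesis by auto
  qed
qed

end

section \<open>Linear maps of differential modules\<close>

text \<open>Common ground of linear maps and connections: a connection is additive without being
  linear over the ring, and the rules for zero, negatives, differences and finite sums are shared by
  both.\<close>

definition add_hom :: "('a, 'c) ring_scheme \<Rightarrow> ('b, 'e) ring_scheme \<Rightarrow> ('a \<Rightarrow> 'b) \<Rightarrow> bool" where
  "add_hom M N f \<longleftrightarrow> f \<in> carrier M \<rightarrow> carrier N \<and>
     (\<forall>x\<in>carrier M. \<forall>y\<in>carrier M. f (x \<oplus>\<^bsub>M\<^esub> y) = f x \<oplus>\<^bsub>N\<^esub> f y)"

lemma add_homI:
  "(\<And>x. x \<in> carrier M \<Longrightarrow> f x \<in> carrier N) \<Longrightarrow>
   (\<And>x y. x \<in> carrier M \<Longrightarrow> y \<in> carrier M \<Longrightarrow> f (x \<oplus>\<^bsub>M\<^esub> y) = f x \<oplus>\<^bsub>N\<^esub> f y) \<Longrightarrow> add_hom M N f"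
  by (simp add: add_hom_def)

context
  fixes M :: "('a, 'c) ring_scheme" and N :: "('b, 'e) ring_scheme" and f :: "'a \<Rightarrow> 'b"
  assumes M: "abelian_group M" and N: "abelian_group N" and f: "add_hom M N f"
begin

interpretation M: abelian_group M by (rule M)
interpretation N: abelian_group N by (rule N)

lemma add_hom_closed: "x \<in> carrier M \<Longrightarrow> f x \<in> carrier N"
  using f by (auto simp: add_hom_def)

lemma add_hom_add: "x \<in> carrier M \<Longrightarrow> y \<in> carrier M \<Longrightarrow> f (x \<oplus>\<^bsub>M\<^esub> y) = f x \<oplus>\<^bsub>N\<^esub> f y"
  using f by (auto simp: add_hom_def)

lemma add_hom_zero: "f \<zero>\<^bsub>M\<^esub> = \<zero>\<^bsub>N\<^esub>"
  using add_hom_add[of "\<zero>\<^bsub>M\<^esub>" "\<zero>\<^bsub>M\<^esub>"] add_hom_closed[of "\<zero>\<^bsub>M\<^esub>"] by (simp add: N.add.l_cancel_one')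

lemma add_hom_neg: "x \<in> carrier M \<Longrightarrow> f (\<ominus>\<^bsub>M\<^esub> x) = \<ominus>\<^bsub>N\<^esub> f x"
  using add_hom_add[of "\<ominus>\<^bsub>M\<^esub> x" x] add_hom_closed add_hom_zero
  by (metis M.a_inv_closed M.l_neg N.minus_equality)

lemma add_hom_diff: "x \<in> carrier M \<Longrightarrow> y \<in> carrier M \<Longrightarrow> f (x \<ominus>\<^bsub>M\<^esub> y) = f x \<ominus>\<^bsub>N\<^esub> f y"
  by (simp add: a_minus_def add_hom_add add_hom_neg)

lemma add_hom_finsum:
  "finite I \<Longrightarrow> g \<in> I \<rightarrow> carrier M \<Longrightarrow> f (finsum M g I) = finsum N (\<lambda>i. f (g i)) I"
proof (induction I rule: finite_induct)
  case (insert i I)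
  then have "(\<lambda>i. f (g i)) \<in> I \<rightarrow> carrier N" "f (g i) \<in> carrier N" using add_hom_closed by auto
  with insert show ?case by (simp add: add_hom_add M.finsum_insert N.finsum_insert Pi_def)
qed (simp add: add_hom_zero)

end

lemma lin_mapsI:
  assumes "\<And>x. x \<in> carrier M \<Longrightarrow> f x \<in> carrier N"
    and "\<And>x y. x \<in> carrier M \<Longrightarrow> y \<in> carrier M \<Longrightarrow> f (x \<oplus>\<^bsub>M\<^esub> y) = f x \<oplus>\<^bsub>N\<^esub> f y"
    and "\<And>a x. a \<in> carrier R \<Longrightarrow> x \<in> carrier M \<Longrightarrow> f (a \<odot>\<^bsub>M\<^esub> x) = a \<odot>\<^bsub>N\<^esub> f x"
    and "Module.module R M"
  shows "(\<lambda>x\<in>carrier M. f x) \<in> lin_maps R M N"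
proof -
  interpret M: Module.module R M by fact
  show ?thesis using assms(1-3) by (simp add: lin_maps_def LinearCombinations.module_hom_def)
qed

lemma lin_maps_closed: "f \<in> lin_maps R M N \<Longrightarrow> x \<in> carrier M \<Longrightarrow> f x \<in> carrier N"
  and lin_maps_add: "f \<in> lin_maps R M N \<Longrightarrow> x \<in> carrier M \<Longrightarrow> y \<in> carrier M \<Longrightarrow> f (x \<oplus>\<^bsub>M\<^esub> y) = f x \<oplus>\<^bsub>N\<^esub> f y"
  and lin_maps_smult: "f \<in> lin_maps R M N \<Longrightarrow> a \<in> carrier R \<Longrightarrow> x \<in> carrier M \<Longrightarrow> f (a \<odot>\<^bsub>M\<^esub> x) = a \<odot>\<^bsub>N\<^esub> f x"
  and lin_maps_eqI: "f \<in> lin_maps R M N \<Longrightarrow> g \<in> lin_maps R M N \<Longrightarrow> (\<And>x. x \<in> carrier M \<Longrightarrow> f x = g x) \<Longrightarrow> f = g"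
  by (auto simp: lin_maps_def LinearCombinations.module_hom_def intro: extensionalityI)

lemma lin_maps_add_hom: "f \<in> lin_maps R M N \<Longrightarrow> add_hom M N f"
  by (simp add: add_hom_def lin_maps_closed lin_maps_add)

lemma module_abelian_group: "Module.module R M \<Longrightarrow> abelian_group M"
  by (simp add: Module.module_def)

lemmas lin_maps_zero = add_hom_zero[OF module_abelian_group module_abelian_group lin_maps_add_hom]
  and lin_maps_neg = add_hom_neg[OF module_abelian_group module_abelian_group lin_maps_add_hom]
  and lin_maps_diff = add_hom_diff[OF module_abelian_group module_abelian_group lin_maps_add_hom]
  and lin_maps_finsum = add_hom_finsum[OF module_abelian_group module_abelian_group lin_maps_add_hom]

lemma dmod_module: "dmod R d M \<Longrightarrow> Module.module R M"
  and nabla_closed: "dmod R d M \<Longrightarrow> x \<in> carrier M \<Longrightarrow> nabla M x \<in> carrier M"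
  and nabla_add: "dmod R d M \<Longrightarrow> x \<in> carrier M \<Longrightarrow> y \<in> carrier M \<Longrightarrow>
    nabla M (x \<oplus>\<^bsub>M\<^esub> y) = nabla M x \<oplus>\<^bsub>M\<^esub> nabla M y"
  and nabla_smult: "dmod R d M \<Longrightarrow> a \<in> carrier R \<Longrightarrow> x \<in> carrier M \<Longrightarrow>
    nabla M (a \<odot>\<^bsub>M\<^esub> x) = d a \<odot>\<^bsub>M\<^esub> x \<oplus>\<^bsub>M\<^esub> a \<odot>\<^bsub>M\<^esub> nabla M x"
  by (auto simp: dmod_def)

lemma dmod_abelian_group: "dmod R d M \<Longrightarrow> abelian_group M"
  using dmod_module module_abelian_group by blast

lemma nabla_add_hom: "dmod R d M \<Longrightarrow> add_hom M M (nabla M)"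
  by (simp add: add_hom_def nabla_closed nabla_add)

lemmas nabla_zero = add_hom_zero[OF dmod_abelian_group dmod_abelian_group nabla_add_hom]
  and nabla_diff = add_hom_diff[OF dmod_abelian_group dmod_abelian_group nabla_add_hom]
  and nabla_neg = add_hom_neg[OF dmod_abelian_group dmod_abelian_group nabla_add_hom]

lemma (in Module.module) smult_diff_distrib:
  "a \<in> carrier R \<Longrightarrow> x \<in> carrier M \<Longrightarrow> y \<in> carrier M \<Longrightarrow> a \<odot>\<^bsub>M\<^esub> (x \<ominus>\<^bsub>M\<^esub> y) = a \<odot>\<^bsub>M\<^esub> x \<ominus>\<^bsub>M\<^esub> a \<odot>\<^bsub>M\<^esub> y"
  by (simp add: a_minus_def smult_r_distr smult_r_minus)

lemma (in abelian_group) diff_add_diff: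
  "a \<in> carrier G \<Longrightarrow> b \<in> carrier G \<Longrightarrow> c \<in> carrier G \<Longrightarrow> e \<in> carrier G \<Longrightarrow>
   (a \<oplus> b) \<ominus> (c \<oplus> e) = (a \<ominus> c) \<oplus> (b \<ominus> e)"
  by (simp add: a_minus_def minus_add a_ac)

lemma (in abelian_group) diff_eq_iff:
  "a \<in> carrier G \<Longrightarrow> b \<in> carrier G \<Longrightarrow> c \<in> carrier G \<Longrightarrow> a \<ominus> b = c \<longleftrightarrow> a = c \<oplus> b"
  by (metis a_minus_def add.inv_closed add.inv_solve_right')

lemma (in abelian_group) add_diff_cancel [simp]:
  "a \<in> carrier G \<Longrightarrow> b \<in> carrier G \<Longrightarrow> (a \<oplus> b) \<ominus> b = a"
  "a \<in> carrier G \<Longrightarrow> b \<in> carrier G \<Longrightarrow> (b \<oplus> a) \<ominus> b = a"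
  "a \<in> carrier G \<Longrightarrow> b \<in> carrier G \<Longrightarrow> (a \<ominus> b) \<oplus> b = a"
  "a \<in> carrier G \<Longrightarrow> b \<in> carrier G \<Longrightarrow> b \<oplus> (a \<ominus> b) = a"
  "a \<in> carrier G \<Longrightarrow> a \<ominus> a = \<zero>"
  "a \<in> carrier G \<Longrightarrow> a \<ominus> \<zero> = a"
  by (simp_all add: a_minus_def a_assoc r_neg l_neg r_neg1 a_comm[of b a])
     (metis a_assoc a_comm a_inv_closed r_neg r_zero)+

section \<open>The connection on spaces of linear maps\<close>

abbreviation conn :: "'r ring \<Rightarrow> ('r, 'm) dmodule \<Rightarrow> ('r, 'n) dmodule \<Rightarrow> ('m \<Rightarrow> 'n) \<Rightarrow> 'm \<Rightarrow> 'n" where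
  "conn R M N \<equiv> nabla (internal_hom R M N)"

lemma conn_def: "conn R M N f = (\<lambda>x\<in>carrier M. nabla N (f x) \<ominus>\<^bsub>N\<^esub> f (nabla M x))"
  by (simp add: internal_hom_def)

lemma lin_maps_compose:
  assumes "f \<in> lin_maps R M N" "g \<in> lin_maps R N P" "Module.module R M"
  shows "(\<lambda>x\<in>carrier M. g (f x)) \<in> lin_maps R M P"
  using assms by (intro lin_mapsI) (auto simp: lin_maps_closed lin_maps_add lin_maps_smult)

lemma lin_maps_plus:
  assumes "f \<in> lin_maps R M N" "g \<in> lin_maps R M N" "Module.module R M" "Module.module R N"
  shows "(\<lambda>x\<in>carrier M. f x \<oplus>\<^bsub>N\<^esub> g x) \<in> lin_maps R M N"
proof -
  interpret N: Module.module R N by fact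
  show ?thesis using assms
    by (intro lin_mapsI)
       (auto simp: lin_maps_closed lin_maps_add lin_maps_smult N.smult_r_distr N.a_ac)
qed

lemma lin_maps_minus:
  assumes "f \<in> lin_maps R M N" "g \<in> lin_maps R M N" "Module.module R M" "Module.module R N"
  shows "(\<lambda>x\<in>carrier M. f x \<ominus>\<^bsub>N\<^esub> g x) \<in> lin_maps R M N"
proof -
  interpret N: Module.module R N by fact
  show ?thesis using assms
    by (intro lin_mapsI)
       (auto simp: lin_maps_closed lin_maps_add lin_maps_smult N.smult_diff_distrib N.diff_add_diff)
qed

text \<open>The two Leibniz terms with \<open>d a\<close> cancel, so the commutator of a linear map
  with the connections is again linear.\<close>

lemma commutator_smult:
  assumes "dmod R d M" "dmod R d N" "d \<in> carrier R \<rightarrow> carrier R" "f \<in> lin_maps R M N"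
    "a \<in> carrier R" "x \<in> carrier M"
  shows "nabla N (f (a \<odot>\<^bsub>M\<^esub> x)) \<ominus>\<^bsub>N\<^esub> f (nabla M (a \<odot>\<^bsub>M\<^esub> x)) =
    a \<odot>\<^bsub>N\<^esub> (nabla N (f x) \<ominus>\<^bsub>N\<^esub> f (nabla M x))"
proof -
  interpret N: Module.module R N using assms(2) by (rule dmod_module)
  interpret M: Module.module R M using assms(1) by (rule dmod_module)
  have da: "d a \<in> carrier R" using assms by auto
  show ?thesis
    using assms da
    by (simp add: lin_maps_smult lin_maps_add nabla_smult nabla_closed lin_maps_closed N.diff_add_diff
        N.smult_diff_distrib)
qed

lemma conn_closed:
  assumes "dmod R d M" "dmod R d N" "d \<in> carrier R \<rightarrow> carrier R" "f \<in> lin_maps R M N"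
  shows "conn R M N f \<in> lin_maps R M N"
proof -
  interpret N: Module.module R N using assms(2) by (rule dmod_module)
  show ?thesis unfolding conn_def
    by (rule lin_mapsI)
       (use assms in \<open>simp_all add: commutator_smult nabla_closed lin_maps_closed nabla_add lin_maps_add
          N.diff_add_diff dmod_module\<close>)
qed

lemma dmod_homD:
  assumes "f \<in> dmod_hom R M N"
  shows "f \<in> lin_maps R M N" "x \<in> carrier M \<Longrightarrow> f (nabla M x) = nabla N (f x)"
  using assms by (auto simp: dmod_hom_def)

text \<open>Turns full faithfulness into a statement about the kernels of the connections on
  Hom.\<close>

lemma dmod_hom_iff_conn:
  assumes "dmod R d M" "dmod R d N"
  shows "f \<in> dmod_hom R M N \<longleftrightarrow> f \<in> lin_maps R M N \<and> conn R M N f = (\<lambda>x\<in>carrier M. \<zero>\<^bsub>N\<^esub>)"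
proof -
  interpret N: Module.module R N using assms(2) by (rule dmod_module)
  show ?thesis
  proof (cases "f \<in> lin_maps R M N")
    case True
    have "conn R M N f = (\<lambda>x\<in>carrier M. \<zero>\<^bsub>N\<^esub>) \<longleftrightarrow> (\<forall>x\<in>carrier M. nabla N (f x) \<ominus>\<^bsub>N\<^esub> f (nabla M x) = \<zero>\<^bsub>N\<^esub>)"
      by (auto simp: conn_def fun_eq_iff restrict_def)
    also have "\<dots> \<longleftrightarrow> (\<forall>x\<in>carrier M. f (nabla M x) = nabla N (f x))"
      using True assms by (auto simp: N.diff_eq_iff lin_maps_closed nabla_closed)
    finally show ?thesis using True by (simp add: dmod_hom_def)
  qed (simp add: dmod_hom_def)
qed

section \<open>Extensions and cocycles\<close>

text \<open>An \<open>R\<close>-linear section \<open>\<sigma>\<close> of an extension identifies its middle term with \<open>N \<times> M\<close>; the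
  connection then differs from the direct sum by a linear map \<open>\<phi> : M \<rightarrow> N\<close>.\<close>

definition cocycle :: "'r ring \<Rightarrow> ('r, 'm) dmodule \<Rightarrow> ('r, 'n, 'e, 'm) extension \<Rightarrow> ('m \<Rightarrow> 'n) \<Rightarrow> bool" where
  "cocycle R M = (\<lambda>(E, i, p) \<phi>. \<exists>\<sigma>\<in>lin_maps R M E. \<forall>y\<in>carrier M.
     p (\<sigma> y) = y \<and> nabla E (\<sigma> y) = i (\<phi> y) \<oplus>\<^bsub>E\<^esub> \<sigma> (nabla M y))"

text \<open>The dual basis criterion for finitely generated projective modules: generators
  \<open>x j\<close> with coordinate functionals \<open>s j\<close> that reproduce every element.
  The generators may satisfy relations, so the coordinates are one choice among several, but a
  linear one.\<close>

definition dual_basis ::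
  "'r ring \<Rightarrow> ('r, 'm) dmodule \<Rightarrow> nat \<Rightarrow> (nat \<Rightarrow> 'm) \<Rightarrow> (nat \<Rightarrow> 'm \<Rightarrow> 'r) \<Rightarrow> bool" where
  "dual_basis R M n x s \<longleftrightarrow> (\<forall>j<n. x j \<in> carrier M) \<and>
     (\<forall>j<n. \<forall>y\<in>carrier M. s j y \<in> carrier R) \<and>
     (\<forall>j<n. \<forall>y\<in>carrier M. \<forall>z\<in>carrier M. s j (y \<oplus>\<^bsub>M\<^esub> z) = s j y \<oplus>\<^bsub>R\<^esub> s j z) \<and>
     (\<forall>j<n. \<forall>a\<in>carrier R. \<forall>y\<in>carrier M. s j (a \<odot>\<^bsub>M\<^esub> y) = a \<otimes>\<^bsub>R\<^esub> s j y) \<and>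
     (\<forall>y\<in>carrier M. y = finsum M (\<lambda>j. s j y \<odot>\<^bsub>M\<^esub> x j) {..<n})"

text \<open>The functionals are linear, so any family \<open>e\<close> defines a map this way, even
  where the \<open>x j\<close> satisfy relations; then \<open>x j\<close> need not go to
  \<open>e j\<close>. When the \<open>e j\<close> lift the \<open>x j\<close> along a surjection,
  the map is a section of it.\<close>

lemma dual_basis_map:
  assumes M: "Module.module R M" and E: "Module.module R E" and db: "dual_basis R M n x s"
    and e: "\<And>j. j < n \<Longrightarrow> e j \<in> carrier E"
  shows "(\<lambda>y\<in>carrier M. finsum E (\<lambda>j. s j y \<odot>\<^bsub>E\<^esub> e j) {..<n}) \<in> lin_maps R M E"
proof -
  interpret M: Module.module R M by fact
  interpret E: Module.module R E by fact
  note db = db[unfolded dual_basis_def]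
  show ?thesis
  proof (rule lin_mapsI[OF _ _ _ M])
    fix y assume y: "y \<in> carrier M"
    show "finsum E (\<lambda>j. s j y \<odot>\<^bsub>E\<^esub> e j) {..<n} \<in> carrier E"
      using db e y by (intro E.finsum_closed) auto
    fix z assume z: "z \<in> carrier M"
    have "finsum E (\<lambda>j. s j (y \<oplus>\<^bsub>M\<^esub> z) \<odot>\<^bsub>E\<^esub> e j) {..<n} =
        finsum E (\<lambda>j. s j y \<odot>\<^bsub>E\<^esub> e j \<oplus>\<^bsub>E\<^esub> s j z \<odot>\<^bsub>E\<^esub> e j) {..<n}"
      using db e y z by (intro E.finsum_cong') (auto simp: E.smult_l_distr)
    also have "\<dots> = finsum E (\<lambda>j. s j y \<odot>\<^bsub>E\<^esub> e j) {..<n} \<oplus>\<^bsub>E\<^esub> finsum E (\<lambda>j. s j z \<odot>\<^bsub>E\<^esub> e j) {..<n}"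
      using db e y z by (intro E.finsum_addf) auto
    finally show "finsum E (\<lambda>j. s j (y \<oplus>\<^bsub>M\<^esub> z) \<odot>\<^bsub>E\<^esub> e j) {..<n} = \<dots>" .
  next
    fix a y assume a: "a \<in> carrier R" and y: "y \<in> carrier M"
    have "finsum E (\<lambda>j. s j (a \<odot>\<^bsub>M\<^esub> y) \<odot>\<^bsub>E\<^esub> e j) {..<n} = finsum E (\<lambda>j. a \<odot>\<^bsub>E\<^esub> (s j y \<odot>\<^bsub>E\<^esub> e j)) {..<n}"
      using db e y a by (intro E.finsum_cong') (auto simp: E.smult_assoc1)
    also have "\<dots> = a \<odot>\<^bsub>E\<^esub> finsum E (\<lambda>j. s j y \<odot>\<^bsub>E\<^esub> e j) {..<n}"
      using db e y a by (subst E.finsum_smult_ldistr) (auto simp: Pi_def)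
    finally show "finsum E (\<lambda>j. s j (a \<odot>\<^bsub>M\<^esub> y) \<odot>\<^bsub>E\<^esub> e j) {..<n} = \<dots>" .
  qed
qed

lemma dual_basis_expand:
  assumes M: "Module.module R M" and E: "Module.module R E" and db: "dual_basis R M n x s"
    and f: "f \<in> lin_maps R M E" and y: "y \<in> carrier M"
  shows "f y = finsum E (\<lambda>j. s j y \<odot>\<^bsub>E\<^esub> f (x j)) {..<n}"
proof -
  interpret M: Module.module R M by fact
  interpret E: Module.module R E by fact
  note db = db[unfolded dual_basis_def]
  have "f y = f (finsum M (\<lambda>j. s j y \<odot>\<^bsub>M\<^esub> x j) {..<n})" using db y by simp
  also have "\<dots> = finsum E (\<lambda>j. f (s j y \<odot>\<^bsub>M\<^esub> x j)) {..<n}"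
    using db y by (intro lin_maps_finsum[OF M E f]) auto
  also have "\<dots> = finsum E (\<lambda>j. s j y \<odot>\<^bsub>E\<^esub> f (x j)) {..<n}"
    using db y f by (intro E.finsum_cong') (auto simp: lin_maps_smult lin_maps_closed)
  finally show ?thesis .
qed

section \<open>Linear sections and cocycles of an exact sequence\<close>

locale short_exact_sequence =
  fixes R :: "'r ring" and d :: "'r \<Rightarrow> 'r" and N :: "('r, 'n) dmodule" and E :: "('r, 'e) dmodule"
    and M :: "('r, 'm) dmodule" and i :: "'n \<Rightarrow> 'e" and p :: "'e \<Rightarrow> 'm"
  assumes exact: "short_exact R d N E M i p"
begin

lemma dmods: "dmod R d N" "dmod R d E" "dmod R d M"
  and i_hom: "i \<in> dmod_hom R N E" and p_hom: "p \<in> dmod_hom R E M"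
  and i_inj: "inj_on i (carrier N)"
  and i_image: "i ` carrier N = {e \<in> carrier E. p e = \<zero>\<^bsub>M\<^esub>}"
  and p_image: "p ` carrier E = carrier M"
  using exact by (simp_all add: short_exact_def)

sublocale N: Module.module R N by (rule dmod_module[OF dmods(1)])
sublocale E: Module.module R E by (rule dmod_module[OF dmods(2)])
sublocale M: Module.module R M by (rule dmod_module[OF dmods(3)])

lemma modules: "Module.module R N" "Module.module R E" "Module.module R M"
  by (rule N.module_axioms E.module_axioms M.module_axioms)+

lemma i_lin: "i \<in> lin_maps R N E" and p_lin: "p \<in> lin_maps R E M"
  and i_nabla: "x \<in> carrier N \<Longrightarrow> i (nabla N x) = nabla E (i x)"
  and p_nabla: "e \<in> carrier E \<Longrightarrow> p (nabla E e) = nabla M (p e)"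
  using dmod_homD[OF i_hom] dmod_homD[OF p_hom] by auto

lemmas i_simps = lin_maps_closed[OF i_lin] lin_maps_add[OF i_lin] lin_maps_smult[OF i_lin]
    lin_maps_zero[OF modules(1,2) i_lin] lin_maps_diff[OF modules(1,2) i_lin] lin_maps_neg[OF modules(1,2) i_lin]
  and p_simps = lin_maps_closed[OF p_lin] lin_maps_add[OF p_lin] lin_maps_smult[OF p_lin]
    lin_maps_zero[OF modules(2,3) p_lin] lin_maps_diff[OF modules(2,3) p_lin] lin_maps_neg[OF modules(2,3) p_lin]
  and nabla_simps = nabla_closed[OF dmods(1)] nabla_closed[OF dmods(2)] nabla_closed[OF dmods(3)]
    nabla_add[OF dmods(1)] nabla_add[OF dmods(2)] nabla_add[OF dmods(3)]
    nabla_diff[OF dmods(1) dmods(1) dmods(1)] nabla_diff[OF dmods(2) dmods(2) dmods(2)]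

lemma p_i: "x \<in> carrier N \<Longrightarrow> p (i x) = \<zero>\<^bsub>M\<^esub>"
  using i_image by blast

text \<open>Preimages under the injective map \<open>i\<close> are unique, and uniqueness makes
  their choice linear.\<close>

lemma factor_through_kernel:
  assumes g: "g \<in> lin_maps R P E" "\<And>y. y \<in> carrier P \<Longrightarrow> p (g y) = \<zero>\<^bsub>M\<^esub>" and P: "Module.module R P"
  obtains \<psi> where "\<psi> \<in> lin_maps R P N" "\<And>y. y \<in> carrier P \<Longrightarrow> i (\<psi> y) = g y"
proof -
  interpret P: Module.module R P by (rule P)
  define \<psi> where "\<psi> y = inv_into (carrier N) i (g y)" for y
  have gi: "g y \<in> i ` carrier N" if "y \<in> carrier P" for y
    unfolding i_image using g that lin_maps_closed[OF g(1)] by blast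
  have \<psi>: "\<psi> y \<in> carrier N" "i (\<psi> y) = g y" if "y \<in> carrier P" for y
    unfolding \<psi>_def using gi[OF that] by (simp_all add: inv_into_into f_inv_into_f)
  have eq: "\<psi> y = x" if "y \<in> carrier P" "x \<in> carrier N" "g y = i x" for x y
    using that \<psi> i_inj by (simp add: inj_onD)
  have "(\<lambda>y\<in>carrier P. \<psi> y) \<in> lin_maps R P N"
    by (rule lin_mapsI[OF _ _ _ P])
       (auto simp: \<psi> i_simps lin_maps_add[OF g(1)] lin_maps_smult[OF g(1)] intro!: eq)
  then show ?thesis by (rule that) (simp add: \<psi>)
qed

text \<open>The map \<open>e - \<sigma> (p e)\<close> takes values in the kernel of
  \<open>p\<close>; factored through \<open>i\<close> it is the retraction complementary to
  \<sigma>.\<close>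

lemma section_retraction:
  assumes \<sigma>: "\<sigma> \<in> lin_maps R M E" "\<And>y. y \<in> carrier M \<Longrightarrow> p (\<sigma> y) = y"
  obtains \<rho> where "\<rho> \<in> lin_maps R E N" "\<And>e. e \<in> carrier E \<Longrightarrow> e = i (\<rho> e) \<oplus>\<^bsub>E\<^esub> \<sigma> (p e)"
    "\<And>x. x \<in> carrier N \<Longrightarrow> \<rho> (i x) = x" "\<And>y. y \<in> carrier M \<Longrightarrow> \<rho> (\<sigma> y) = \<zero>\<^bsub>N\<^esub>"
proof -
  note \<sigma>_simps = lin_maps_closed[OF \<sigma>(1)] lin_maps_zero[OF modules(3,2) \<sigma>(1)]
  have id: "(\<lambda>e\<in>carrier E. e) \<in> lin_maps R E E"
    by (rule lin_mapsI[OF _ _ _ modules(2)]) auto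
  have \<sigma>p: "(\<lambda>e\<in>carrier E. \<sigma> (p e)) \<in> lin_maps R E E"
    by (rule lin_maps_compose[OF p_lin \<sigma>(1) modules(2)])
  have g: "(\<lambda>e\<in>carrier E. (\<lambda>e\<in>carrier E. e) e \<ominus>\<^bsub>E\<^esub> (\<lambda>e\<in>carrier E. \<sigma> (p e)) e) \<in> lin_maps R E E"
    by (rule lin_maps_minus[OF id \<sigma>p modules(2,2)])
  obtain \<rho> where \<rho>: "\<rho> \<in> lin_maps R E N" "\<And>e. e \<in> carrier E \<Longrightarrow> i (\<rho> e) = e \<ominus>\<^bsub>E\<^esub> \<sigma> (p e)"
    by (rule factor_through_kernel[OF g _ modules(2)]) (auto simp: p_simps \<sigma>_simps \<sigma>(2))
  show ?thesis
  proof (rule that[OF \<rho>(1)])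
    show "e = i (\<rho> e) \<oplus>\<^bsub>E\<^esub> \<sigma> (p e)" if "e \<in> carrier E" for e
      using that by (simp add: \<rho> p_simps \<sigma>_simps)
    show "\<rho> (i x) = x" if "x \<in> carrier N" for x
      by (rule inj_onD[OF i_inj]) (use that in \<open>simp_all add: \<rho> i_simps p_i \<sigma>_simps lin_maps_closed[OF \<rho>(1)]\<close>)
    show "\<rho> (\<sigma> y) = \<zero>\<^bsub>N\<^esub>" if "y \<in> carrier M" for y
      by (rule inj_onD[OF i_inj]) (use that in \<open>simp_all add: \<rho> i_simps p_simps \<sigma> \<sigma>_simps lin_maps_closed[OF \<rho>(1)]\<close>)
  qed
qed

text \<open>Lifts of the dual generators give a linear section. Its commutator with the connections
  is killed by \<open>p\<close>, because \<open>p\<close> is horizontal and inverts the section;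
  hence it comes from a linear map to \<open>N\<close>.\<close>

lemma cocycle_exists:
  assumes db: "dual_basis R M n x s" and d: "d \<in> carrier R \<rightarrow> carrier R"
  obtains \<phi> where "\<phi> \<in> lin_maps R M N" "cocycle R M (E, i, p) \<phi>"
proof -
  have "\<forall>j\<in>{..<n}. \<exists>e. e \<in> carrier E \<and> p e = x j"
  proof
    fix j assume "j \<in> {..<n}"
    then have "x j \<in> p ` carrier E" using db unfolding p_image by (simp add: dual_basis_def)
    then show "\<exists>e. e \<in> carrier E \<and> p e = x j" by auto
  qed
  then obtain e where e: "\<And>j. j < n \<Longrightarrow> e j \<in> carrier E" "\<And>j. j < n \<Longrightarrow> p (e j) = x j"
    by (drule_tac bchoice) auto
  define \<sigma> where "\<sigma> = (\<lambda>y\<in>carrier M. finsum E (\<lambda>j. s j y \<odot>\<^bsub>E\<^esub> e j) {..<n})"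
  have \<sigma>: "\<sigma> \<in> lin_maps R M E"
    unfolding \<sigma>_def by (rule dual_basis_map[OF modules(3,2) db e(1)])
  have p\<sigma>: "p (\<sigma> y) = y" if y: "y \<in> carrier M" for y
  proof -
    have "p (\<sigma> y) = finsum M (\<lambda>j. p (s j y \<odot>\<^bsub>E\<^esub> e j)) {..<n}"
      unfolding \<sigma>_def using y db e
      by (simp add: lin_maps_finsum[OF modules(2,3) p_lin] dual_basis_def)
    also have "\<dots> = finsum M (\<lambda>j. s j y \<odot>\<^bsub>M\<^esub> x j) {..<n}"
      using db e y by (intro M.finsum_cong') (auto simp: dual_basis_def p_simps)
    also have "\<dots> = y" using db y by (simp add: dual_basis_def)
    finally show ?thesis .
  qed
  have c: "conn R M E \<sigma> \<in> lin_maps R M E" by (rule conn_closed[OF dmods(3,2) d \<sigma>])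
  obtain \<phi> where \<phi>: "\<phi> \<in> lin_maps R M N" "\<And>y. y \<in> carrier M \<Longrightarrow> i (\<phi> y) = conn R M E \<sigma> y"
    by (rule factor_through_kernel[OF c _ modules(3)])
       (auto simp: conn_def p_simps p_nabla nabla_simps lin_maps_closed[OF \<sigma>] p\<sigma>)
  have "cocycle R M (E, i, p) \<phi>"
    unfolding cocycle_def using \<sigma> p\<sigma> \<phi>
    by (auto intro!: bexI[of _ \<sigma>] simp: conn_def nabla_simps lin_maps_closed[OF \<sigma>])
  with \<phi>(1) show ?thesis by (rule that)
qed

text \<open>Two linear sections differ by a linear map \<psi> into \<open>N\<close>, and replacing
  one by the other changes the cocycle by the connection of \<psi>. The cocycles of one extension
  therefore form a coset of exact ones.\<close>

lemma cocycle_iff: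
  assumes c: "cocycle R M (E, i, p) \<phi>" and \<phi>: "\<phi> \<in> lin_maps R M N" and \<phi>': "\<phi>' \<in> lin_maps R M N"
  shows "cocycle R M (E, i, p) \<phi>' \<longleftrightarrow>
    (\<exists>\<psi>\<in>lin_maps R M N. \<forall>y\<in>carrier M. \<phi>' y = \<phi> y \<oplus>\<^bsub>N\<^esub> conn R M N \<psi> y)"
proof -
  from c obtain \<sigma> where \<sigma>: "\<sigma> \<in> lin_maps R M E" and p\<sigma>: "\<And>y. y \<in> carrier M \<Longrightarrow> p (\<sigma> y) = y"
    and n\<sigma>: "\<And>y. y \<in> carrier M \<Longrightarrow> nabla E (\<sigma> y) = i (\<phi> y) \<oplus>\<^bsub>E\<^esub> \<sigma> (nabla M y)"
    unfolding cocycle_def by auto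
  note cl = lin_maps_closed[OF \<sigma>] lin_maps_closed[OF \<phi>] lin_maps_closed[OF \<phi>']
  show ?thesis
  proof
    assume "cocycle R M (E, i, p) \<phi>'"
    then obtain \<tau> where \<tau>: "\<tau> \<in> lin_maps R M E" and p\<tau>: "\<And>y. y \<in> carrier M \<Longrightarrow> p (\<tau> y) = y"
      and n\<tau>: "\<And>y. y \<in> carrier M \<Longrightarrow> nabla E (\<tau> y) = i (\<phi>' y) \<oplus>\<^bsub>E\<^esub> \<tau> (nabla M y)"
      unfolding cocycle_def by auto
    note cl = cl lin_maps_closed[OF \<tau>]
    have g: "(\<lambda>y\<in>carrier M. \<tau> y \<ominus>\<^bsub>E\<^esub> \<sigma> y) \<in> lin_maps R M E"
      by (rule lin_maps_minus[OF \<tau> \<sigma> modules(3,2)])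
    obtain \<psi> where \<psi>: "\<psi> \<in> lin_maps R M N" and i\<psi>: "\<And>y. y \<in> carrier M \<Longrightarrow> i (\<psi> y) = \<tau> y \<ominus>\<^bsub>E\<^esub> \<sigma> y"
      by (rule factor_through_kernel[OF g _ modules(3)]) (auto simp: cl p_simps p\<sigma> p\<tau>)
    note cl = cl lin_maps_closed[OF \<psi>]
    have "\<phi>' y = \<phi> y \<oplus>\<^bsub>N\<^esub> conn R M N \<psi> y" if y: "y \<in> carrier M" for y
    proof (rule inj_onD[OF i_inj])
      have ny: "nabla M y \<in> carrier M" using y by (rule nabla_simps)
      have "i (nabla N (\<psi> y)) = nabla E (\<tau> y) \<ominus>\<^bsub>E\<^esub> nabla E (\<sigma> y)"
        using y by (simp add: i_nabla i\<psi> cl nabla_simps)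
      also have "\<dots> = (i (\<phi>' y) \<ominus>\<^bsub>E\<^esub> i (\<phi> y)) \<oplus>\<^bsub>E\<^esub> i (\<psi> (nabla M y))"
        using y ny by (simp add: n\<tau> n\<sigma> i\<psi> E.diff_add_diff cl i_simps)
      finally have "i (conn R M N \<psi> y) = i (\<phi>' y) \<ominus>\<^bsub>E\<^esub> i (\<phi> y)"
        using y ny by (simp add: conn_def i_simps cl nabla_simps)
      then show "i (\<phi>' y) = i (\<phi> y \<oplus>\<^bsub>N\<^esub> conn R M N \<psi> y)"
        using y ny by (simp add: i_simps cl conn_def nabla_simps)
    qed (use y in \<open>simp_all add: cl conn_def nabla_simps\<close>)
    with \<psi> show "\<exists>\<psi>\<in>lin_maps R M N. \<forall>y\<in>carrier M. \<phi>' y = \<phi> y \<oplus>\<^bsub>N\<^esub> conn R M N \<psi> y" by blast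
  next
    assume "\<exists>\<psi>\<in>lin_maps R M N. \<forall>y\<in>carrier M. \<phi>' y = \<phi> y \<oplus>\<^bsub>N\<^esub> conn R M N \<psi> y"
    then obtain \<psi> where \<psi>: "\<psi> \<in> lin_maps R M N"
      and \<phi>'_eq: "\<And>y. y \<in> carrier M \<Longrightarrow> \<phi>' y = \<phi> y \<oplus>\<^bsub>N\<^esub> conn R M N \<psi> y" by blast
    note cl = cl lin_maps_closed[OF \<psi>]
    have i\<psi>: "(\<lambda>y\<in>carrier M. i (\<psi> y)) \<in> lin_maps R M E"
      by (rule lin_maps_compose[OF \<psi> i_lin modules(3)])
    have t: "(\<lambda>y\<in>carrier M. \<sigma> y \<oplus>\<^bsub>E\<^esub> (\<lambda>y\<in>carrier M. i (\<psi> y)) y) \<in> lin_maps R M E"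
      by (rule lin_maps_plus[OF \<sigma> i\<psi> modules(3,2)])
    show "cocycle R M (E, i, p) \<phi>'"
      unfolding cocycle_def prod.case
    proof (intro bexI[OF _ t] ballI conjI)
      fix y assume y: "y \<in> carrier M"
      have ny: "nabla M y \<in> carrier M" using y by (rule nabla_simps)
      show "p ((\<lambda>y\<in>carrier M. \<sigma> y \<oplus>\<^bsub>E\<^esub> (\<lambda>y\<in>carrier M. i (\<psi> y)) y) y) = y"
        using y by (simp add: p_simps p\<sigma> p_i cl i_simps)
      have "i (\<phi>' y) \<oplus>\<^bsub>E\<^esub> i (\<psi> (nabla M y)) = i (\<phi> y) \<oplus>\<^bsub>E\<^esub> i (nabla N (\<psi> y))"
        using y ny by (simp add: \<phi>'_eq conn_def i_simps cl nabla_simps E.a_assoc)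
      then have *: "i (\<phi> y) \<oplus>\<^bsub>E\<^esub> i (nabla N (\<psi> y)) \<oplus>\<^bsub>E\<^esub> \<sigma> (nabla M y) =
          i (\<phi>' y) \<oplus>\<^bsub>E\<^esub> i (\<psi> (nabla M y)) \<oplus>\<^bsub>E\<^esub> \<sigma> (nabla M y)" by simp
      have "nabla E (\<sigma> y \<oplus>\<^bsub>E\<^esub> i (\<psi> y)) = (i (\<phi> y) \<oplus>\<^bsub>E\<^esub> \<sigma> (nabla M y)) \<oplus>\<^bsub>E\<^esub> i (nabla N (\<psi> y))"
        using y by (simp add: nabla_simps cl i_simps n\<sigma> i_nabla)
      also have "\<dots> = i (\<phi>' y) \<oplus>\<^bsub>E\<^esub> (\<sigma> (nabla M y) \<oplus>\<^bsub>E\<^esub> i (\<psi> (nabla M y)))"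
        using * y ny by (simp add: cl i_simps nabla_simps E.a_assoc E.a_comm[of "\<sigma> (nabla M y)"])
      finally show "nabla E ((\<lambda>y\<in>carrier M. \<sigma> y \<oplus>\<^bsub>E\<^esub> (\<lambda>y\<in>carrier M. i (\<psi> y)) y) y) =
          i (\<phi>' y) \<oplus>\<^bsub>E\<^esub> (\<lambda>y\<in>carrier M. \<sigma> y \<oplus>\<^bsub>E\<^esub> (\<lambda>y\<in>carrier M. i (\<psi> y)) y) (nabla M y)"
        using y ny by simp
    qed
  qed
qed

end

text \<open>The short five lemma for a map that is the identity on both outer terms.\<close>

lemma extension_map_bij:
  assumes "short_exact R d N E M i p" "short_exact R d N E' M i' p'"
    and h: "h \<in> lin_maps R E E'" "\<And>x. x \<in> carrier N \<Longrightarrow> h (i x) = i' x" "\<And>e. e \<in> carrier E \<Longrightarrow> p' (h e) = p e"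
  shows "bij_betw h (carrier E) (carrier E')"
proof -
  interpret S: short_exact_sequence R d N E M i p by unfold_locales fact
  interpret S': short_exact_sequence R d N E' M i' p' by unfold_locales fact
  note h_simps = lin_maps_closed[OF h(1)] lin_maps_diff[OF S.modules(2) S'.modules(2) h(1)]
    lin_maps_add[OF h(1)]
  have ker: "e = \<zero>\<^bsub>E\<^esub>" if e: "e \<in> carrier E" "h e = \<zero>\<^bsub>E'\<^esub>" for e
  proof -
    have "p e = \<zero>\<^bsub>M\<^esub>" using h(3)[OF e(1)] e(2) by (simp add: S'.p_simps)
    then obtain x where x: "x \<in> carrier N" "e = i x" using e(1) S.i_image by blast
    then have "i' x = i' \<zero>\<^bsub>N\<^esub>" using e(2) h(2) by (simp add: S'.i_simps)
    then have "x = \<zero>\<^bsub>N\<^esub>" using S'.i_inj x(1) by (simp add: inj_onD)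
    with x show ?thesis by (simp add: S.i_simps)
  qed
  have "inj_on h (carrier E)"
  proof
    fix a b assume ab: "a \<in> carrier E" "b \<in> carrier E" "h a = h b"
    then have "h (a \<ominus>\<^bsub>E\<^esub> b) = \<zero>\<^bsub>E'\<^esub>" by (simp add: h_simps)
    then have "a \<ominus>\<^bsub>E\<^esub> b = \<zero>\<^bsub>E\<^esub>" using ker ab by simp
    then show "a = b" using ab by (simp add: S.E.diff_eq_iff)
  qed
  moreover have "h ` carrier E = carrier E'"
  proof
    show "h ` carrier E \<subseteq> carrier E'" by (auto simp: h_simps)
    show "carrier E' \<subseteq> h ` carrier E"
    proof
      fix e' assume e': "e' \<in> carrier E'"
      then have "p' e' \<in> p ` carrier E" using S.p_image by (simp add: S'.p_simps)
      then obtain e where e: "e \<in> carrier E" "p e = p' e'" by auto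
      then have "p' (e' \<ominus>\<^bsub>E'\<^esub> h e) = \<zero>\<^bsub>M\<^esub>" using e' h(3) by (simp add: S'.p_simps h_simps)
      then have "e' \<ominus>\<^bsub>E'\<^esub> h e \<in> i' ` carrier N" unfolding S'.i_image using e e' by (simp add: h_simps)
      then obtain x where x: "x \<in> carrier N" "e' \<ominus>\<^bsub>E'\<^esub> h e = i' x" by auto
      then have "h (i x \<oplus>\<^bsub>E\<^esub> e) = e'"
        using e e' h(2) by (simp add: h_simps S.i_simps S'.E.diff_eq_iff S'.i_simps)
      moreover have "i x \<oplus>\<^bsub>E\<^esub> e \<in> carrier E" using x e by (simp add: S.i_simps)
      ultimately show "e' \<in> h ` carrier E" by blast
    qed
  qed
  ultimately show ?thesis by (simp add: bij_betw_def)
qed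

text \<open>An equivalence carries a section to one with the same cocycle. Conversely, sections
  \<sigma> and \<tau> with equal cocycle give the map that is \<open>i'\<close> on the part from
  \<open>N\<close> and \<tau> on the part from \<open>M\<close>; equality of the cocycles is what
  makes it horizontal. The two middle terms may be of different types.\<close>

lemma ext_equiv_iff_cocycle:
  assumes ex: "short_exact R d N E M i p" "short_exact R d N E' M i' p'"
    and c: "cocycle R M (E, i, p) \<phi>" and \<phi>: "\<phi> \<in> lin_maps R M N"
  shows "ext_equiv R M N (E, i, p) (E', i', p') \<longleftrightarrow> cocycle R M (E', i', p') \<phi>"
proof -
  interpret S: short_exact_sequence R d N E M i p by unfold_locales fact
  interpret S': short_exact_sequence R d N E' M i' p' by unfold_locales fact
  from c obtain \<sigma> where \<sigma>: "\<sigma> \<in> lin_maps R M E" and p\<sigma>: "\<And>y. y \<in> carrier M \<Longrightarrow> p (\<sigma> y) = y"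
    and n\<sigma>: "\<And>y. y \<in> carrier M \<Longrightarrow> nabla E (\<sigma> y) = i (\<phi> y) \<oplus>\<^bsub>E\<^esub> \<sigma> (nabla M y)"
    unfolding cocycle_def by auto
  note cl = lin_maps_closed[OF \<sigma>] lin_maps_closed[OF \<phi>]
  show ?thesis
  proof
    assume "ext_equiv R M N (E, i, p) (E', i', p')"
    then obtain h where h: "h \<in> lin_maps R E E'" "\<And>e. e \<in> carrier E \<Longrightarrow> h (nabla E e) = nabla E' (h e)"
      and hi: "\<And>x. x \<in> carrier N \<Longrightarrow> h (i x) = i' x" and ph: "\<And>e. e \<in> carrier E \<Longrightarrow> p' (h e) = p e"
      by (auto simp: ext_equiv_def dmod_hom_def)
    show "cocycle R M (E', i', p') \<phi>"
      unfolding cocycle_def prod.case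
    proof (intro bexI[OF _ lin_maps_compose[OF \<sigma> h(1) S.modules(3)]] ballI conjI)
      fix y assume y: "y \<in> carrier M"
      then show "p' ((\<lambda>y\<in>carrier M. h (\<sigma> y)) y) = y" by (simp add: ph cl p\<sigma>)
      show "nabla E' ((\<lambda>y\<in>carrier M. h (\<sigma> y)) y) = i' (\<phi> y) \<oplus>\<^bsub>E'\<^esub> (\<lambda>y\<in>carrier M. h (\<sigma> y)) (nabla M y)"
        using y by (simp add: h(2)[symmetric] cl n\<sigma> lin_maps_add[OF h(1)] S.i_simps hi S.nabla_simps)
    qed
  next
    assume "cocycle R M (E', i', p') \<phi>"
    then obtain \<tau> where \<tau>: "\<tau> \<in> lin_maps R M E'" and p\<tau>: "\<And>y. y \<in> carrier M \<Longrightarrow> p' (\<tau> y) = y"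
      and n\<tau>: "\<And>y. y \<in> carrier M \<Longrightarrow> nabla E' (\<tau> y) = i' (\<phi> y) \<oplus>\<^bsub>E'\<^esub> \<tau> (nabla M y)"
      unfolding cocycle_def by auto
    obtain \<rho> where \<rho>: "\<rho> \<in> lin_maps R E N" "\<And>e. e \<in> carrier E \<Longrightarrow> e = i (\<rho> e) \<oplus>\<^bsub>E\<^esub> \<sigma> (p e)"
        "\<And>x. x \<in> carrier N \<Longrightarrow> \<rho> (i x) = x" "\<And>y. y \<in> carrier M \<Longrightarrow> \<rho> (\<sigma> y) = \<zero>\<^bsub>N\<^esub>"
    proof (rule S.section_retraction[OF \<sigma> p\<sigma>])
      fix \<rho> assume *: "\<rho> \<in> lin_maps R E N" "\<And>e. e \<in> carrier E \<Longrightarrow> e = i (\<rho> e) \<oplus>\<^bsub>E\<^esub> \<sigma> (p e)"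
        "\<And>x. x \<in> carrier N \<Longrightarrow> \<rho> (i x) = x" "\<And>y. y \<in> carrier M \<Longrightarrow> \<rho> (\<sigma> y) = \<zero>\<^bsub>N\<^esub>"
      show thesis by (rule that[OF *])
    qed
    note cl = cl lin_maps_closed[OF \<tau>] lin_maps_closed[OF \<rho>(1)]
    note i\<rho> = lin_maps_compose[OF \<rho>(1) S'.i_lin S.modules(2)]
    note \<tau>p = lin_maps_compose[OF S.p_lin \<tau> S.modules(2)]
    define h where "h = (\<lambda>e\<in>carrier E. (\<lambda>e\<in>carrier E. i' (\<rho> e)) e \<oplus>\<^bsub>E'\<^esub> (\<lambda>e\<in>carrier E. \<tau> (p e)) e)"
    have h: "h \<in> lin_maps R E E'" unfolding h_def
      by (rule lin_maps_plus[OF i\<rho> \<tau>p S.modules(2) S'.modules(2)])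
    have h_eq: "h e = i' (\<rho> e) \<oplus>\<^bsub>E'\<^esub> \<tau> (p e)" if "e \<in> carrier E" for e
      using that by (simp add: h_def)
    have hi: "h (i x) = i' x" if "x \<in> carrier N" for x
      using that by (simp add: h_eq S.i_simps \<rho>(3) S.p_i lin_maps_zero[OF S.modules(3) S'.modules(2) \<tau>] S'.i_simps)
    have ph: "p' (h e) = p e" if "e \<in> carrier E" for e
      using that by (simp add: h_eq cl S'.p_simps S'.i_simps S.p_simps S'.p_i p\<tau>)
    have h\<sigma>: "h (\<sigma> y) = \<tau> y" if "y \<in> carrier M" for y
      using that by (simp add: h_eq cl \<rho>(4) S'.i_simps p\<sigma>)
    have "h (nabla E e) = nabla E' (h e)" if e: "e \<in> carrier E" for e
    proof -
      let ?x = "\<rho> e" and ?y = "p e"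
      have xy: "?x \<in> carrier N" "?y \<in> carrier M" using e by (simp_all add: cl S.p_simps)
      have "nabla E e = nabla E (i ?x \<oplus>\<^bsub>E\<^esub> \<sigma> ?y)" using \<rho>(2)[OF e] by simp
      also have "\<dots> = i (nabla N ?x) \<oplus>\<^bsub>E\<^esub> (i (\<phi> ?y) \<oplus>\<^bsub>E\<^esub> \<sigma> (nabla M ?y))"
        using xy by (simp add: S.nabla_simps S.i_simps cl n\<sigma> S.i_nabla)
      finally have "h (nabla E e) = i' (nabla N ?x) \<oplus>\<^bsub>E'\<^esub> (i' (\<phi> ?y) \<oplus>\<^bsub>E'\<^esub> \<tau> (nabla M ?y))"
        using xy by (simp add: lin_maps_add[OF h] S.nabla_simps S.i_simps cl hi h\<sigma>)
      also have "\<dots> = nabla E' (h e)"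
        using xy e by (simp add: h_eq S'.nabla_simps S'.i_simps cl n\<tau> S'.i_nabla)
      finally show ?thesis .
    qed
    moreover have "bij_betw h (carrier E) (carrier E')"
      by (rule extension_map_bij[OF ex h hi ph])
    ultimately show "ext_equiv R M N (E, i, p) (E', i', p')"
      unfolding ext_equiv_def prod.case using h hi ph by (auto intro!: bexI[of _ h] simp: dmod_hom_def)
  qed
qed

section \<open>Twisted products\<close>

definition twist :: "('r, 'm) dmodule \<Rightarrow> ('r, 'n) dmodule \<Rightarrow> ('m \<Rightarrow> 'n) \<Rightarrow> ('r, 'n, 'n \<times> 'm, 'm) extension" where
  "twist M N \<phi> = ((prod_dmod N M) \<lparr>nabla := \<lambda>(x, y). (nabla N x \<oplus>\<^bsub>N\<^esub> \<phi> y, nabla M y)\<rparr>,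
     \<lambda>x\<in>carrier N. (x, \<zero>\<^bsub>M\<^esub>), \<lambda>e\<in>carrier N \<times> carrier M. snd e)"

text \<open>The section sending \<open>y\<close> to the pair of zero and \<open>y\<close> has
  cocycle \<phi>, so every linear map from \<open>M\<close> to \<open>N\<close> occurs as a
  cocycle.\<close>

lemma twist_short_exact:
  assumes M: "dmod R d M" and N: "dmod R d N" and \<phi>: "\<phi> \<in> lin_maps R M N"
    and d: "d \<in> carrier R \<rightarrow> carrier R"
  shows "case twist M N \<phi> of (E, i, p) \<Rightarrow> short_exact R d N E M i p \<and> cocycle R M (E, i, p) \<phi>"
proof -
  interpret N: Module.module R N using N by (rule dmod_module)
  interpret M: Module.module R M using M by (rule dmod_module)
  note simps = nabla_closed[OF M] nabla_closed[OF N] nabla_add[OF M] nabla_add[OF N]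
    nabla_smult[OF M] nabla_smult[OF N] lin_maps_closed[OF \<phi>] lin_maps_add[OF \<phi>] lin_maps_smult[OF \<phi>]
    lin_maps_zero[OF M.module_axioms N.module_axioms \<phi>] nabla_zero[OF M M M] nabla_zero[OF N N N]
  define E where "E = (prod_dmod N M) \<lparr>nabla := \<lambda>(x, y). (nabla N x \<oplus>\<^bsub>N\<^esub> \<phi> y, nabla M y)\<rparr>"
  have E_simps: "carrier E = carrier N \<times> carrier M" "(x, y) \<oplus>\<^bsub>E\<^esub> (x', y') = (x \<oplus>\<^bsub>N\<^esub> x', y \<oplus>\<^bsub>M\<^esub> y')"
    "\<zero>\<^bsub>E\<^esub> = (\<zero>\<^bsub>N\<^esub>, \<zero>\<^bsub>M\<^esub>)" "a \<odot>\<^bsub>E\<^esub> (x, y) = (a \<odot>\<^bsub>N\<^esub> x, a \<odot>\<^bsub>M\<^esub> y)"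
    "nabla E (x, y) = (nabla N x \<oplus>\<^bsub>N\<^esub> \<phi> y, nabla M y)" for x y x' y' a
    by (simp_all add: E_def prod_dmod_def)
  have "abelian_group E"
  proof (rule abelian_groupI)
    fix e assume "e \<in> carrier E"
    then show "\<exists>f\<in>carrier E. f \<oplus>\<^bsub>E\<^esub> e = \<zero>\<^bsub>E\<^esub>"
      by (auto simp: E_simps N.l_neg M.l_neg intro!: bexI[of _ "\<ominus>\<^bsub>N\<^esub> fst e"] bexI[of _ "\<ominus>\<^bsub>M\<^esub> snd e"])
  qed (auto simp: E_simps N.a_ac M.a_ac)
  then have E: "Module.module R E"
    by (intro moduleI N.is_cring)
       (auto simp: E_simps N.smult_l_distr M.smult_l_distr N.smult_r_distr M.smult_r_distr
          N.smult_assoc1 M.smult_assoc1)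
  have dE: "dmod R d E"
    unfolding dmod_def using E funcset_mem[OF d]
    by (auto simp: E_simps simps N.a_ac N.smult_r_distr)
  have i: "(\<lambda>x\<in>carrier N. (x, \<zero>\<^bsub>M\<^esub>)) \<in> dmod_hom R N E"
    unfolding dmod_hom_def by (auto intro!: lin_mapsI[OF _ _ _ N.module_axioms] simp: E_simps simps)
  have p: "(\<lambda>e\<in>carrier N \<times> carrier M. snd e) \<in> dmod_hom R E M"
    using lin_mapsI[OF _ _ _ E, of snd M] by (auto simp: dmod_hom_def E_simps simps)
  have "short_exact R d N E M (\<lambda>x\<in>carrier N. (x, \<zero>\<^bsub>M\<^esub>)) (\<lambda>e\<in>carrier N \<times> carrier M. snd e)"
    unfolding short_exact_def
  proof (intro conjI M N dE i p)
    have "y \<in> (\<lambda>e\<in>carrier N \<times> carrier M. snd e) ` carrier E" if "y \<in> carrier M" for y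
      by (rule image_eqI[of _ _ "(\<zero>\<^bsub>N\<^esub>, y)"]) (use that in \<open>auto simp: E_simps\<close>)
    then show "(\<lambda>e\<in>carrier N \<times> carrier M. snd e) ` carrier E = carrier M" by (auto simp: E_simps)
  qed (auto simp: E_simps inj_on_def)
  moreover have "(\<lambda>y\<in>carrier M. (\<zero>\<^bsub>N\<^esub>, y)) \<in> lin_maps R M E"
    by (rule lin_mapsI[OF _ _ _ M.module_axioms]) (auto simp: E_simps)
  then have "cocycle R M (E, \<lambda>x\<in>carrier N. (x, \<zero>\<^bsub>M\<^esub>), \<lambda>e\<in>carrier N \<times> carrier M. snd e) \<phi>"
    unfolding cocycle_def by (auto simp: E_simps simps intro!: bexI[of _ "\<lambda>y\<in>carrier M. (\<zero>\<^bsub>N\<^esub>, y)"])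
  ultimately show ?thesis by (simp add: twist_def E_def)
qed

section \<open>Baer sums\<close>

lemma (in abelian_group) a_coset_eq_iff:
  assumes "additive_subgroup S G" "x \<in> carrier G" "y \<in> carrier G"
  shows "S +> x = S +> y \<longleftrightarrow> x \<ominus> y \<in> S"
proof -
  interpret S: abelian_subgroup S G by (rule abelian_subgroupI3) (fact assms(1), fact abelian_group_axioms)
  have "S +> x = S +> y \<longleftrightarrow> x \<in> S +> y"
    using S.a_rcos_self[OF assms(2)] S.a_repr_independence'[of x y] assms(3) by blast
  also have "\<dots> \<longleftrightarrow> x \<ominus> y \<in> S"
    using S.a_rcos_module[OF assms(3,2)] by (simp add: a_minus_def)
  finally show ?thesis .
qed

text \<open>Operations on cosets are defined as unions over all representatives. By the last clause
  such a union is a single coset as soon as \<open>f\<close> respects congruence modulo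
  \<open>S\<close>.\<close>

lemma quot_dmod_simps:
  assumes M: "abelian_group M" and S: "additive_subgroup S M"
  shows "x \<in> carrier M \<Longrightarrow> S +>\<^bsub>M\<^esub> x \<in> carrier (quot_dmod M S)"
    and "X \<in> carrier (quot_dmod M S) \<Longrightarrow> \<exists>x\<in>carrier M. X = S +>\<^bsub>M\<^esub> x"
    and "x \<in> carrier M \<Longrightarrow> y \<in> carrier M \<Longrightarrow>
      (S +>\<^bsub>M\<^esub> x) \<oplus>\<^bsub>quot_dmod M S\<^esub> (S +>\<^bsub>M\<^esub> y) = S +>\<^bsub>M\<^esub> (x \<oplus>\<^bsub>M\<^esub> y)"
    and "\<zero>\<^bsub>quot_dmod M S\<^esub> = S +>\<^bsub>M\<^esub> \<zero>\<^bsub>M\<^esub>"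
    and "x \<in> carrier M \<Longrightarrow> f \<in> carrier M \<rightarrow> carrier M \<Longrightarrow>
      (\<And>x y. x \<in> carrier M \<Longrightarrow> y \<in> carrier M \<Longrightarrow> x \<ominus>\<^bsub>M\<^esub> y \<in> S \<Longrightarrow> f x \<ominus>\<^bsub>M\<^esub> f y \<in> S) \<Longrightarrow>
      (\<Union>z\<in>S +>\<^bsub>M\<^esub> x. S +>\<^bsub>M\<^esub> f z) = S +>\<^bsub>M\<^esub> f x"
proof -
  interpret M: abelian_group M by (rule M)
  interpret S: abelian_subgroup S M by (rule abelian_subgroupI3) (fact S, fact M)
  show "x \<in> carrier M \<Longrightarrow> S +>\<^bsub>M\<^esub> x \<in> carrier (quot_dmod M S)"
    and "X \<in> carrier (quot_dmod M S) \<Longrightarrow> \<exists>x\<in>carrier M. X = S +>\<^bsub>M\<^esub> x"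
    by (auto simp: quot_dmod_def A_RCOSETS_def')
  show "x \<in> carrier M \<Longrightarrow> y \<in> carrier M \<Longrightarrow>
      (S +>\<^bsub>M\<^esub> x) \<oplus>\<^bsub>quot_dmod M S\<^esub> (S +>\<^bsub>M\<^esub> y) = S +>\<^bsub>M\<^esub> (x \<oplus>\<^bsub>M\<^esub> y)"
    by (simp add: quot_dmod_def S.a_rcos_sum)
  have "S +>\<^bsub>M\<^esub> \<zero>\<^bsub>M\<^esub> = S" using S.a_subset by (intro M.a_coset_add_zero)
  then show "\<zero>\<^bsub>quot_dmod M S\<^esub> = S +>\<^bsub>M\<^esub> \<zero>\<^bsub>M\<^esub>" by (simp add: quot_dmod_def)
  assume x: "x \<in> carrier M" and f: "f \<in> carrier M \<rightarrow> carrier M"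
    and resp: "\<And>x y. x \<in> carrier M \<Longrightarrow> y \<in> carrier M \<Longrightarrow> x \<ominus>\<^bsub>M\<^esub> y \<in> S \<Longrightarrow> f x \<ominus>\<^bsub>M\<^esub> f y \<in> S"
  have "S +>\<^bsub>M\<^esub> f z = S +>\<^bsub>M\<^esub> f x" if "z \<in> S +>\<^bsub>M\<^esub> x" for z
  proof -
    have z: "z \<in> carrier M" using that x S.a_elemrcos_carrier by blast
    have "S +>\<^bsub>M\<^esub> z = S +>\<^bsub>M\<^esub> x" using S.a_repr_independence'[OF that x] by simp
    then have "z \<ominus>\<^bsub>M\<^esub> x \<in> S" using M.a_coset_eq_iff[OF S z x] by simp
    from resp[OF z x this] show ?thesis
      using M.a_coset_eq_iff[OF S] f z x by (simp add: Pi_iff)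
  qed
  moreover have "x \<in> S +>\<^bsub>M\<^esub> x" using S.a_rcos_self x by blast
  ultimately show "(\<Union>z\<in>S +>\<^bsub>M\<^esub> x. S +>\<^bsub>M\<^esub> f z) = S +>\<^bsub>M\<^esub> f x" by blast
qed

text \<open>Kept apart from the connection because it serves twice: for the quotient in a Baer sum,
  and for cohomology in degree one, which is a quotient over the constants.\<close>

lemma quot_module:
  assumes M: "Module.module R M" and S: "additive_subgroup S M"
    and sm: "\<And>a x. a \<in> carrier R \<Longrightarrow> x \<in> S \<Longrightarrow> a \<odot>\<^bsub>M\<^esub> x \<in> S"
  shows "Module.module R (quot_dmod M S)"
    and "a \<in> carrier R \<Longrightarrow> x \<in> carrier M \<Longrightarrow>
      a \<odot>\<^bsub>quot_dmod M S\<^esub> (S +>\<^bsub>M\<^esub> x) = S +>\<^bsub>M\<^esub> (a \<odot>\<^bsub>M\<^esub> x)"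
proof -
  interpret M: Module.module R M by (rule M)
  note q = quot_dmod_simps[OF M.M.abelian_group_axioms S]
  let ?Q = "quot_dmod M S"
  have smult: "a \<odot>\<^bsub>?Q\<^esub> (S +>\<^bsub>M\<^esub> x) = S +>\<^bsub>M\<^esub> (a \<odot>\<^bsub>M\<^esub> x)" if "a \<in> carrier R" "x \<in> carrier M" for a x
  proof -
    have "(\<Union>z\<in>S +>\<^bsub>M\<^esub> x. S +>\<^bsub>M\<^esub> (a \<odot>\<^bsub>M\<^esub> z)) = S +>\<^bsub>M\<^esub> (a \<odot>\<^bsub>M\<^esub> x)"
      by (rule q(5)) (use that sm in \<open>auto simp: M.smult_diff_distrib[symmetric]\<close>)
    then show ?thesis by (simp add: quot_dmod_def)
  qed
  then show "a \<in> carrier R \<Longrightarrow> x \<in> carrier M \<Longrightarrow> a \<odot>\<^bsub>?Q\<^esub> (S +>\<^bsub>M\<^esub> x) = S +>\<^bsub>M\<^esub> (a \<odot>\<^bsub>M\<^esub> x)" .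
  have "abelian_group ?Q"
  proof (rule abelian_groupI)
    fix X assume "X \<in> carrier ?Q"
    then obtain x where "x \<in> carrier M" "X = S +>\<^bsub>M\<^esub> x" using q(2) by blast
    then show "\<exists>Y\<in>carrier ?Q. Y \<oplus>\<^bsub>?Q\<^esub> X = \<zero>\<^bsub>?Q\<^esub>"
      by (intro bexI[of _ "S +>\<^bsub>M\<^esub> (\<ominus>\<^bsub>M\<^esub> x)"]) (simp_all add: q(1,3,4) M.M.l_neg)
  qed (auto dest!: q(2) simp: q(1,3,4) M.M.a_ac)
  then show "Module.module R ?Q"
    by (intro moduleI M.is_cring)
       (auto dest!: q(2) simp: q(1,3,4) smult M.smult_l_distr M.smult_r_distr M.smult_assoc1)
qed

lemma quot_dmod_dmod:
  assumes M: "dmod R d M" and S: "additive_subgroup S M" and d: "d \<in> carrier R \<rightarrow> carrier R"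
    and sm: "\<And>a x. a \<in> carrier R \<Longrightarrow> x \<in> S \<Longrightarrow> a \<odot>\<^bsub>M\<^esub> x \<in> S"
    and nab: "\<And>x. x \<in> S \<Longrightarrow> nabla M x \<in> S"
  shows "dmod R d (quot_dmod M S)"
    and "x \<in> carrier M \<Longrightarrow> nabla (quot_dmod M S) (S +>\<^bsub>M\<^esub> x) = S +>\<^bsub>M\<^esub> nabla M x"
proof -
  interpret M: Module.module R M using M by (rule dmod_module)
  note q = quot_dmod_simps[OF M.M.abelian_group_axioms S]
  note smult = quot_module(2)[OF M.module_axioms S sm]
  let ?Q = "quot_dmod M S"
  have nabla: "nabla ?Q (S +>\<^bsub>M\<^esub> x) = S +>\<^bsub>M\<^esub> nabla M x" if "x \<in> carrier M" for x
  proof -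
    have "(\<Union>z\<in>S +>\<^bsub>M\<^esub> x. S +>\<^bsub>M\<^esub> nabla M z) = S +>\<^bsub>M\<^esub> nabla M x"
      by (rule q(5)) (use that nab in \<open>auto simp: nabla_diff[OF M M M, symmetric] nabla_closed[OF M]\<close>)
    then show ?thesis by (simp add: quot_dmod_def)
  qed
  then show "x \<in> carrier M \<Longrightarrow> nabla ?Q (S +>\<^bsub>M\<^esub> x) = S +>\<^bsub>M\<^esub> nabla M x" .
  show "dmod R d ?Q"
    unfolding dmod_def
  proof (intro conjI ballI funcsetI)
    show "Module.module R ?Q" by (rule quot_module(1)[OF M.module_axioms S sm])
    fix X assume "X \<in> carrier ?Q"
    then obtain x where x: "x \<in> carrier M" "X = S +>\<^bsub>M\<^esub> x" using q(2) by blast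
    then show "nabla ?Q X \<in> carrier ?Q" by (simp add: nabla q(1) nabla_closed[OF M])
    show "nabla ?Q (a \<odot>\<^bsub>?Q\<^esub> X) = d a \<odot>\<^bsub>?Q\<^esub> X \<oplus>\<^bsub>?Q\<^esub> a \<odot>\<^bsub>?Q\<^esub> nabla ?Q X" if "a \<in> carrier R" for a
      using x that funcset_mem[OF d that] by (simp add: smult nabla q(3) nabla_closed[OF M] nabla_smult[OF M])
    fix Y assume "Y \<in> carrier ?Q"
    then obtain y where "y \<in> carrier M" "Y = S +>\<^bsub>M\<^esub> y" using q(2) by blast
    with x show "nabla ?Q (X \<oplus>\<^bsub>?Q\<^esub> Y) = nabla ?Q X \<oplus>\<^bsub>?Q\<^esub> nabla ?Q Y"
      by (simp add: nabla q(3) nabla_closed[OF M] nabla_add[OF M])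
  qed
qed

section \<open>The Baer sum as addition of cocycles\<close>

definition fibre_product ::
  "('r, 'e) dmodule \<Rightarrow> ('e \<Rightarrow> 'm) \<Rightarrow> ('r, 'f) dmodule \<Rightarrow> ('f \<Rightarrow> 'm) \<Rightarrow> ('r, 'e \<times> 'f) dmodule" where
  "fibre_product E p E' p' =
     (prod_dmod E E') \<lparr>carrier := {(e, e') \<in> carrier E \<times> carrier E'. p e = p' e'}\<rparr>"

text \<open>Sections \<sigma> and \<tau> of the summands combine to the section sending
  \<open>y\<close> to the class of the pair of \<open>\<sigma> y\<close> and
  \<open>\<tau> y\<close>. Its cocycle is first the pair of \<open>i (\<phi> y)\<close> and
  \<open>i' (\<phi>' y)\<close>; modulo the antidiagonal copy of \<open>N\<close> the second entry
  moves into the first slot, where the two are added.\<close>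

lemma baer_sum_cocycle:
  assumes x: "short_exact R d N E M i p" "cocycle R M (E, i, p) \<phi>"
    and x': "short_exact R d N E' M i' p'" "cocycle R M (E', i', p') \<phi>'"
    and \<phi>: "\<phi> \<in> lin_maps R M N" "\<phi>' \<in> lin_maps R M N" and d: "d \<in> carrier R \<rightarrow> carrier R"
  shows "case baer_sum M N (E, i, p) (E', i', p') of (B, j, q) \<Rightarrow>
    short_exact R d N B M j q \<and> cocycle R M (B, j, q) (\<lambda>y\<in>carrier M. \<phi> y \<oplus>\<^bsub>N\<^esub> \<phi>' y)"
proof -
  interpret X: short_exact_sequence R d N E M i p by unfold_locales fact
  interpret X': short_exact_sequence R d N E' M i' p' by unfold_locales fact
  note cl [simp] = X.i_simps X'.i_simps X.p_simps X'.p_simps X.nabla_simps X'.nabla_simps X.p_i X'.p_i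
    lin_maps_closed[OF \<phi>(1)] lin_maps_closed[OF \<phi>(2)]
  have neg_zero [simp]: "\<ominus>\<^bsub>M\<^esub> \<zero>\<^bsub>M\<^esub> = \<zero>\<^bsub>M\<^esub>" "\<ominus>\<^bsub>E'\<^esub> \<zero>\<^bsub>E'\<^esub> = \<zero>\<^bsub>E'\<^esub>"
    by (rule X.M.minus_equality X'.E.minus_equality; simp)+
  define P where "P = fibre_product E p E' p'"
  have P_carrier: "carrier P = {(e, e'). e \<in> carrier E \<and> e' \<in> carrier E' \<and> p e = p' e'}"
    and P_add: "(e, e') \<oplus>\<^bsub>P\<^esub> (f, f') = (e \<oplus>\<^bsub>E\<^esub> f, e' \<oplus>\<^bsub>E'\<^esub> f')"
    and P_zero: "\<zero>\<^bsub>P\<^esub> = (\<zero>\<^bsub>E\<^esub>, \<zero>\<^bsub>E'\<^esub>)" and P_smult: "a \<odot>\<^bsub>P\<^esub> (e, e') = (a \<odot>\<^bsub>E\<^esub> e, a \<odot>\<^bsub>E'\<^esub> e')"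
    and P_nabla: "nabla P (e, e') = (nabla E e, nabla E' e')" for e e' f f' a
    by (auto simp: P_def fibre_product_def prod_dmod_def)
  note P_simps = P_carrier P_add P_zero P_smult P_nabla
  have gP: "abelian_group P"
  proof (rule abelian_groupI)
    fix e assume e: "e \<in> carrier P"
    then have "(\<ominus>\<^bsub>E\<^esub> fst e, \<ominus>\<^bsub>E'\<^esub> snd e) \<in> carrier P" by (auto simp: P_simps)
    moreover have "(\<ominus>\<^bsub>E\<^esub> fst e, \<ominus>\<^bsub>E'\<^esub> snd e) \<oplus>\<^bsub>P\<^esub> e = \<zero>\<^bsub>P\<^esub>"
      using e by (auto simp: P_simps X.E.l_neg X'.E.l_neg)
    ultimately show "\<exists>f\<in>carrier P. f \<oplus>\<^bsub>P\<^esub> e = \<zero>\<^bsub>P\<^esub>" by blast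
  qed (auto simp: P_simps X.E.a_ac X'.E.a_ac)
  then have mP: "Module.module R P"
    by (intro moduleI X.N.is_cring)
       (auto simp: P_simps X.E.smult_l_distr X'.E.smult_l_distr X.E.smult_r_distr X'.E.smult_r_distr
          X.E.smult_assoc1 X'.E.smult_assoc1)
  interpret P: Module.module R P by (rule mP)
  have dP: "dmod R d P"
    unfolding dmod_def
  proof (intro conjI ballI funcsetI mP)
    fix z assume "z \<in> carrier P"
    then obtain e e' where z: "z = (e, e')" "e \<in> carrier E" "e' \<in> carrier E'" "p e = p' e'"
      by (auto simp: P_simps)
    then show "nabla P z \<in> carrier P" by (simp add: P_simps X.p_nabla X'.p_nabla)
    show "nabla P (a \<odot>\<^bsub>P\<^esub> z) = d a \<odot>\<^bsub>P\<^esub> z \<oplus>\<^bsub>P\<^esub> a \<odot>\<^bsub>P\<^esub> nabla P z" if "a \<in> carrier R" for a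
      using z that by (simp add: P_simps nabla_smult[OF X.dmods(2)] nabla_smult[OF X'.dmods(2)])
    fix w assume "w \<in> carrier P"
    then obtain f f' where "w = (f, f')" "f \<in> carrier E" "f' \<in> carrier E'" by (auto simp: P_simps)
    with z show "nabla P (z \<oplus>\<^bsub>P\<^esub> w) = nabla P z \<oplus>\<^bsub>P\<^esub> nabla P w" by (simp add: P_simps)
  qed
  have P_neg: "\<ominus>\<^bsub>P\<^esub> (e, e') = (\<ominus>\<^bsub>E\<^esub> e, \<ominus>\<^bsub>E'\<^esub> e')" if "(e, e') \<in> carrier P" for e e'
    by (rule P.minus_equality) (use that in \<open>auto simp: P_simps X.E.l_neg X'.E.l_neg\<close>)
  have P_diff: "(e, e') \<ominus>\<^bsub>P\<^esub> (f, f') = (e \<ominus>\<^bsub>E\<^esub> f, e' \<ominus>\<^bsub>E'\<^esub> f')"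
    if "(e, e') \<in> carrier P" "(f, f') \<in> carrier P" for e e' f f'
    using that by (simp add: a_minus_def P_neg P_add)
  define S where "S = (\<lambda>x. (i x, \<ominus>\<^bsub>E'\<^esub> i' x)) ` carrier N"
  have S_I: "(i x, \<ominus>\<^bsub>E'\<^esub> i' x) \<in> S" if "x \<in> carrier N" for x
    using that by (auto simp: S_def)
  have S: "additive_subgroup S P"
  proof (rule additive_subgroup.intro, rule P.add.subgroupI)
    show "S \<subseteq> carrier P" by (auto simp: S_def P_simps)
    show "S \<noteq> {}" by (auto simp: S_def)
    show "\<ominus>\<^bsub>P\<^esub> a \<in> S" if "a \<in> S" for a
    proof -
      from that obtain x where x: "x \<in> carrier N" "a = (i x, \<ominus>\<^bsub>E'\<^esub> i' x)" by (auto simp: S_def)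
      then have eq: "\<ominus>\<^bsub>P\<^esub> a = (i (\<ominus>\<^bsub>N\<^esub> x), \<ominus>\<^bsub>E'\<^esub> i' (\<ominus>\<^bsub>N\<^esub> x))"
        by (auto simp: P_simps P_neg)
      show ?thesis unfolding eq using x by (intro S_I) simp
    qed
    show "a \<oplus>\<^bsub>P\<^esub> b \<in> S" if "a \<in> S" "b \<in> S" for a b
    proof -
      from that obtain x y where x: "x \<in> carrier N" "a = (i x, \<ominus>\<^bsub>E'\<^esub> i' x)" "y \<in> carrier N" "b = (i y, \<ominus>\<^bsub>E'\<^esub> i' y)"
        by (auto simp: S_def)
      then have eq: "a \<oplus>\<^bsub>P\<^esub> b = (i (x \<oplus>\<^bsub>N\<^esub> y), \<ominus>\<^bsub>E'\<^esub> i' (x \<oplus>\<^bsub>N\<^esub> y))"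
        by (simp add: P_simps X'.E.minus_add)
      show ?thesis unfolding eq using x by (intro S_I) simp
    qed
  qed
  have Ssm: "a \<odot>\<^bsub>P\<^esub> s \<in> S" if "a \<in> carrier R" "s \<in> S" for a s
  proof -
    from that obtain x where x: "x \<in> carrier N" "s = (i x, \<ominus>\<^bsub>E'\<^esub> i' x)" by (auto simp: S_def)
    then have eq: "a \<odot>\<^bsub>P\<^esub> s = (i (a \<odot>\<^bsub>N\<^esub> x), \<ominus>\<^bsub>E'\<^esub> i' (a \<odot>\<^bsub>N\<^esub> x))"
      using that by (simp add: P_simps X'.E.smult_r_minus)
    show ?thesis unfolding eq using x that by (intro S_I) simp
  qed
  have Snab: "nabla P s \<in> S" if "s \<in> S" for s
  proof -
    from that obtain x where x: "x \<in> carrier N" "s = (i x, \<ominus>\<^bsub>E'\<^esub> i' x)" by (auto simp: S_def)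
    then have eq: "nabla P s = (i (nabla N x), \<ominus>\<^bsub>E'\<^esub> i' (nabla N x))"
      by (auto simp: P_simps X.i_nabla X'.i_nabla nabla_neg[OF X'.dmods(2) X'.dmods(2) X'.dmods(2)])
    show ?thesis unfolding eq using x by (intro S_I) simp
  qed
  define Q where "Q = quot_dmod P S"
  note q = quot_dmod_simps[OF gP S, folded Q_def]
  note Q_smult = quot_module(2)[OF mP S Ssm, folded Q_def]
  note dQ = quot_dmod_dmod(1)[OF dP S d Ssm Snab, folded Q_def]
  note Q_nabla = quot_dmod_dmod(2)[OF dP S d Ssm Snab, folded Q_def]
  note Q_simps = q(1,3,4) Q_smult Q_nabla
  have S_iff: "(e, e') \<in> S \<longleftrightarrow> (\<exists>x\<in>carrier N. e = i x \<and> e' = \<ominus>\<^bsub>E'\<^esub> i' x)" for e e'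
    by (auto simp: S_def)
  define j where "j = (\<lambda>x\<in>carrier N. S +>\<^bsub>P\<^esub> (i x, \<zero>\<^bsub>E'\<^esub>))"
  define r where "r = (\<lambda>X\<in>carrier Q. the_elem ((\<lambda>(e, e'). p e) ` X))"
  \<comment> \<open>The first components of a coset differ by elements of the image of
    \<open>i\<close>, which \<open>p\<close> kills. So the set under \<open>the_elem\<close> is a
    singleton.\<close>
  have r_eq: "r (S +>\<^bsub>P\<^esub> (e, e')) = p e" if "(e, e') \<in> carrier P" for e e'
  proof -
    interpret S: abelian_subgroup S P by (rule abelian_subgroupI3) (fact S, fact gP)
    have self: "(e, e') \<in> S +>\<^bsub>P\<^esub> (e, e')" using that by (rule S.a_rcos_self)
    have const: "p f = p e" if "(f, f') \<in> S +>\<^bsub>P\<^esub> (e, e')" for f f'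
      using that \<open>(e, e') \<in> carrier P\<close> by (auto simp: a_r_coset_def' S_def P_simps)
    have "(\<lambda>(e, e'). p e) ` (S +>\<^bsub>P\<^esub> (e, e')) = {p e}"
    proof (intro equalityI subsetI)
      fix y assume "y \<in> (\<lambda>(e, e'). p e) ` (S +>\<^bsub>P\<^esub> (e, e'))"
      then obtain f f' where "(f, f') \<in> S +>\<^bsub>P\<^esub> (e, e')" "y = p f" by (elim imageE) (simp split: prod.splits)
      from this(2) const[OF this(1)] show "y \<in> {p e}" by simp
    next
      fix y assume "y \<in> {p e}"
      then show "y \<in> (\<lambda>(e, e'). p e) ` (S +>\<^bsub>P\<^esub> (e, e'))"
        by (intro image_eqI[OF _ self]) simp
    qed
    then show ?thesis using that by (simp add: r_def Q_simps)
  qed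
  have j_hom: "j \<in> dmod_hom R N Q"
    unfolding dmod_hom_def j_def
  proof (intro CollectI conjI lin_mapsI[OF _ _ _ X.N.module_axioms] ballI)
  qed (auto simp: Q_simps P_simps X.i_nabla nabla_zero[OF X'.dmods(2) X'.dmods(2) X'.dmods(2)])
  have r_lin: "(\<lambda>X\<in>carrier Q. r X) \<in> lin_maps R Q M"
    by (rule lin_mapsI[OF _ _ _ dmod_module[OF dQ]])
       (auto dest!: q(2) simp: Q_simps r_eq P_simps)
  moreover have "(\<lambda>X\<in>carrier Q. r X) = r" by (auto simp: r_def)
  ultimately have r_hom: "r \<in> dmod_hom R Q M"
    unfolding dmod_hom_def by (auto dest!: q(2) simp: Q_simps r_eq P_simps X.p_nabla X'.p_nabla)
  have exact: "short_exact R d N Q M j r"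
    unfolding short_exact_def
  proof (intro conjI X.dmods dQ j_hom r_hom)
    show "inj_on j (carrier N)"
    proof
      fix x y assume xy: "x \<in> carrier N" "y \<in> carrier N" "j x = j y"
      then have "(i x, \<zero>\<^bsub>E'\<^esub>) \<ominus>\<^bsub>P\<^esub> (i y, \<zero>\<^bsub>E'\<^esub>) \<in> S"
        by (subst P.M.a_coset_eq_iff[OF S, symmetric]) (auto simp: j_def P_simps)
      then have "(i (x \<ominus>\<^bsub>N\<^esub> y), \<zero>\<^bsub>E'\<^esub>) \<in> S" using xy by (simp add: P_diff P_simps)
      then obtain z where z: "z \<in> carrier N" "i (x \<ominus>\<^bsub>N\<^esub> y) = i z" "\<zero>\<^bsub>E'\<^esub> = \<ominus>\<^bsub>E'\<^esub> i' z"
        unfolding S_iff by blast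
      then have "i' z = i' \<zero>\<^bsub>N\<^esub>" by (metis X'.E.minus_minus neg_zero(2) X'.i_simps(1,4))
      then have "z = \<zero>\<^bsub>N\<^esub>" using z X'.i_inj by (simp add: inj_onD)
      moreover have "x \<ominus>\<^bsub>N\<^esub> y = z" using z xy X.i_inj by (simp add: inj_onD del: X.i_simps(5))
      ultimately show "x = y" using xy by (simp add: X.N.diff_eq_iff)
    qed
    show "j ` carrier N = {X \<in> carrier Q. r X = \<zero>\<^bsub>M\<^esub>}"
    proof (intro equalityI subsetI)
      fix X assume "X \<in> {X \<in> carrier Q. r X = \<zero>\<^bsub>M\<^esub>}"
      then have X: "X \<in> carrier Q" "r X = \<zero>\<^bsub>M\<^esub>" by auto
      then obtain e e' where e: "(e, e') \<in> carrier P" "X = S +>\<^bsub>P\<^esub> (e, e')" using q(2) by fastforce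
      then have "p e = \<zero>\<^bsub>M\<^esub>" "p' e' = \<zero>\<^bsub>M\<^esub>" using X r_eq by (auto simp: P_simps)
      then have "e \<in> i ` carrier N" "e' \<in> i' ` carrier N"
        using e unfolding X.i_image X'.i_image by (auto simp: P_simps)
      then obtain x y where xy: "x \<in> carrier N" "y \<in> carrier N" "e = i x" "e' = i' y" by blast
      \<comment> \<open>The difference is the antidiagonal element attached to the negative of
        \<open>y\<close>: subtracting \<open>i y\<close> in the first slot has the same effect as
        cancelling \<open>i' y\<close> in the second.\<close>
      have "(e, e') \<ominus>\<^bsub>P\<^esub> (i (x \<oplus>\<^bsub>N\<^esub> y), \<zero>\<^bsub>E'\<^esub>) = (i x \<ominus>\<^bsub>E\<^esub> (i x \<oplus>\<^bsub>E\<^esub> i y), i' y)"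
        using e xy by (subst P_diff) (auto simp: P_simps)
      also have "i x \<ominus>\<^bsub>E\<^esub> (i x \<oplus>\<^bsub>E\<^esub> i y) = i (\<ominus>\<^bsub>N\<^esub> y)"
        using xy by (simp add: a_minus_def X.E.minus_add X.E.r_neg1 X.E.r_neg2 X.E.a_assoc[symmetric] X.E.r_neg)
      finally have "(e, e') \<ominus>\<^bsub>P\<^esub> (i (x \<oplus>\<^bsub>N\<^esub> y), \<zero>\<^bsub>E'\<^esub>) \<in> S"
        using xy by (auto simp: S_iff intro!: bexI[of _ "\<ominus>\<^bsub>N\<^esub> y"])
      then have "X = j (x \<oplus>\<^bsub>N\<^esub> y)"
        using e xy P.M.a_coset_eq_iff[OF S, of "(e, e')" "(i (x \<oplus>\<^bsub>N\<^esub> y), \<zero>\<^bsub>E'\<^esub>)"] by (simp add: j_def P_simps)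
      then show "X \<in> j ` carrier N" using xy by blast
    qed (auto simp: j_def Q_simps r_eq P_simps)
    show "r ` carrier Q = carrier M"
    proof (intro equalityI subsetI)
      fix y assume y: "y \<in> carrier M"
      then obtain e e' where "e \<in> carrier E" "e' \<in> carrier E'" "p e = y" "p' e' = y"
        using X.p_image X'.p_image by (metis imageE)
      then have "(e, e') \<in> carrier P" "r (S +>\<^bsub>P\<^esub> (e, e')) = y" by (auto simp: P_simps r_eq)
      then show "y \<in> r ` carrier Q" using q(1) by blast
    qed (auto dest!: q(2) simp: r_eq P_simps)
  qed
  from x(2) obtain \<sigma> where \<sigma>: "\<sigma> \<in> lin_maps R M E" and p\<sigma>: "\<And>y. y \<in> carrier M \<Longrightarrow> p (\<sigma> y) = y"
    and n\<sigma>: "\<And>y. y \<in> carrier M \<Longrightarrow> nabla E (\<sigma> y) = i (\<phi> y) \<oplus>\<^bsub>E\<^esub> \<sigma> (nabla M y)"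
    unfolding cocycle_def by auto
  from x'(2) obtain \<tau> where \<tau>: "\<tau> \<in> lin_maps R M E'" and p\<tau>: "\<And>y. y \<in> carrier M \<Longrightarrow> p' (\<tau> y) = y"
    and n\<tau>: "\<And>y. y \<in> carrier M \<Longrightarrow> nabla E' (\<tau> y) = i' (\<phi>' y) \<oplus>\<^bsub>E'\<^esub> \<tau> (nabla M y)"
    unfolding cocycle_def by auto
  note \<sigma>\<tau> = lin_maps_closed[OF \<sigma>] lin_maps_closed[OF \<tau>] lin_maps_add[OF \<sigma>] lin_maps_add[OF \<tau>]
    lin_maps_smult[OF \<sigma>] lin_maps_smult[OF \<tau>] p\<sigma> p\<tau>
  have t: "(\<lambda>y\<in>carrier M. S +>\<^bsub>P\<^esub> (\<sigma> y, \<tau> y)) \<in> lin_maps R M Q"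
    by (rule lin_mapsI[OF _ _ _ X.M.module_axioms]) (auto simp: Q_simps P_simps \<sigma>\<tau>)
  have "cocycle R M (Q, j, r) (\<lambda>y\<in>carrier M. \<phi> y \<oplus>\<^bsub>N\<^esub> \<phi>' y)"
    unfolding cocycle_def prod.case
  proof (intro bexI[OF _ t] ballI conjI)
    fix y assume y: "y \<in> carrier M"
    show "r ((\<lambda>y\<in>carrier M. S +>\<^bsub>P\<^esub> (\<sigma> y, \<tau> y)) y) = y" using y by (simp add: r_eq P_simps \<sigma>\<tau>)
    define u where "u = (\<sigma> (nabla M y), \<tau> (nabla M y))"
    have u: "u \<in> carrier P" using y by (simp add: u_def P_simps \<sigma>\<tau>)
    have "nabla Q (S +>\<^bsub>P\<^esub> (\<sigma> y, \<tau> y)) = S +>\<^bsub>P\<^esub> ((i (\<phi> y), i' (\<phi>' y)) \<oplus>\<^bsub>P\<^esub> u)"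
      using y by (simp add: Q_simps P_simps \<sigma>\<tau> n\<sigma> n\<tau> u_def)
    also have "\<dots> = (S +>\<^bsub>P\<^esub> (i (\<phi> y), i' (\<phi>' y))) \<oplus>\<^bsub>Q\<^esub> (S +>\<^bsub>P\<^esub> u)"
      using y u by (simp add: Q_simps P_carrier)
    also have "S +>\<^bsub>P\<^esub> (i (\<phi> y), i' (\<phi>' y)) = S +>\<^bsub>P\<^esub> (i (\<phi> y \<oplus>\<^bsub>N\<^esub> \<phi>' y), \<zero>\<^bsub>E'\<^esub>)"
    proof (subst P.M.a_coset_eq_iff[OF S])
      have "(i (\<phi> y), i' (\<phi>' y)) \<ominus>\<^bsub>P\<^esub> (i (\<phi> y \<oplus>\<^bsub>N\<^esub> \<phi>' y), \<zero>\<^bsub>E'\<^esub>) =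
          (i (\<phi> y) \<ominus>\<^bsub>E\<^esub> (i (\<phi> y) \<oplus>\<^bsub>E\<^esub> i (\<phi>' y)), i' (\<phi>' y))"
        using y by (subst P_diff) (auto simp: P_simps)
      also have "i (\<phi> y) \<ominus>\<^bsub>E\<^esub> (i (\<phi> y) \<oplus>\<^bsub>E\<^esub> i (\<phi>' y)) = i (\<ominus>\<^bsub>N\<^esub> \<phi>' y)"
        using y by (simp add: a_minus_def X.E.minus_add X.E.a_assoc[symmetric] X.E.r_neg)
      finally show "(i (\<phi> y), i' (\<phi>' y)) \<ominus>\<^bsub>P\<^esub> (i (\<phi> y \<oplus>\<^bsub>N\<^esub> \<phi>' y), \<zero>\<^bsub>E'\<^esub>) \<in> S"
        using y by (auto simp: S_iff intro!: bexI[of _ "\<ominus>\<^bsub>N\<^esub> \<phi>' y"])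
    qed (use y in \<open>auto simp: P_simps\<close>)
    finally show "nabla Q ((\<lambda>y\<in>carrier M. S +>\<^bsub>P\<^esub> (\<sigma> y, \<tau> y)) y) =
        j ((\<lambda>y\<in>carrier M. \<phi> y \<oplus>\<^bsub>N\<^esub> \<phi>' y) y) \<oplus>\<^bsub>Q\<^esub> (\<lambda>y\<in>carrier M. S +>\<^bsub>P\<^esub> (\<sigma> y, \<tau> y)) (nabla M y)"
      using y by (simp add: j_def u_def)
  qed
  moreover have "baer_sum M N (E, i, p) (E', i', p') = (Q, j, r)"
    by (simp add: baer_sum_def Let_def Q_def P_def S_def j_def r_def fibre_product_def)
  ultimately show ?thesis using exact by simp
qed

section \<open>Scalar extension\<close>

definition subring_of :: "'a::comm_ring_1 set \<Rightarrow> 'a ring" where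
  "subring_of S = class_ring\<lparr>carrier := S\<rparr>"

lemma subring_of_simps [simp]:
  "carrier (subring_of S) = S" "x \<otimes>\<^bsub>subring_of S\<^esub> y = x * y" "x \<oplus>\<^bsub>subring_of S\<^esub> y = x + y"
  "\<one>\<^bsub>subring_of S\<^esub> = 1" "\<zero>\<^bsub>subring_of S\<^esub> = 0"
  by (simp_all add: subring_of_def)

text \<open>Single letters generate all words under differences, so an additive map is controlled by
  its values on letters.\<close>

lemma frag_extend_additive:
  assumes "Poly_Mapping.keys w \<subseteq> K" and "\<And>k. k \<in> K \<Longrightarrow> T (frag_of k) \<in> I" and "0 \<in> I"
    and "\<And>u v. u \<in> I \<Longrightarrow> v \<in> I \<Longrightarrow> u - v \<in> I" and "\<And>u v. T (u - v) = T u - (T v :: 'b::ab_group_add)"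
  shows "T w \<in> I"
proof -
  have "T 0 = 0" using assms(5)[of 0 0] by simp
  with assms show ?thesis by (induction w rule: frag_induction) simp_all
qed

text \<open>The big ring \<open>A\<close> is the whole type and \<open>R\<close> is carried by the
  subset \<open>S\<close>. That \<open>S\<close> is a commutative ring is not listed among the
  assumptions because every \<open>dmod R d M\<close> already contains it.\<close>

locale scalar_extension =
  fixes S :: "'a::comm_ring_1 set" and d :: "'a \<Rightarrow> 'a"
  assumes d_add: "d (a + b) = d a + d b" and d_mult: "d (a * b) = d a * b + a * d b"
    and d_closed: "a \<in> S \<Longrightarrow> d a \<in> S"
begin

abbreviation "R \<equiv> subring_of S"
abbreviation "A \<equiv> class_ring :: 'a ring"
abbreviation "ext \<equiv> base_change A R d"
abbreviation "ext_hom \<equiv> base_change_hom A R d"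

lemma d_funcset: "d \<in> carrier R \<rightarrow> carrier R" "d \<in> carrier A \<rightarrow> carrier A"
  by (simp_all add: d_closed)

text \<open>The class of a formal sum in the tensor product. All computations below take place on
  formal sums, the \<open>words\<close>, modulo the relations; \<open>pure\<close> is the class of a
  single letter, a pure tensor.\<close>

definition cls :: "('a, 'm) dmodule \<Rightarrow> ('a \<times> 'm \<Rightarrow>\<^sub>0 int) \<Rightarrow> ('a \<times> 'm \<Rightarrow>\<^sub>0 int) set" where
  "cls M w = tensor_rel A R M #>\<^bsub>tensor_pre A M\<^esub> w"

definition pure :: "('a, 'm) dmodule \<Rightarrow> 'a \<Rightarrow> 'm \<Rightarrow> ('a \<times> 'm \<Rightarrow>\<^sub>0 int) set" where
  "pure M a x = cls M (frag_of (a, x))"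

definition words :: "('a, 'm) dmodule \<Rightarrow> ('a \<times> 'm \<Rightarrow>\<^sub>0 int) set" where
  "words M = {w. Poly_Mapping.keys w \<subseteq> UNIV \<times> carrier M}"

lemma words_iff: "w \<in> words M \<longleftrightarrow> Poly_Mapping.keys w \<subseteq> UNIV \<times> carrier M"
  by (simp add: words_def)

lemma tensor_pre_simps: "carrier (tensor_pre A M) = words M" "w \<otimes>\<^bsub>tensor_pre A M\<^esub> w' = w + w'"
  by (auto simp: tensor_pre_def words_iff)

lemma cls_eq: "cls M w = (\<lambda>h. h + w) ` tensor_rel A R M"
  by (auto simp: cls_def r_coset_def tensor_pre_simps)

lemma words_simps [simp]: "frag_of (a, x) \<in> words M \<longleftrightarrow> x \<in> carrier M" "0 \<in> words M"
  "w \<in> words M \<Longrightarrow> w' \<in> words M \<Longrightarrow> w + w' \<in> words M"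
  "w \<in> words M \<Longrightarrow> w' \<in> words M \<Longrightarrow> w - w' \<in> words M"
  "w \<in> words M \<Longrightarrow> - w \<in> words M"
  using keys_add[of w w'] keys_diff[of w w'] unfolding words_iff by auto

lemma words_extend:
  assumes "w \<in> words M" "\<And>a x. x \<in> carrier M \<Longrightarrow> t (a, x) \<in> words N"
  shows "frag_extend t w \<in> words N"
  using assms keys_frag_extend[of t w] unfolding words_iff by fastforce

context
  fixes M :: "('a, 'm) dmodule"
  assumes M: "dmod R d M"
begin

interpretation M: Module.module R M using M by (rule dmod_module)

lemma rel_gens:
  "x \<in> carrier M \<Longrightarrow> frag_of (a + b, x) - frag_of (a, x) - frag_of (b, x) \<in> tensor_rel A R M"
  "x \<in> carrier M \<Longrightarrow> y \<in> carrier M \<Longrightarrow>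
    frag_of (a, x \<oplus>\<^bsub>M\<^esub> y) - frag_of (a, x) - frag_of (a, y) \<in> tensor_rel A R M"
  "c \<in> S \<Longrightarrow> x \<in> carrier M \<Longrightarrow> frag_of (a * c, x) - frag_of (a, c \<odot>\<^bsub>M\<^esub> x) \<in> tensor_rel A R M"
  unfolding tensor_rel_def by (rule generate.incl; force)+

lemma rel_induct [consumes 1, case_names zero add smult_add scalar plus neg]:
  assumes w: "w \<in> tensor_rel A R M"
    and "P 0"
    and "\<And>a b x. x \<in> carrier M \<Longrightarrow> P (frag_of (a + b, x) - frag_of (a, x) - frag_of (b, x))"
    and "\<And>a x y. x \<in> carrier M \<Longrightarrow> y \<in> carrier M \<Longrightarrow>
      P (frag_of (a, x \<oplus>\<^bsub>M\<^esub> y) - frag_of (a, x) - frag_of (a, y))"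
    and "\<And>a c x. c \<in> S \<Longrightarrow> x \<in> carrier M \<Longrightarrow> P (frag_of (a * c, x) - frag_of (a, c \<odot>\<^bsub>M\<^esub> x))"
    and plus: "\<And>w w'. P w \<Longrightarrow> P w' \<Longrightarrow> P (w + w')" and neg: "\<And>w. P w \<Longrightarrow> P (- w)"
  shows "P w"
  using w unfolding tensor_rel_def
proof (induction rule: generate.induct)
  case one show ?case using assms(2) by (simp add: tensor_pre_def)
next
  case (incl h) then show ?case using assms(3-5) by auto
next
  case (inv h)
  then have "h \<in> words M" by (auto intro!: words_simps(4) simp: words_simps(1))
  then have "inv\<^bsub>tensor_pre A M\<^esub> h = - h" by (simp add: tensor_pre_def words_iff)
    moreover have "P h" using inv assms(3-5) by auto
  ultimately show ?case using neg by simp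
next
  case (eng h1 h2) then show ?case using plus by (simp add: tensor_pre_simps)
qed

lemma rel_words: "tensor_rel A R M \<subseteq> words M"
proof
  fix w assume "w \<in> tensor_rel A R M"
  then show "w \<in> words M"
    by (induction rule: rel_induct) (simp_all add: words_simps)
qed

lemma rel_zero: "0 \<in> tensor_rel A R M"
  using generate.one[of "tensor_pre A M"] by (simp add: tensor_rel_def tensor_pre_def)

lemma rel_plus: "w \<in> tensor_rel A R M \<Longrightarrow> w' \<in> tensor_rel A R M \<Longrightarrow> w + w' \<in> tensor_rel A R M"
  using generate.eng[of w "tensor_pre A M" _ w'] unfolding tensor_rel_def by (simp add: tensor_pre_simps)

lemma rel_neg: "w \<in> tensor_rel A R M \<Longrightarrow> - w \<in> tensor_rel A R M"
proof -
  interpret G: group "tensor_pre A M" by (simp add: tensor_pre_def)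
  have "subgroup (tensor_rel A R M) (tensor_pre A M)"
    unfolding tensor_rel_def
    by (rule G.generate_is_subgroup)
       (auto intro!: words_simps(4) simp: words_simps(1) tensor_pre_simps)
  from subgroup.m_inv_closed[OF this, of w] show "w \<in> tensor_rel A R M \<Longrightarrow> - w \<in> tensor_rel A R M"
    using rel_words by (auto simp: tensor_pre_def words_iff)
qed

lemma rel_minus: "w \<in> tensor_rel A R M \<Longrightarrow> w' \<in> tensor_rel A R M \<Longrightarrow> w - w' \<in> tensor_rel A R M"
  using rel_plus[OF _ rel_neg, of w w'] by simp

lemma cls_eq_iff: "cls M w = cls M w' \<longleftrightarrow> w - w' \<in> tensor_rel A R M"
proof
  assume "cls M w = cls M w'"
  moreover have "w \<in> cls M w" unfolding cls_eq using rel_zero by force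
  ultimately show "w - w' \<in> tensor_rel A R M" by (auto simp: cls_eq)
next
  assume *: "w - w' \<in> tensor_rel A R M"
  show "cls M w = cls M w'" unfolding cls_eq
  proof (intro equalityI image_subsetI)
    fix h assume h: "h \<in> tensor_rel A R M"
    show "h + w \<in> (\<lambda>h. h + w') ` tensor_rel A R M"
      by (rule image_eqI[of _ _ "h + (w - w')"]) (simp, rule rel_plus[OF h *])
    show "h + w' \<in> (\<lambda>h. h + w) ` tensor_rel A R M"
      by (rule image_eqI[of _ _ "h - (w - w')"]) (simp, rule rel_minus[OF h *])
  qed
qed

lemma cls_add: "cls M w \<oplus>\<^bsub>ext M\<^esub> cls M w' = cls M (w + w')"
proof -
  have "cls M w \<oplus>\<^bsub>ext M\<^esub> cls M w' = {h + w + (h' + w') | h h'. h \<in> tensor_rel A R M \<and> h' \<in> tensor_rel A R M}"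
    by (auto simp: base_change_def set_mult_def cls_eq tensor_pre_simps)
  also have "\<dots> = cls M (w + w')"
  proof (intro equalityI subsetI)
    fix z assume "z \<in> cls M (w + w')"
    then obtain h where "h \<in> tensor_rel A R M" "z = h + w + (0 + w')" by (auto simp: cls_eq add.assoc)
    then show "z \<in> {h + w + (h' + w') | h h'. h \<in> tensor_rel A R M \<and> h' \<in> tensor_rel A R M}"
      using rel_zero by blast
  next
    fix z assume "z \<in> {h + w + (h' + w') | h h'. h \<in> tensor_rel A R M \<and> h' \<in> tensor_rel A R M}"
    then obtain h h' where "h \<in> tensor_rel A R M" "h' \<in> tensor_rel A R M" "z = (h + h') + (w + w')"
      by (auto simp: add_ac)
    then show "z \<in> cls M (w + w')" using rel_plus by (auto simp: cls_eq)
  qed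
  finally show ?thesis .
qed

lemma ext_carrier: "carrier (ext M) = cls M ` words M"
  by (auto simp: base_change_def RCOSETS_def cls_def tensor_pre_simps)

lemma ext_zero: "\<zero>\<^bsub>ext M\<^esub> = cls M 0"
  by (simp add: base_change_def cls_eq)

end

text \<open>A map on letters that preserves the relations gives the same coset for all
  representatives, so the union defining the lift collapses.\<close>

lemma tensor_lift_cls:
  assumes M: "dmod R d M" and N: "dmod R d N"
    and t: "\<And>w. w \<in> tensor_rel A R M \<Longrightarrow> frag_extend t w \<in> tensor_rel A R N"
  shows "tensor_lift A R N t (cls M w) = cls N (frag_extend t w)"
proof -
  have "cls N (frag_extend t w') = cls N (frag_extend t w)" if "w' \<in> cls M w" for w'
    using that t cls_eq_iff[OF N] by (auto simp: cls_eq frag_extend_add)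
  moreover have "w \<in> cls M w" using rel_zero[OF M] by (force simp: cls_eq)
  ultimately show ?thesis unfolding tensor_lift_def cls_def[symmetric] by blast
qed

context
  fixes M :: "('a, 'm) dmodule"
  assumes M: "dmod R d M"
begin

interpretation M: Module.module R M using M by (rule dmod_module)

definition "scale_word a = frag_extend (\<lambda>(b, x :: 'm). frag_of (a * b, x))"
definition "nabla_word = frag_extend (\<lambda>(b, x). frag_of (d b, x) + frag_of (b, nabla M x))"

lemma scale_word_simps: "scale_word a (frag_of (b, x)) = frag_of (a * b, x)"
  "scale_word a (u + v) = scale_word a u + scale_word a v"
  "scale_word a (u - v) = scale_word a u - scale_word a v"
  "scale_word a (- u) = - scale_word a u" "scale_word a 0 = 0"
  by (simp_all add: scale_word_def frag_extend_add frag_extend_diff frag_extend_minus)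

lemma nabla_word_simps: "nabla_word (frag_of (b, x)) = frag_of (d b, x) + frag_of (b, nabla M x)"
  "nabla_word (u + v) = nabla_word u + nabla_word v"
  "nabla_word (u - v) = nabla_word u - nabla_word v"
  "nabla_word (- u) = - nabla_word u" "nabla_word 0 = 0"
  by (simp_all add: nabla_word_def frag_extend_add frag_extend_diff frag_extend_minus)

lemma scale_word_words: "w \<in> words M \<Longrightarrow> scale_word a w \<in> words M"
  unfolding scale_word_def by (rule words_extend) (auto simp: words_simps)

lemma nabla_word_words: "w \<in> words M \<Longrightarrow> nabla_word w \<in> words M"
  unfolding nabla_word_def
  by (rule words_extend, assumption)
     (simp add: words_simps nabla_closed[OF M])

lemma scale_word_rel: "w \<in> tensor_rel A R M \<Longrightarrow> scale_word a w \<in> tensor_rel A R M"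
proof (induction rule: rel_induct[OF M, consumes 1, case_names zero add smult_add scalar plus neg])
qed (auto simp: scale_word_simps distrib_left mult.assoc[symmetric] rel_gens[OF M] rel_plus[OF M] rel_neg[OF M]
  rel_zero[OF M])

text \<open>Moving a scalar across the tensor sign is the delicate relation: there the Leibniz rule
  of \<open>d\<close> must match that of the connection on \<open>M\<close>. The other relations
  follow from additivity.\<close>

lemma nabla_word_rel: "w \<in> tensor_rel A R M \<Longrightarrow> nabla_word w \<in> tensor_rel A R M"
proof (induction rule: rel_induct[OF M, consumes 1, case_names zero add smult_add scalar plus neg])
  case (add a b x)
  have "nabla_word (frag_of (a + b, x) - frag_of (a, x) - frag_of (b, x)) =
      (frag_of (d a + d b, x) - frag_of (d a, x) - frag_of (d b, x)) +
      (frag_of (a + b, nabla M x) - frag_of (a, nabla M x) - frag_of (b, nabla M x))"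
    by (simp add: nabla_word_simps d_add)
  then show ?case using add by (metis rel_plus[OF M] rel_gens(1)[OF M] nabla_closed[OF M])
next
  case (smult_add a x y)
  have "nabla_word (frag_of (a, x \<oplus>\<^bsub>M\<^esub> y) - frag_of (a, x) - frag_of (a, y)) =
      (frag_of (d a, x \<oplus>\<^bsub>M\<^esub> y) - frag_of (d a, x) - frag_of (d a, y)) +
      (frag_of (a, nabla M x \<oplus>\<^bsub>M\<^esub> nabla M y) - frag_of (a, nabla M x) - frag_of (a, nabla M y))"
    using smult_add by (simp add: nabla_word_simps nabla_add[OF M])
  then show ?case using smult_add by (metis rel_plus[OF M] rel_gens(2)[OF M] nabla_closed[OF M])
next
  case (scalar a c x)
  let ?nx = "nabla M x"
  note mem = scalar d_closed[OF scalar(1)] nabla_closed[OF M scalar(2)] M.smult_closed[of c ?nx]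
    M.smult_closed[of "d c" x]
  \<comment> \<open>The Leibniz rule in the ring splits the first factor and the one in the module
    splits the second; what remains are three relations, two moving \<open>c\<close> across the
    tensor sign and one moving \<open>d c\<close>.\<close>
  have "nabla_word (frag_of (a * c, x) - frag_of (a, c \<odot>\<^bsub>M\<^esub> x)) =
      (frag_of (d a * c + a * d c, x) - frag_of (d a * c, x) - frag_of (a * d c, x)) +
      (frag_of (d a * c, x) - frag_of (d a, c \<odot>\<^bsub>M\<^esub> x)) + (frag_of (a * d c, x) - frag_of (a, d c \<odot>\<^bsub>M\<^esub> x)) +
      (frag_of (a * c, ?nx) - frag_of (a, c \<odot>\<^bsub>M\<^esub> ?nx)) -
      (frag_of (a, d c \<odot>\<^bsub>M\<^esub> x \<oplus>\<^bsub>M\<^esub> c \<odot>\<^bsub>M\<^esub> ?nx) - frag_of (a, d c \<odot>\<^bsub>M\<^esub> x) - frag_of (a, c \<odot>\<^bsub>M\<^esub> ?nx))"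
    using scalar by (simp add: nabla_word_simps nabla_smult[OF M] d_mult)
  also have "\<dots> \<in> tensor_rel A R M"
    using mem by (intro rel_plus[OF M] rel_minus[OF M] rel_gens[OF M]) auto
  finally show ?case .
qed (simp_all add: nabla_word_simps rel_plus[OF M] rel_neg[OF M] rel_zero[OF M])

lemma ext_smult: "a \<odot>\<^bsub>ext M\<^esub> cls M w = cls M (scale_word a w)"
proof -
  have "a \<odot>\<^bsub>ext M\<^esub> cls M w = tensor_lift A R M (\<lambda>(b, x). frag_of (a * b, x)) (cls M w)"
    by (simp add: base_change_def)
  also have "\<dots> = cls M (scale_word a w)"
    unfolding scale_word_def by (rule tensor_lift_cls[OF M M]) (use scale_word_rel in \<open>simp add: scale_word_def\<close>)
  finally show ?thesis .
qed

lemma ext_nabla: "nabla (ext M) (cls M w) = cls M (nabla_word w)"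
proof -
  have "nabla (ext M) (cls M w) = tensor_lift A R M (\<lambda>(b, x). frag_of (d b, x) + frag_of (b, nabla M x)) (cls M w)"
    by (simp add: base_change_def)
  also have "\<dots> = cls M (nabla_word w)"
    unfolding nabla_word_def by (rule tensor_lift_cls[OF M M]) (use nabla_word_rel in \<open>simp add: nabla_word_def\<close>)
  finally show ?thesis .
qed

text \<open>Reduces identities between additive operations on the tensor product, such as the module
  axioms and the Leibniz rule, to single letters.\<close>

lemma cls_eqI:
  assumes w: "w \<in> words M" and "\<And>a x. x \<in> carrier M \<Longrightarrow> T1 (frag_of (a, x)) - T2 (frag_of (a, x)) \<in> tensor_rel A R M"
    and "\<And>u v. T1 (u - v) = T1 u - T1 v" "\<And>u v. T2 (u - v) = T2 u - T2 v"
  shows "cls M (T1 w) = cls M (T2 w)"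
proof -
  have "T1 w - T2 w \<in> tensor_rel A R M"
  proof (rule frag_extend_additive[where w = w and T = "\<lambda>w. T1 w - T2 w"])
    show "Poly_Mapping.keys w \<subseteq> UNIV \<times> carrier M" using w by (simp add: words_iff)
  qed (use assms rel_zero[OF M] rel_minus[OF M] in auto)
  then show ?thesis by (simp add: cls_eq_iff[OF M])
qed

lemma dmod_ext: "dmod A d (ext M)"
proof -
  note simps = ext_carrier[OF M] cls_add[OF M] ext_zero[OF M] ext_smult ext_nabla
  have "abelian_group (ext M)"
  proof (rule abelian_groupI)
    fix X assume "X \<in> carrier (ext M)"
    then obtain w where "w \<in> words M" "X = cls M w" by (auto simp: simps)
    then show "\<exists>Y\<in>carrier (ext M). Y \<oplus>\<^bsub>ext M\<^esub> X = \<zero>\<^bsub>ext M\<^esub>"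
      by (intro bexI[of _ "cls M (- w)"]) (auto simp: simps words_simps)
  qed (auto simp: simps add_ac intro!: image_eqI words_simps(2,3))
  then have "Module.module A (ext M)"
  proof (rule moduleI[OF class_cring.is_cring])
    fix a X assume "X \<in> carrier (ext M)"
    then obtain w where w: "w \<in> words M" "X = cls M w" by (auto simp: simps)
    show "a \<odot>\<^bsub>ext M\<^esub> X \<in> carrier (ext M)"
      using scale_word_words[OF w(1)] by (auto simp: simps w(2))
    show "(a \<oplus>\<^bsub>A\<^esub> b) \<odot>\<^bsub>ext M\<^esub> X = a \<odot>\<^bsub>ext M\<^esub> X \<oplus>\<^bsub>ext M\<^esub> b \<odot>\<^bsub>ext M\<^esub> X" for b
      unfolding w(2) simps using w(1)
      by (rule cls_eqI[where ?T1.0 = "scale_word (a \<oplus>\<^bsub>A\<^esub> b)" and ?T2.0 = "\<lambda>w. scale_word a w + scale_word b w"])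
         (use rel_gens(1)[OF M] in \<open>simp_all add: scale_word_simps distrib_right diff_diff_eq\<close>)
    show "(a \<otimes>\<^bsub>A\<^esub> b) \<odot>\<^bsub>ext M\<^esub> X = a \<odot>\<^bsub>ext M\<^esub> (b \<odot>\<^bsub>ext M\<^esub> X)" for b
      unfolding w(2) simps using w(1)
      by (rule cls_eqI[where ?T1.0 = "scale_word (a \<otimes>\<^bsub>A\<^esub> b)" and ?T2.0 = "\<lambda>w. scale_word a (scale_word b w)"])
         (simp_all add: scale_word_simps mult.assoc rel_zero[OF M])
    show "\<one>\<^bsub>A\<^esub> \<odot>\<^bsub>ext M\<^esub> X = X"
      unfolding w(2) simps using w(1)
      by (rule cls_eqI[where ?T1.0 = "scale_word \<one>\<^bsub>A\<^esub>" and ?T2.0 = "\<lambda>w. w"])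
         (simp_all add: scale_word_simps rel_zero[OF M])
    fix Y assume "Y \<in> carrier (ext M)"
    then obtain w' where "Y = cls M w'" by (auto simp: simps)
    then show "a \<odot>\<^bsub>ext M\<^esub> (X \<oplus>\<^bsub>ext M\<^esub> Y) = a \<odot>\<^bsub>ext M\<^esub> X \<oplus>\<^bsub>ext M\<^esub> a \<odot>\<^bsub>ext M\<^esub> Y"
      by (simp add: w(2) simps scale_word_simps)
  qed
  then show ?thesis
    unfolding dmod_def
  proof (intro conjI ballI funcsetI)
    fix X assume "X \<in> carrier (ext M)"
    then obtain w where w: "w \<in> words M" "X = cls M w" by (auto simp: simps)
    show "nabla (ext M) X \<in> carrier (ext M)"
      using nabla_word_words[OF w(1)] by (auto simp: simps w(2))
    show "nabla (ext M) (a \<odot>\<^bsub>ext M\<^esub> X) = d a \<odot>\<^bsub>ext M\<^esub> X \<oplus>\<^bsub>ext M\<^esub> a \<odot>\<^bsub>ext M\<^esub> nabla (ext M) X" for a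
      unfolding w(2) simps using w(1)
      by (rule cls_eqI[where ?T1.0 = "\<lambda>w. nabla_word (scale_word a w)"
            and ?T2.0 = "\<lambda>w. scale_word (d a) w + scale_word a (nabla_word w)"])
         (use rel_gens(1)[OF M, of _ "d a * _" "a * d _"] in
           \<open>simp_all add: scale_word_simps nabla_word_simps d_mult diff_diff_eq add_ac\<close>)
    fix Y assume "Y \<in> carrier (ext M)"
    then obtain w' where "Y = cls M w'" by (auto simp: simps)
    then show "nabla (ext M) (X \<oplus>\<^bsub>ext M\<^esub> Y) = nabla (ext M) X \<oplus>\<^bsub>ext M\<^esub> nabla (ext M) Y"
      by (simp add: w(2) simps nabla_word_simps)
  qed
qed

lemma pure_closed: "x \<in> carrier M \<Longrightarrow> pure M a x \<in> carrier (ext M)"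
  unfolding pure_def ext_carrier[OF M] by (rule imageI) (simp add: words_simps)

lemma pure_add_left: "x \<in> carrier M \<Longrightarrow> pure M (a + b) x = pure M a x \<oplus>\<^bsub>ext M\<^esub> pure M b x"
  and pure_add_right: "x \<in> carrier M \<Longrightarrow> y \<in> carrier M \<Longrightarrow>
    pure M a (x \<oplus>\<^bsub>M\<^esub> y) = pure M a x \<oplus>\<^bsub>ext M\<^esub> pure M a y"
  and pure_scalar: "c \<in> S \<Longrightarrow> x \<in> carrier M \<Longrightarrow> pure M (a * c) x = pure M a (c \<odot>\<^bsub>M\<^esub> x)"
  using rel_gens[OF M] by (simp_all add: pure_def cls_add[OF M] cls_eq_iff[OF M] diff_diff_eq)

lemma smult_pure: "a \<odot>\<^bsub>ext M\<^esub> pure M b x = pure M (a * b) x"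
  by (simp add: pure_def ext_smult scale_word_simps)

lemma nabla_pure: "nabla (ext M) (pure M a x) = pure M (d a) x \<oplus>\<^bsub>ext M\<^esub> pure M a (nabla M x)"
  by (simp add: pure_def ext_nabla nabla_word_simps cls_add[OF M])

text \<open>A pure tensor absorbs a sign into its scalar, so sums of pure tensors exhaust the tensor
  product although words have integer coefficients.\<close>

lemma ext_induct [consumes 1, case_names pure add]:
  assumes X: "X \<in> carrier (ext M)"
    and pure: "\<And>a x. x \<in> carrier M \<Longrightarrow> P (pure M a x)"
    and add: "\<And>X Y. X \<in> carrier (ext M) \<Longrightarrow> Y \<in> carrier (ext M) \<Longrightarrow> P X \<Longrightarrow> P Y \<Longrightarrow> P (X \<oplus>\<^bsub>ext M\<^esub> Y)"
  shows "P X"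
proof -
  interpret E: Module.module A "ext M" by (rule dmod_module[OF dmod_ext])
  have zero: "pure M 0 x = \<zero>\<^bsub>ext M\<^esub>" if "x \<in> carrier M" for x
    using E.smult_l_null[OF pure_closed[OF that], of 0] by (simp add: smult_pure)
  have neg: "cls M (- frag_of (a, x)) = pure M (- a) x" if "x \<in> carrier M" for a x
  proof -
    have "cls M 0 = pure M (- a) x \<oplus>\<^bsub>ext M\<^esub> pure M a x"
      using zero[OF that] pure_add_left[OF that, of "- a" a] by (simp add: ext_zero[OF M])
    then have "cls M 0 = cls M (frag_of (- a, x) + frag_of (a, x))" by (simp add: pure_def cls_add[OF M])
    then have "- (frag_of (- a, x) + frag_of (a, x)) \<in> tensor_rel A R M" by (simp add: cls_eq_iff[OF M])
    then show ?thesis unfolding pure_def cls_eq_iff[OF M] by (simp add: algebra_simps)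
  qed
  from X obtain w where w: "w \<in> words M" "X = cls M w" by (auto simp: ext_carrier[OF M])
  \<comment> \<open>The induction on words passes through differences, so \<open>P\<close> is
    carried along for a word together with its negative.\<close>
  have "w \<in> {w \<in> words M. P (cls M w) \<and> P (cls M (- w))}" (is "_ \<in> ?I")
  proof (rule frag_extend_additive[where T = "\<lambda>w. w"])
    show "Poly_Mapping.keys w \<subseteq> UNIV \<times> carrier M" using w by (simp add: words_iff)
    show "frag_of k \<in> ?I" if "k \<in> UNIV \<times> carrier M" for k
      using that pure neg by (auto simp: pure_def words_simps)
    show "0 \<in> ?I" using pure[OF M.zero_closed, of 0] by (simp add: zero ext_zero[OF M] words_simps)
    show "u - v \<in> ?I" if "u \<in> ?I" "v \<in> ?I" for u v
    proof -
      have "P (cls M u' \<oplus>\<^bsub>ext M\<^esub> cls M v')" if "u' \<in> words M" "v' \<in> words M" "P (cls M u')" "P (cls M v')" for u' v'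
        using that by (intro add) (auto simp: ext_carrier[OF M])
      from this[of u "- v"] this[of "- u" v] show ?thesis
        using that words_simps(4)[of u M v] by (simp add: cls_add[OF M])
    qed
  qed simp
  then show ?thesis using w by simp
qed

end

section \<open>Scalar extension of linear maps and functionals\<close>

lemma lin_maps_ext_eqI:
  assumes M: "dmod R d M" and f: "f \<in> lin_maps A (ext M) N" and g: "g \<in> lin_maps A (ext M) N"
    and eq: "\<And>x. x \<in> carrier M \<Longrightarrow> f (pure M 1 x) = g (pure M 1 x)"
  shows "f = g"
proof (rule lin_maps_eqI[OF f g])
  fix X assume "X \<in> carrier (ext M)"
  then show "f X = g X"
  proof (induction rule: ext_induct[OF M, consumes 1, case_names pure add])
    case (pure a x)
    then have "pure M a x = a \<odot>\<^bsub>ext M\<^esub> pure M 1 x" by (simp add: smult_pure[OF M])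
    then show ?case using pure eq pure_closed[OF M pure(1)] by (simp add: lin_maps_smult[OF f] lin_maps_smult[OF g])
  qed (simp add: lin_maps_add[OF f] lin_maps_add[OF g])
qed

lemma ext_hom:
  assumes M: "dmod R d M" and N: "dmod R d N" and f: "f \<in> lin_maps R M N"
  shows ext_hom_lin: "ext_hom M N f \<in> lin_maps A (ext M) (ext N)"
    and ext_hom_pure: "x \<in> carrier M \<Longrightarrow> ext_hom M N f (pure M a x) = pure N a (f x)"
proof -
  define T where "T = frag_extend (\<lambda>(b, x). frag_of (b, f x) :: 'a \<times> 'c \<Rightarrow>\<^sub>0 int)"
  note f_simps = lin_maps_closed[OF f] lin_maps_add[OF f] lin_maps_smult[OF f]
  have T_simps: "T (frag_of (b, x)) = frag_of (b, f x)" "T (u + v) = T u + T v" "T (u - v) = T u - T v"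
    "T (- u) = - T u" "T 0 = 0" for b x u v
    by (simp_all add: T_def frag_extend_add frag_extend_diff frag_extend_minus)
  have T_rel: "T w \<in> tensor_rel A R N" if "w \<in> tensor_rel A R M" for w
    using that
    by (induction rule: rel_induct[OF M, consumes 1, case_names zero add smult_add scalar plus neg])
       (auto simp: T_simps f_simps rel_gens[OF N] rel_plus[OF N] rel_neg[OF N] rel_zero[OF N])
  have T_words: "T w \<in> words N" if "w \<in> words M" for w
    unfolding T_def by (rule words_extend[OF that]) (simp add: f_simps words_simps)
  have cls: "ext_hom M N f (cls M w) = cls N (T w)" if "w \<in> words M" for w
    using that tensor_lift_cls[OF M N T_rel[unfolded T_def], of w]
    by (simp add: base_change_hom_def ext_carrier[OF M] T_def)
  then show p: "ext_hom M N f (pure M a x) = pure N a (f x)" if "x \<in> carrier M" for a x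
    using that by (simp add: pure_def T_simps)
  note E = dmod_module[OF dmod_ext[OF M]]
  have "(\<lambda>X\<in>carrier (ext M). ext_hom M N f X) \<in> lin_maps A (ext M) (ext N)"
  proof (rule lin_mapsI[OF _ _ _ E])
    fix X assume "X \<in> carrier (ext M)"
    then obtain w where w: "w \<in> words M" "X = cls M w" by (auto simp: ext_carrier[OF M])
    then show "ext_hom M N f X \<in> carrier (ext N)" using T_words by (auto simp: cls ext_carrier[OF N])
    {
      fix Y assume "Y \<in> carrier (ext M)"
      then obtain w' where w': "w' \<in> words M" "Y = cls M w'" by (auto simp: ext_carrier[OF M])
      then show "ext_hom M N f (X \<oplus>\<^bsub>ext M\<^esub> Y) = ext_hom M N f X \<oplus>\<^bsub>ext N\<^esub> ext_hom M N f Y"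
        using w words_simps(3)[of w M w'] by (simp add: cls_add[OF M] cls_add[OF N] cls T_simps)
    }
    show "ext_hom M N f (a \<odot>\<^bsub>ext M\<^esub> X) = a \<odot>\<^bsub>ext N\<^esub> ext_hom M N f X" for a
    proof -
      have "cls N (T (scale_word a w)) = cls N (scale_word a (T w))"
      proof -
        have "T (scale_word a w) - scale_word a (T w) \<in> tensor_rel A R N"
          by (rule frag_extend_additive[where w = w and T = "\<lambda>w. T (scale_word a w) - scale_word a (T w)"
                and K = "UNIV \<times> carrier M"])
             (use w(1) rel_minus[OF N] rel_zero[OF N] in \<open>auto simp: words_iff T_simps scale_word_simps[OF M] scale_word_simps[OF N]\<close>)
        then show ?thesis by (simp add: cls_eq_iff[OF N])
      qed
      then show ?thesis using w scale_word_words[OF M w(1)] by (simp add: cls ext_smult[OF M] ext_smult[OF N])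
    qed
  qed
  moreover have "(\<lambda>X\<in>carrier (ext M). ext_hom M N f X) = ext_hom M N f"
    by (rule ext) (simp add: base_change_hom_def)
  ultimately show "ext_hom M N f \<in> lin_maps A (ext M) (ext N)" by simp
qed

text \<open>The rule sending a letter with entries \<open>a\<close> and \<open>x\<close> to
  \<open>a * s x\<close> extends to formal sums and kills the bilinearity relations. It is used to
  extend the coordinate functionals of a dual basis.\<close>

lemma ext_functional:
  assumes M: "dmod R d M" and s: "\<And>x. x \<in> carrier M \<Longrightarrow> s x \<in> S"
    "\<And>x y. x \<in> carrier M \<Longrightarrow> y \<in> carrier M \<Longrightarrow> s (x \<oplus>\<^bsub>M\<^esub> y) = s x + s y"
    "\<And>c x. c \<in> S \<Longrightarrow> x \<in> carrier M \<Longrightarrow> s (c \<odot>\<^bsub>M\<^esub> x) = c * s x"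
  obtains s' where "\<And>X Y. X \<in> carrier (ext M) \<Longrightarrow> Y \<in> carrier (ext M) \<Longrightarrow> s' (X \<oplus>\<^bsub>ext M\<^esub> Y) = s' X + s' Y"
    "\<And>a X. X \<in> carrier (ext M) \<Longrightarrow> s' (a \<odot>\<^bsub>ext M\<^esub> X) = a * s' X"
    "\<And>a x. x \<in> carrier M \<Longrightarrow> s' (pure M a x) = a * s x"
proof -
  \<comment> \<open>The additive group of the ring in multiplicative notation, the form in which the
    universal property of free abelian groups is available.\<close>
  define G where "G = \<lparr>carrier = UNIV :: 'a set, monoid.mult = (+), one = 0 :: 'a\<rparr>"
  interpret G: comm_group G
    by (rule comm_groupI) (auto simp: G_def add_ac intro: exI[of _ "- _"] add.left_inverse)
  obtain h where h: "h \<in> hom (free_Abelian_group (UNIV \<times> carrier M)) G"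
    and h_of: "\<And>k. k \<in> UNIV \<times> carrier M \<Longrightarrow> h (frag_of k) = fst k * s (snd k)"
    by (rule G.free_Abelian_group_universal[of "\<lambda>k. fst k * s (snd k)" "UNIV \<times> carrier M"]) (auto simp: G_def)
  have h_add: "h (u + v) = h u + h v" if "u \<in> words M" "v \<in> words M" for u v
    using that hom_mult[OF h, of u v] by (simp add: G_def words_iff)
  have h_0: "h 0 = 0" using h_add[of 0 0] by (simp add: words_simps)
  have h_neg: "h (- u) = - h u" if "u \<in> words M" for u
    using h_add[OF that words_simps(5)[OF that]] h_0 by (simp add: eq_neg_iff_add_eq_0 add.commute)
  have h_diff: "h (u - v) = h u - h v" if "u \<in> words M" "v \<in> words M" for u v
    using h_add[OF that(1) words_simps(5)[OF that(2)]] h_neg[OF that(2)] by simp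
  have h_rel: "w \<in> words M \<and> h w = 0" if "w \<in> tensor_rel A R M" for w
    using that
  proof (induction rule: rel_induct[OF M, consumes 1, case_names zero add smult_add scalar plus neg])
    case (scalar a c x)
    then have "c \<odot>\<^bsub>M\<^esub> x \<in> carrier M" using Module.module.smult_closed[OF dmod_module[OF M], of c x] by simp
    with scalar show ?case
      using words_simps(4)[of "frag_of (a * c, x)" M "frag_of (a, c \<odot>\<^bsub>M\<^esub> x)"] by (simp add: h_diff h_of s mult.assoc)
  next
    case (add a b x)
    then show ?case
      using words_simps(4)[of "frag_of (a + b, x) - frag_of (a, x)" M "frag_of (b, x)"]
        words_simps(4)[of "frag_of (a + b, x)" M "frag_of (a, x)"] by (simp add: h_diff h_of s distrib_right)
  next
    case (smult_add a x y)
    then have "x \<oplus>\<^bsub>M\<^esub> y \<in> carrier M" using abelian_monoid.a_closed[OF abelian_group.axioms(1)[OF dmod_abelian_group[OF M]]] by simp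
    with smult_add show ?case
      using words_simps(4)[of "frag_of (a, x \<oplus>\<^bsub>M\<^esub> y) - frag_of (a, x)" M "frag_of (a, y)"]
        words_simps(4)[of "frag_of (a, x \<oplus>\<^bsub>M\<^esub> y)" M "frag_of (a, x)"] by (simp add: h_diff h_of s distrib_left)
  next
    case (plus w w')
    then show ?case using words_simps(3)[of w M w'] by (simp add: h_add)
  qed (simp_all add: h_0 h_neg)
  \<comment> \<open>Any representative will do, since two of them differ by a relation and
    \<open>h\<close> vanishes on relations.\<close>
  define s' where "s' X = h (SOME w. w \<in> X)" for X
  have s'_cls: "s' (cls M w) = h w" if "w \<in> words M" for w
  proof -
    have "w \<in> cls M w" using rel_zero[OF M] by (force simp: cls_eq)
    then have "(SOME w'. w' \<in> cls M w) \<in> cls M w" by (rule someI)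
    then obtain u where "u \<in> tensor_rel A R M" "(SOME w'. w' \<in> cls M w) = u + w" by (auto simp: cls_eq)
    then show ?thesis using h_rel[of u] that by (simp add: s'_def h_add)
  qed
  show ?thesis
  proof (rule that)
    show pure: "s' (pure M a x) = a * s x" if "x \<in> carrier M" for a x
      using that s'_cls[of "frag_of (a, x)"] by (simp add: pure_def h_of)
    show add: "s' (X \<oplus>\<^bsub>ext M\<^esub> Y) = s' X + s' Y" if XY: "X \<in> carrier (ext M)" "Y \<in> carrier (ext M)" for X Y
    proof -
      from XY obtain w w' where w: "w \<in> words M" "X = cls M w" "w' \<in> words M" "Y = cls M w'"
        by (auto simp: ext_carrier[OF M])
      then show ?thesis using words_simps(3)[of w M w'] by (simp add: cls_add[OF M] s'_cls h_add)
    qed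
    interpret E: Module.module A "ext M" by (rule dmod_module[OF dmod_ext[OF M]])
    show "s' (a \<odot>\<^bsub>ext M\<^esub> X) = a * s' X" if "X \<in> carrier (ext M)" for a X
      using that
    proof (induction rule: ext_induct[OF M, consumes 1, case_names pure add])
      case (pure b x)
      then show ?case using \<open>\<And>x a. x \<in> carrier M \<Longrightarrow> s' (pure M a x) = a * s x\<close>
        by (simp add: smult_pure[OF M] mult.assoc)
    next
      case (add X Y)
      then show ?case by (simp add: E.smult_r_distr \<open>\<And>Y X. X \<in> carrier (ext M) \<Longrightarrow> Y \<in> carrier (ext M) \<Longrightarrow> s' (X \<oplus>\<^bsub>ext M\<^esub> Y) = s' X + s' Y\<close> distrib_left)
    qed
  qed
qed

end

section \<open>Internal Hom\<close>

lemma internal_hom_simps: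
  "carrier (internal_hom R M N) = lin_maps R M N"
  "\<zero>\<^bsub>internal_hom R M N\<^esub> = (\<lambda>x\<in>carrier M. \<zero>\<^bsub>N\<^esub>)"
  "f \<oplus>\<^bsub>internal_hom R M N\<^esub> g = (\<lambda>x\<in>carrier M. f x \<oplus>\<^bsub>N\<^esub> g x)"
  "a \<odot>\<^bsub>internal_hom R M N\<^esub> f = (\<lambda>x\<in>carrier M. a \<odot>\<^bsub>N\<^esub> f x)"
  by (simp_all add: internal_hom_def)

lemma internal_hom_module:
  fixes M :: "('r, 'm) dmodule" and N :: "('r, 'n) dmodule"
  assumes M: "Module.module R M" and N: "Module.module R N"
  shows "Module.module R (internal_hom R M N)"
proof -
  interpret N: Module.module R N by fact
  interpret M: Module.module R M by fact
  have zero: "(\<lambda>x\<in>carrier M. \<zero>\<^bsub>N\<^esub>) \<in> lin_maps R M N"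
    by (rule lin_mapsI[OF _ _ _ M]) auto
  have smult: "(\<lambda>x\<in>carrier M. a \<odot>\<^bsub>N\<^esub> f x) \<in> lin_maps R M N" if "a \<in> carrier R" "f \<in> lin_maps R M N" for a f
    using that by (intro lin_mapsI[OF _ _ _ M])
      (auto simp: lin_maps_closed lin_maps_add lin_maps_smult N.smult_r_distr N.smult_assoc1[symmetric] N.m_comm)
  note plus = lin_maps_plus[OF _ _ M N]
  have eqI: "f = g" if "f \<in> extensional (carrier M)" "g \<in> extensional (carrier M)"
    "\<And>x. x \<in> carrier M \<Longrightarrow> f x = g x" for f g :: "'m \<Rightarrow> 'n"
    using that by (rule extensionalityI)
  have ex: "f \<in> lin_maps R M N \<Longrightarrow> f \<in> extensional (carrier M)" for f by (simp add: lin_maps_def)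
  have "abelian_group (internal_hom R M N)"
  proof (rule abelian_groupI)
    fix f assume f: "f \<in> carrier (internal_hom R M N)"
    then have f': "f \<in> lin_maps R M N" by (simp add: internal_hom_simps)
    have n: "(\<lambda>x\<in>carrier M. (\<lambda>x\<in>carrier M. \<zero>\<^bsub>N\<^esub>) x \<ominus>\<^bsub>N\<^esub> f x) \<in> lin_maps R M N"
      by (rule lin_maps_minus[OF zero f' M N])
    show "\<exists>g\<in>carrier (internal_hom R M N). g \<oplus>\<^bsub>internal_hom R M N\<^esub> f = \<zero>\<^bsub>internal_hom R M N\<^esub>"
      by (rule bexI[of _ "\<lambda>x\<in>carrier M. (\<lambda>x\<in>carrier M. \<zero>\<^bsub>N\<^esub>) x \<ominus>\<^bsub>N\<^esub> f x"])
         (use n f' in \<open>auto simp: internal_hom_simps lin_maps_closed intro!: eqI\<close>)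
    show "\<zero>\<^bsub>internal_hom R M N\<^esub> \<oplus>\<^bsub>internal_hom R M N\<^esub> f = f"
      using f' by (auto simp: internal_hom_simps lin_maps_closed ex[OF f'] intro!: eqI)
    fix g assume "g \<in> carrier (internal_hom R M N)"
    then have g': "g \<in> lin_maps R M N" by (simp add: internal_hom_simps)
    show "f \<oplus>\<^bsub>internal_hom R M N\<^esub> g = g \<oplus>\<^bsub>internal_hom R M N\<^esub> f"
      using f' g' by (auto simp: internal_hom_simps lin_maps_closed N.a_comm intro!: eqI)
    fix h assume "h \<in> carrier (internal_hom R M N)"
    then have h': "h \<in> lin_maps R M N" by (simp add: internal_hom_simps)
    show "f \<oplus>\<^bsub>internal_hom R M N\<^esub> g \<oplus>\<^bsub>internal_hom R M N\<^esub> h =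
        f \<oplus>\<^bsub>internal_hom R M N\<^esub> (g \<oplus>\<^bsub>internal_hom R M N\<^esub> h)"
      using f' g' h' by (auto simp: internal_hom_simps lin_maps_closed N.a_assoc intro!: eqI)
  qed (simp_all add: internal_hom_simps zero plus)
  then show ?thesis
  proof (rule moduleI[OF N.is_cring])
    fix f assume "f \<in> carrier (internal_hom R M N)"
    then have f: "f \<in> lin_maps R M N" by (simp add: internal_hom_simps)
    show "\<one>\<^bsub>R\<^esub> \<odot>\<^bsub>internal_hom R M N\<^esub> f = f"
      using f by (auto simp: internal_hom_simps lin_maps_closed ex[OF f] intro!: eqI)
    fix a assume a: "a \<in> carrier R"
    show "a \<odot>\<^bsub>internal_hom R M N\<^esub> f \<in> carrier (internal_hom R M N)"
      using f a smult by (simp add: internal_hom_simps)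
    show "a \<odot>\<^bsub>internal_hom R M N\<^esub> (f \<oplus>\<^bsub>internal_hom R M N\<^esub> g) =
        a \<odot>\<^bsub>internal_hom R M N\<^esub> f \<oplus>\<^bsub>internal_hom R M N\<^esub> a \<odot>\<^bsub>internal_hom R M N\<^esub> g"
      if "g \<in> carrier (internal_hom R M N)" for g
      using f a that by (auto simp: internal_hom_simps lin_maps_closed N.smult_r_distr intro!: eqI)
    fix b assume b: "b \<in> carrier R"
    show "(a \<oplus>\<^bsub>R\<^esub> b) \<odot>\<^bsub>internal_hom R M N\<^esub> f =
        a \<odot>\<^bsub>internal_hom R M N\<^esub> f \<oplus>\<^bsub>internal_hom R M N\<^esub> b \<odot>\<^bsub>internal_hom R M N\<^esub> f"
      using f a b by (auto simp: internal_hom_simps lin_maps_closed N.smult_l_distr intro!: eqI)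
    show "(a \<otimes>\<^bsub>R\<^esub> b) \<odot>\<^bsub>internal_hom R M N\<^esub> f = a \<odot>\<^bsub>internal_hom R M N\<^esub> (b \<odot>\<^bsub>internal_hom R M N\<^esub> f)"
      using f a b by (auto simp: internal_hom_simps lin_maps_closed N.smult_assoc1 intro!: eqI)
  qed
qed

lemma (in abelian_group) diff_add_eq:
  "a \<in> carrier G \<Longrightarrow> b \<in> carrier G \<Longrightarrow> c \<in> carrier G \<Longrightarrow> (a \<oplus> b) \<ominus> c = a \<oplus> (b \<ominus> c)"
  by (simp add: a_minus_def a_assoc)

lemma internal_hom_dmod:
  assumes M: "dmod R d M" and N: "dmod R d N" and d: "d \<in> carrier R \<rightarrow> carrier R"
  shows "dmod R d (internal_hom R M N)"
  unfolding dmod_def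
proof (intro conjI ballI funcsetI)
  interpret N: Module.module R N using N by (rule dmod_module)
  interpret M: Module.module R M using M by (rule dmod_module)
  show H: "Module.module R (internal_hom R M N)"
    by (rule internal_hom_module[OF M.module_axioms N.module_axioms])
  interpret H: Module.module R "internal_hom R M N" by (rule H)
  fix f assume f: "f \<in> carrier (internal_hom R M N)"
  then have f': "f \<in> lin_maps R M N" by (simp add: internal_hom_simps)
  note simps = lin_maps_closed[OF f'] nabla_closed[OF M] nabla_closed[OF N] nabla_add[OF N] nabla_smult[OF N]
  show "conn R M N f \<in> carrier (internal_hom R M N)"
    using conn_closed[OF M N d f'] by (simp add: internal_hom_simps)
  show "conn R M N (a \<odot>\<^bsub>internal_hom R M N\<^esub> f) =
      d a \<odot>\<^bsub>internal_hom R M N\<^esub> f \<oplus>\<^bsub>internal_hom R M N\<^esub> a \<odot>\<^bsub>internal_hom R M N\<^esub> conn R M N f"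
    if a: "a \<in> carrier R" for a
    unfolding internal_hom_simps conn_def
    by (rule restrict_ext)
       (use a funcset_mem[OF d a] in \<open>simp add: simps N.diff_add_eq N.smult_diff_distrib\<close>)
  fix g assume g: "g \<in> carrier (internal_hom R M N)"
  then have g': "g \<in> lin_maps R M N" by (simp add: internal_hom_simps)
  show "conn R M N (f \<oplus>\<^bsub>internal_hom R M N\<^esub> g) = conn R M N f \<oplus>\<^bsub>internal_hom R M N\<^esub> conn R M N g"
    unfolding internal_hom_simps conn_def
    by (rule restrict_ext) (simp add: simps lin_maps_closed[OF g'] N.diff_add_diff)
qed

section \<open>Dual bases\<close>

text \<open>The generators are the images of the unit vectors under the projection from the free
  module, and the functionals are the coordinates of the embedding into it.\<close>

lemma fg_projective_dual_basis:
  assumes M: "Module.module R M" and fg: "fg_projective R M"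
  shows "\<exists>n x s. dual_basis R M n x s"
proof -
  interpret M: Module.module R M by fact
  from fg obtain n s q where s: "s \<in> lin_maps R M (power_module R n)"
    and q: "q \<in> lin_maps R (power_module R n) M" and qs: "\<And>x. x \<in> carrier M \<Longrightarrow> q (s x) = x"
    unfolding fg_projective_def by blast
  let ?P = "power_module R n"
  note P_simps = power_module_def
  define \<delta> where "\<delta> j = (\<lambda>i\<in>{..<n}. if i = j then \<one>\<^bsub>R\<^esub> else \<zero>\<^bsub>R\<^esub>)" for j :: nat
  have \<delta>: "\<delta> j \<in> carrier ?P" for j by (auto simp: P_simps \<delta>_def)
  note q_simps = lin_maps_closed[OF q] lin_maps_add[OF q] lin_maps_smult[OF q]
  \<comment> \<open>Induction on the number \<open>m\<close> of leading coordinates of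
    \<open>v\<close> that may be nonzero; the step splits off the last of them.\<close>
  have expand: "q v = finsum M (\<lambda>j. v j \<odot>\<^bsub>M\<^esub> q (\<delta> j)) {..<m}"
    if "m \<le> n" "v \<in> carrier ?P" "\<And>j. m \<le> j \<Longrightarrow> j < n \<Longrightarrow> v j = \<zero>\<^bsub>R\<^esub>" for m v
    using that
  proof (induction m arbitrary: v)
    case 0
    then have v: "v i \<in> carrier R" if "i < n" for i using that by (auto simp: P_simps)
    \<comment> \<open>Here \<open>v\<close> is the zero vector; writing it as zero times itself
      gives \<open>q v = 0\<close> from compatibility with scalars.\<close>
    have "v = \<zero>\<^bsub>R\<^esub> \<odot>\<^bsub>?P\<^esub> v"
      using 0 v by (auto simp: P_simps PiE_def intro!: extensionalityI[of _ "{..<n}"])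
    then have "q v = \<zero>\<^bsub>R\<^esub> \<odot>\<^bsub>M\<^esub> q v" using q_simps(3)[of "\<zero>\<^bsub>R\<^esub>" v] 0 by simp
    then show ?case using q_simps(1)[OF 0(2)] by simp
  next
    case (Suc m)
    define w where "w = (\<lambda>i\<in>{..<n}. if i = m then \<zero>\<^bsub>R\<^esub> else v i)"
    have v: "v i \<in> carrier R" if "i < n" for i using that Suc by (auto simp: P_simps)
    have w: "w \<in> carrier ?P" using v by (auto simp: P_simps w_def)
    have vm: "v m \<odot>\<^bsub>?P\<^esub> \<delta> m \<in> carrier ?P" using v Suc by (auto simp: P_simps \<delta>_def)
    have "v = w \<oplus>\<^bsub>?P\<^esub> (v m \<odot>\<^bsub>?P\<^esub> \<delta> m)"
      using Suc v by (auto simp: P_simps w_def \<delta>_def PiE_def intro!: extensionalityI[of _ "{..<n}"])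
    then have "q v = q w \<oplus>\<^bsub>M\<^esub> v m \<odot>\<^bsub>M\<^esub> q (\<delta> m)"
      using q_simps(2)[OF w vm] q_simps(3)[of "v m" "\<delta> m"] v Suc \<delta> by simp
    also have "q w = finsum M (\<lambda>j. w j \<odot>\<^bsub>M\<^esub> q (\<delta> j)) {..<m}"
    proof (rule Suc.IH[OF _ w])
      fix j assume "m \<le> j" "j < n"
      then show "w j = \<zero>\<^bsub>R\<^esub>" using Suc.prems(3)[of j] by (auto simp: w_def)
    qed (use Suc in auto)
    also have "\<dots> = finsum M (\<lambda>j. v j \<odot>\<^bsub>M\<^esub> q (\<delta> j)) {..<m}"
      using Suc v \<delta> by (intro M.finsum_cong') (auto simp: w_def q_simps)
    also have "\<dots> \<oplus>\<^bsub>M\<^esub> v m \<odot>\<^bsub>M\<^esub> q (\<delta> m) = finsum M (\<lambda>j. v j \<odot>\<^bsub>M\<^esub> q (\<delta> j)) {..<Suc m}"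
      using Suc v \<delta> q_simps(1) by (simp add: lessThan_Suc M.a_comm)
    finally show ?case .
  qed
  have s': "s x \<in> carrier ?P" if "x \<in> carrier M" for x by (rule lin_maps_closed[OF s that])
  have "dual_basis R M n (\<lambda>j. q (\<delta> j)) (\<lambda>j y. s y j)"
    unfolding dual_basis_def
  proof (intro conjI allI ballI impI)
    show "q (\<delta> j) \<in> carrier M" for j using \<delta> by (rule q_simps)
    show "s y j \<in> carrier R" if "j < n" "y \<in> carrier M" for j y
      using s'[OF that(2)] that(1) by (auto simp: P_simps)
    show "s (y \<oplus>\<^bsub>M\<^esub> z) j = s y j \<oplus>\<^bsub>R\<^esub> s z j" if "j < n" "y \<in> carrier M" "z \<in> carrier M" for j y z
      using that by (simp add: lin_maps_add[OF s] P_simps)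
    show "s (a \<odot>\<^bsub>M\<^esub> y) j = a \<otimes>\<^bsub>R\<^esub> s y j" if "j < n" "a \<in> carrier R" "y \<in> carrier M" for j a y
      using that by (simp add: lin_maps_smult[OF s] P_simps)
    show "y = finsum M (\<lambda>j. s y j \<odot>\<^bsub>M\<^esub> q (\<delta> j)) {..<n}" if "y \<in> carrier M" for y
      using expand[OF order.refl s'[OF that]] qs[OF that] by simp
  qed
  then show ?thesis by blast
qed

lemma functional_expand:
  fixes u :: "'m \<Rightarrow> 'a::comm_ring_1"
  assumes M: "Module.module Q M" and db: "dual_basis Q M n x s"
    and u: "\<And>y z. y \<in> carrier M \<Longrightarrow> z \<in> carrier M \<Longrightarrow> u (y \<oplus>\<^bsub>M\<^esub> z) = u y + u z"
      "\<And>a y. a \<in> carrier Q \<Longrightarrow> y \<in> carrier M \<Longrightarrow> u (a \<odot>\<^bsub>M\<^esub> y) = a * u y"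
    and y: "y \<in> carrier M"
  shows "u y = (\<Sum>j<n. s j y * u (x j))"
proof -
  interpret M: Module.module Q M by fact
  note db = db[unfolded dual_basis_def]
  have ah: "add_hom M (class_ring :: 'a ring) u" by (rule add_homI) (auto simp: u)
  have ag: "abelian_group (class_ring :: 'a ring)" by (rule class_ring.abelian_group_axioms)
  have "u y = u (finsum M (\<lambda>j. s j y \<odot>\<^bsub>M\<^esub> x j) {..<n})" using db y by simp
  also have "\<dots> = finsum class_ring (\<lambda>j. u (s j y \<odot>\<^bsub>M\<^esub> x j)) {..<n}"
    using db y by (intro add_hom_finsum[OF M.M.abelian_group_axioms ag ah]) auto
  also have "\<dots> = (\<Sum>j<n. u (s j y \<odot>\<^bsub>M\<^esub> x j))" by (simp add: class_ring_simps)
  also have "\<dots> = (\<Sum>j<n. s j y * u (x j))" using db y u by (intro sum.cong) auto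
  finally show ?thesis .
qed

section \<open>Scalar extension of dual bases and of Hom\<close>

context scalar_extension
begin

lemma d_one: "d 1 = 0"
  using d_mult[of 1 1] by simp

lemma pure_smult: "dmod R d M \<Longrightarrow> c \<in> S \<Longrightarrow> x \<in> carrier M \<Longrightarrow>
    pure M a (c \<odot>\<^bsub>M\<^esub> x) = c \<odot>\<^bsub>ext M\<^esub> pure M a x"
  by (simp add: pure_scalar[symmetric] smult_pure mult.commute)

lemma nabla_pure_one:
  assumes M: "dmod R d M" and x: "x \<in> carrier M"
  shows "nabla (ext M) (pure M 1 x) = pure M 1 (nabla M x)"
proof -
  interpret E: Module.module A "ext M" by (rule dmod_module[OF dmod_ext[OF M]])
  have "pure M 0 x = \<zero>\<^bsub>ext M\<^esub>"
    using E.smult_l_null[OF pure_closed[OF M x], of 0] by (simp add: smult_pure[OF M])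
  then show ?thesis using pure_closed[OF M nabla_closed[OF M x]] by (simp add: nabla_pure[OF M] d_one)
qed

lemma pure_add_hom: "dmod R d M \<Longrightarrow> add_hom M (ext M) (pure M a)"
  by (rule add_homI) (simp_all add: pure_closed pure_add_right)

lemmas pure_diff = add_hom_diff[OF dmod_abelian_group dmod_abelian_group[OF dmod_ext] pure_add_hom]
  and pure_finsum = add_hom_finsum[OF dmod_abelian_group dmod_abelian_group[OF dmod_ext] pure_add_hom]

text \<open>The functionals extend linearly to the tensor product, and the expansion is checked on
  pure tensors, where the coordinates \<open>s j y\<close> move across the tensor sign.\<close>

lemma dual_basis_ext:
  assumes M: "dmod R d M" and db: "dual_basis R M n x s"
  obtains s' where "dual_basis A (ext M) n (\<lambda>j. pure M 1 (x j)) s'"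
    "\<And>j a y. j < n \<Longrightarrow> y \<in> carrier M \<Longrightarrow> s' j (pure M a y) = a * s j y"
proof -
  interpret M: Module.module R M by (rule dmod_module[OF M])
  interpret E: Module.module A "ext M" by (rule dmod_module[OF dmod_ext[OF M]])
  note db = db[unfolded dual_basis_def]
  have "\<forall>j\<in>{..<n}. \<exists>s'. (\<forall>X\<in>carrier (ext M). \<forall>Y\<in>carrier (ext M). s' (X \<oplus>\<^bsub>ext M\<^esub> Y) = s' X + s' Y) \<and>
      (\<forall>a. \<forall>X\<in>carrier (ext M). s' (a \<odot>\<^bsub>ext M\<^esub> X) = a * s' X) \<and>
      (\<forall>a. \<forall>y\<in>carrier M. s' (pure M a y) = a * s j y)" (is "\<forall>j\<in>_. \<exists>s'. ?Q j s'")
  proof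
    fix j assume "j \<in> {..<n}"
    then have s: "\<And>y. y \<in> carrier M \<Longrightarrow> s j y \<in> S"
      "\<And>y z. y \<in> carrier M \<Longrightarrow> z \<in> carrier M \<Longrightarrow> s j (y \<oplus>\<^bsub>M\<^esub> z) = s j y + s j z"
      "\<And>c y. c \<in> S \<Longrightarrow> y \<in> carrier M \<Longrightarrow> s j (c \<odot>\<^bsub>M\<^esub> y) = c * s j y"
      using db by simp_all
    show "\<exists>s'. (\<forall>X\<in>carrier (ext M). \<forall>Y\<in>carrier (ext M). s' (X \<oplus>\<^bsub>ext M\<^esub> Y) = s' X + s' Y) \<and>
      (\<forall>a. \<forall>X\<in>carrier (ext M). s' (a \<odot>\<^bsub>ext M\<^esub> X) = a * s' X) \<and>
      (\<forall>a. \<forall>y\<in>carrier M. s' (pure M a y) = a * s j y)" (is "\<exists>s'. ?P s'")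
    proof (rule ext_functional[OF M s])
      fix s' assume *: "\<And>X Y. X \<in> carrier (ext M) \<Longrightarrow> Y \<in> carrier (ext M) \<Longrightarrow> s' (X \<oplus>\<^bsub>ext M\<^esub> Y) = s' X + s' Y"
        "\<And>a X. X \<in> carrier (ext M) \<Longrightarrow> s' (a \<odot>\<^bsub>ext M\<^esub> X) = a * s' X"
        "\<And>a y. y \<in> carrier M \<Longrightarrow> s' (pure M a y) = a * s j y"
      have "?P s'" by (intro conjI ballI allI *)
      then show "\<exists>s'. ?P s'" by (rule exI[where P = ?P and x = s'])
    qed
  qed
  from bchoice[OF this] obtain s' where "\<forall>j\<in>{..<n}. ?Q j (s' j)" by (elim exE) (rule that)
  then have s':
    "\<And>j X Y. j < n \<Longrightarrow> X \<in> carrier (ext M) \<Longrightarrow> Y \<in> carrier (ext M) \<Longrightarrow> s' j (X \<oplus>\<^bsub>ext M\<^esub> Y) = s' j X + s' j Y"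
    "\<And>j a X. j < n \<Longrightarrow> X \<in> carrier (ext M) \<Longrightarrow> s' j (a \<odot>\<^bsub>ext M\<^esub> X) = a * s' j X"
    "\<And>j a y. j < n \<Longrightarrow> y \<in> carrier M \<Longrightarrow> s' j (pure M a y) = a * s j y"
    by simp_all
  have "X = finsum (ext M) (\<lambda>j. s' j X \<odot>\<^bsub>ext M\<^esub> pure M 1 (x j)) {..<n}" if "X \<in> carrier (ext M)" for X
    using that
  proof (induction rule: ext_induct[OF M, consumes 1, case_names pure add])
    case (pure a y)
    have "pure M a y = pure M a (finsum M (\<lambda>j. s j y \<odot>\<^bsub>M\<^esub> x j) {..<n})" using db pure by simp
    also have "\<dots> = finsum (ext M) (\<lambda>j. pure M a (s j y \<odot>\<^bsub>M\<^esub> x j)) {..<n}"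
      using db pure by (intro pure_finsum[OF M M M]) auto
    also have "\<dots> = finsum (ext M) (\<lambda>j. s' j (pure M a y) \<odot>\<^bsub>ext M\<^esub> pure M 1 (x j)) {..<n}"
      using db pure
      by (intro E.finsum_cong') (auto simp: s' smult_pure[OF M] pure_closed[OF M] pure_scalar[OF M])
    finally show ?case .
  next
    case (add X Y)
    have "X \<oplus>\<^bsub>ext M\<^esub> Y = finsum (ext M) (\<lambda>j. s' j X \<odot>\<^bsub>ext M\<^esub> pure M 1 (x j)) {..<n} \<oplus>\<^bsub>ext M\<^esub>
        finsum (ext M) (\<lambda>j. s' j Y \<odot>\<^bsub>ext M\<^esub> pure M 1 (x j)) {..<n}"
      using add(3,4) by simp
    also have "\<dots> = finsum (ext M) (\<lambda>j. s' j X \<odot>\<^bsub>ext M\<^esub> pure M 1 (x j) \<oplus>\<^bsub>ext M\<^esub> s' j Y \<odot>\<^bsub>ext M\<^esub> pure M 1 (x j)) {..<n}"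
      using db by (intro E.finsum_addf[symmetric]) (auto simp: pure_closed[OF M])
    also have "\<dots> = finsum (ext M) (\<lambda>j. s' j (X \<oplus>\<^bsub>ext M\<^esub> Y) \<odot>\<^bsub>ext M\<^esub> pure M 1 (x j)) {..<n}"
      using db add by (intro E.finsum_cong') (auto simp: s' pure_closed[OF M] E.smult_l_distr[simplified])
    finally show ?case .
  qed
  with s' db show ?thesis
    by (intro that[of s']) (auto simp: dual_basis_def pure_closed[OF M])
qed

text \<open>The extended functionals take the value \<open>s j y\<close> on the tensor of 1 with
  \<open>y\<close>, so this tensor still determines the coordinates of \<open>y\<close>, and with
  them \<open>y\<close>.\<close>

lemma pure_one_inj:
  assumes M: "dmod R d M" and db: "dual_basis R M n x s"
    and yz: "y \<in> carrier M" "z \<in> carrier M" and eq: "pure M 1 y = pure M 1 z"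
  shows "y = z"
proof -
  interpret M: Module.module R M by (rule dmod_module[OF M])
  obtain s' where s': "\<And>j a y. j < n \<Longrightarrow> y \<in> carrier M \<Longrightarrow> s' j (pure M a y) = a * s j y"
  proof (rule dual_basis_ext[OF M db])
    fix s' assume "\<And>j a y. j < n \<Longrightarrow> y \<in> carrier M \<Longrightarrow> s' j (pure M a y) = a * s j y"
    then show thesis by (rule that)
  qed
  have "s j y = s j z" if "j < n" for j
    using s'[OF that yz(1), of 1] s'[OF that yz(2), of 1] eq by simp
  then have "finsum M (\<lambda>j. s j y \<odot>\<^bsub>M\<^esub> x j) {..<n} = finsum M (\<lambda>j. s j z \<odot>\<^bsub>M\<^esub> x j) {..<n}"
    using db yz by (intro M.finsum_cong') (auto simp: dual_basis_def)
  moreover have "w = finsum M (\<lambda>j. s j w \<odot>\<^bsub>M\<^esub> x j) {..<n}" if "w \<in> carrier M" for w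
    using db that unfolding dual_basis_def by blast
  ultimately show ?thesis using yz by metis
qed

context
  fixes M :: "('a, 'm) dmodule" and N :: "('a, 'n) dmodule"
  assumes M: "dmod R d M" and N: "dmod R d N"
begin

interpretation N: Module.module R N using N by (rule dmod_module)
interpretation EN: Module.module A "ext N" by (rule dmod_module[OF dmod_ext[OF N]])
interpretation H: Module.module R "internal_hom R M N"
  by (rule internal_hom_module[OF dmod_module[OF M] dmod_module[OF N]])
interpretation EH: Module.module A "internal_hom A (ext M) (ext N)"
  by (rule internal_hom_module[OF dmod_module[OF dmod_ext[OF M]] dmod_module[OF dmod_ext[OF N]]])

lemma ext_hom_plus:
  assumes "f \<in> lin_maps R M N" "g \<in> lin_maps R M N"
  shows "ext_hom M N (f \<oplus>\<^bsub>internal_hom R M N\<^esub> g) =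
    ext_hom M N f \<oplus>\<^bsub>internal_hom A (ext M) (ext N)\<^esub> ext_hom M N g"
proof (rule lin_maps_ext_eqI[OF M])
  have fg: "f \<oplus>\<^bsub>internal_hom R M N\<^esub> g \<in> lin_maps R M N"
    using assms H.M.a_closed[of f g] by (simp add: internal_hom_simps(1))
  show "ext_hom M N (f \<oplus>\<^bsub>internal_hom R M N\<^esub> g) \<in> lin_maps A (ext M) (ext N)"
    by (rule ext_hom_lin[OF M N fg])
  show "ext_hom M N f \<oplus>\<^bsub>internal_hom A (ext M) (ext N)\<^esub> ext_hom M N g \<in> lin_maps A (ext M) (ext N)"
    using EH.M.a_closed[of "ext_hom M N f" "ext_hom M N g"] assms
    by (simp add: internal_hom_simps(1) ext_hom_lin[OF M N])
  show "ext_hom M N (f \<oplus>\<^bsub>internal_hom R M N\<^esub> g) (pure M 1 x) =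
      (ext_hom M N f \<oplus>\<^bsub>internal_hom A (ext M) (ext N)\<^esub> ext_hom M N g) (pure M 1 x)" if "x \<in> carrier M" for x
    using that assms
    by (simp add: ext_hom_pure[OF M N] fg) (simp add: internal_hom_simps pure_closed[OF M] ext_hom_pure[OF M N]
        pure_add_right[OF N] lin_maps_closed)
qed

lemma ext_hom_smult:
  assumes "c \<in> S" "f \<in> lin_maps R M N"
  shows "ext_hom M N (c \<odot>\<^bsub>internal_hom R M N\<^esub> f) = c \<odot>\<^bsub>internal_hom A (ext M) (ext N)\<^esub> ext_hom M N f"
proof (rule lin_maps_ext_eqI[OF M])
  have fg: "c \<odot>\<^bsub>internal_hom R M N\<^esub> f \<in> lin_maps R M N"
    using assms H.smult_closed[of c f] by (simp add: internal_hom_simps(1))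
  show "ext_hom M N (c \<odot>\<^bsub>internal_hom R M N\<^esub> f) \<in> lin_maps A (ext M) (ext N)"
    by (rule ext_hom_lin[OF M N fg])
  show "c \<odot>\<^bsub>internal_hom A (ext M) (ext N)\<^esub> ext_hom M N f \<in> lin_maps A (ext M) (ext N)"
    using EH.smult_closed[of c "ext_hom M N f"] assms
    by (simp add: internal_hom_simps(1) ext_hom_lin[OF M N])
  show "ext_hom M N (c \<odot>\<^bsub>internal_hom R M N\<^esub> f) (pure M 1 x) =
      (c \<odot>\<^bsub>internal_hom A (ext M) (ext N)\<^esub> ext_hom M N f) (pure M 1 x)" if "x \<in> carrier M" for x
    using that assms
    by (simp add: ext_hom_pure[OF M N] fg) (simp add: internal_hom_simps pure_closed[OF M] ext_hom_pure[OF M N]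
        pure_smult[OF N] lin_maps_closed)
qed

text \<open>Both sides agree on tensors with first factor 1, because 1 is constant and the
  connection acts on such a tensor through its second factor only.\<close>

lemma ext_hom_conn:
  assumes f: "f \<in> lin_maps R M N"
  shows "ext_hom M N (conn R M N f) = conn A (ext M) (ext N) (ext_hom M N f)"
proof (rule lin_maps_ext_eqI[OF M])
  have fg: "conn R M N f \<in> lin_maps R M N" by (rule conn_closed[OF M N d_funcset(1) f])
  show "ext_hom M N (conn R M N f) \<in> lin_maps A (ext M) (ext N)"
    by (rule ext_hom_lin[OF M N fg])
  show "conn A (ext M) (ext N) (ext_hom M N f) \<in> lin_maps A (ext M) (ext N)"
    by (rule conn_closed[OF dmod_ext[OF M] dmod_ext[OF N] d_funcset(2) ext_hom_lin[OF M N f]])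
  show "ext_hom M N (conn R M N f) (pure M 1 x) = conn A (ext M) (ext N) (ext_hom M N f) (pure M 1 x)"
    if x: "x \<in> carrier M" for x
    using x f
    by (simp add: ext_hom_pure[OF M N] fg)
       (simp add: conn_def pure_closed[OF M] ext_hom_pure[OF M N] nabla_pure_one[OF M] nabla_pure_one[OF N]
         pure_diff[OF N N N] lin_maps_closed nabla_closed[OF M] nabla_closed[OF N])
qed

lemma ext_hom_inj:
  assumes db: "dual_basis R N n y t"
    and fg: "f \<in> lin_maps R M N" "g \<in> lin_maps R M N" and eq: "ext_hom M N f = ext_hom M N g"
  shows "f = g"
proof (rule lin_maps_eqI[OF fg])
  fix x assume x: "x \<in> carrier M"
  have "pure N 1 (f x) = pure N 1 (g x)"
    using eq x fg by (simp flip: ext_hom_pure[OF M N])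
  then show "f x = g x"
    using pure_one_inj[OF N db] fg x by (simp add: lin_maps_closed)
qed

end

end

section \<open>De Rham cohomology over the constants\<close>

lemma const_scalars_simps [simp]:
  "carrier (const_scalars H) = carrier H" "\<zero>\<^bsub>const_scalars H\<^esub> = \<zero>\<^bsub>H\<^esub>"
  "x \<oplus>\<^bsub>const_scalars H\<^esub> y = x \<oplus>\<^bsub>H\<^esub> y" "c \<odot>\<^bsub>const_scalars H\<^esub> x = fls_const c \<odot>\<^bsub>H\<^esub> x"
  by (simp_all add: const_scalars_def)

lemma H0_dR_simps:
  "carrier (H0_dR H) = {x \<in> carrier H. nabla H x = \<zero>\<^bsub>H\<^esub>}" "\<zero>\<^bsub>H0_dR H\<^esub> = \<zero>\<^bsub>H\<^esub>"
  "x \<oplus>\<^bsub>H0_dR H\<^esub> y = x \<oplus>\<^bsub>H\<^esub> y" "c \<odot>\<^bsub>H0_dR H\<^esub> x = fls_const c \<odot>\<^bsub>H\<^esub> x"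
  by (simp_all add: H0_dR_def const_scalars_def)

context
  fixes S :: "'k::field_char_0 fls set" and H :: "('k fls, 'v) dmodule"
  assumes H: "dmod (subring_of S) fls_deriv H" and const: "\<And>c. fls_const c \<in> S"
begin

interpretation H: Module.module "subring_of S" H by (rule dmod_module[OF H])

lemma nabla_const: "x \<in> carrier H \<Longrightarrow> nabla H (fls_const c \<odot>\<^bsub>H\<^esub> x) = fls_const c \<odot>\<^bsub>H\<^esub> nabla H x"
  using nabla_smult[OF H, of "fls_const c" x] const H.smult_l_null[of x] nabla_closed[OF H, of x]
  by simp

lemma const_smult_simps:
  "x \<in> carrier H \<Longrightarrow> fls_const (a + b) \<odot>\<^bsub>H\<^esub> x = fls_const a \<odot>\<^bsub>H\<^esub> x \<oplus>\<^bsub>H\<^esub> fls_const b \<odot>\<^bsub>H\<^esub> x"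
  "x \<in> carrier H \<Longrightarrow> fls_const (a * b) \<odot>\<^bsub>H\<^esub> x = fls_const a \<odot>\<^bsub>H\<^esub> (fls_const b \<odot>\<^bsub>H\<^esub> x)"
  "x \<in> carrier H \<Longrightarrow> 1 \<odot>\<^bsub>H\<^esub> x = x"
  using H.smult_l_distr[of "fls_const a" "fls_const b" x] H.smult_assoc1[of "fls_const a" "fls_const b" x]
    H.smult_one[of x] const by (simp_all add: fls_plus_const)

lemma const_scalars_module: "Module.module class_ring (const_scalars H)"
proof (rule moduleI[OF class_cring.is_cring])
  show "abelian_group (const_scalars H)"
  proof (rule abelian_groupI)
    fix x assume "x \<in> carrier (const_scalars H)"
    then show "\<exists>y\<in>carrier (const_scalars H). y \<oplus>\<^bsub>const_scalars H\<^esub> x = \<zero>\<^bsub>const_scalars H\<^esub>"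
      by (intro bexI[of _ "\<ominus>\<^bsub>H\<^esub> x"]) (simp_all add: H.l_neg)
  qed (simp_all add: H.a_ac)
qed (simp_all add: const const_smult_simps H.smult_r_distr)

lemma H0_dR_vectorspace: "vectorspace class_ring (H0_dR H)"
proof (rule vectorspace.intro[OF _ class_field])
  note simps = H0_dR_simps nabla_add[OF H] nabla_const nabla_zero[OF H H H] nabla_neg[OF H H H]
  show "Module.module class_ring (H0_dR H)"
  proof (rule moduleI[OF class_cring.is_cring])
    show "abelian_group (H0_dR H)"
    proof (rule abelian_groupI)
      fix x assume x: "x \<in> carrier (H0_dR H)"
      have "\<ominus>\<^bsub>H\<^esub> \<zero>\<^bsub>H\<^esub> = \<zero>\<^bsub>H\<^esub>" by (rule H.minus_equality) simp_all
      with x show "\<exists>y\<in>carrier (H0_dR H). y \<oplus>\<^bsub>H0_dR H\<^esub> x = \<zero>\<^bsub>H0_dR H\<^esub>"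
        by (intro bexI[of _ "\<ominus>\<^bsub>H\<^esub> x"]) (simp_all add: simps H.l_neg)
    qed (simp_all add: simps H.a_ac)
  qed (simp_all add: simps const const_smult_simps H.smult_r_distr)
qed

lemma nabla_image_subgroup: "additive_subgroup (nabla H ` carrier H) (const_scalars H)"
proof (rule additive_subgroup.intro)
  interpret C: Module.module class_ring "const_scalars H" by (rule const_scalars_module)
  have neg: "\<ominus>\<^bsub>const_scalars H\<^esub> x = \<ominus>\<^bsub>H\<^esub> x" if "x \<in> carrier H" for x
    by (rule C.minus_equality) (use that in \<open>simp_all add: H.l_neg\<close>)
  show "subgroup (nabla H ` carrier H) (add_monoid (const_scalars H))"
  proof (rule C.add.subgroupI)
    show "nabla H ` carrier H \<subseteq> carrier (const_scalars H)" by (auto simp: nabla_closed[OF H])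
    show "nabla H ` carrier H \<noteq> {}" by auto
    show "\<ominus>\<^bsub>const_scalars H\<^esub> a \<in> nabla H ` carrier H" if "a \<in> nabla H ` carrier H" for a
      using that by (auto simp: neg nabla_closed[OF H] nabla_neg[OF H H H, symmetric])
    show "a \<oplus>\<^bsub>const_scalars H\<^esub> b \<in> nabla H ` carrier H"
      if "a \<in> nabla H ` carrier H" "b \<in> nabla H ` carrier H" for a b
      using that by (auto simp: nabla_add[OF H, symmetric])
  qed
qed

lemma nabla_image_smult: "x \<in> nabla H ` carrier H \<Longrightarrow> c \<odot>\<^bsub>const_scalars H\<^esub> x \<in> nabla H ` carrier H"
  using const by (auto simp: nabla_const[symmetric])

lemma H1_dR_vectorspace: "vectorspace class_ring (H1_dR H)"
  unfolding H1_dR_def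
  by (rule vectorspace.intro[OF quot_module(1)[OF const_scalars_module nabla_image_subgroup nabla_image_smult] class_field])

text \<open>Extracts from the cohomological hypotheses the data used in the index argument:
  independent horizontal elements \<kappa>, and equally many elements \<open>c\<close> that generate
  modulo derivatives. The embedding \<Theta> into a ring type allows both statements to be written
  with ordinary sums.\<close>

lemma euler_characteristic_zero:
  fixes \<Theta> :: "'v \<Rightarrow> 'w::comm_ring_1" and sc :: "'k \<Rightarrow> 'w \<Rightarrow> 'w"
  assumes fd: "finite_dim_dR H" and chi: "chi_dR H = 0"
    and add: "\<And>x y. x \<in> carrier H \<Longrightarrow> y \<in> carrier H \<Longrightarrow> \<Theta> (x \<oplus>\<^bsub>H\<^esub> y) = \<Theta> x + \<Theta> y"
    and sc: "\<And>c x. x \<in> carrier H \<Longrightarrow> \<Theta> (fls_const c \<odot>\<^bsub>H\<^esub> x) = sc c (\<Theta> x)"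
    and inj: "inj_on \<Theta> (carrier H)"
  obtains p :: nat and \<kappa> c :: "nat \<Rightarrow> 'v"
  where "\<And>j. j < p \<Longrightarrow> \<kappa> j \<in> carrier H \<and> nabla H (\<kappa> j) = \<zero>\<^bsub>H\<^esub>"
    and "\<And>\<mu>. (\<Sum>j<p. sc (\<mu> j) (\<Theta> (\<kappa> j))) = 0 \<Longrightarrow> \<forall>j<p. \<mu> j = 0"
    and "\<And>j. j < p \<Longrightarrow> c j \<in> carrier H"
    and "\<And>x. x \<in> carrier H \<Longrightarrow>
      \<exists>\<mu>. \<exists>y\<in>carrier H. \<Theta> x = (\<Sum>j<p. sc (\<mu> j) (\<Theta> (c j))) + \<Theta> (nabla H y)"
proof -
  interpret V0: vectorspace class_ring "H0_dR H" by (rule H0_dR_vectorspace)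
  interpret V1: vectorspace class_ring "H1_dR H" by (rule H1_dR_vectorspace)
  interpret C: Module.module class_ring "const_scalars H" by (rule const_scalars_module)
  let ?N = "nabla H ` carrier H"
  have ag: "abelian_group (class_ring :: 'w ring)" by (rule class_ring.abelian_group_axioms)
  have add_C: "add_hom (const_scalars H) (class_ring :: 'w ring) \<Theta>" by (rule add_homI) (simp_all add: add)
  have add_0: "add_hom (H0_dR H) (class_ring :: 'w ring) \<Theta>" by (rule add_homI) (simp_all add: add H0_dR_simps)
  obtain \<beta>0 where \<beta>0: "finite \<beta>0" "V0.basis \<beta>0"
    using V0.finite_basis_exists fd by (auto simp: finite_dim_dR_def)
  obtain \<beta>1 where \<beta>1: "finite \<beta>1" "V1.basis \<beta>1"
    using V1.finite_basis_exists fd by (auto simp: finite_dim_dR_def)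
  define p where "p = card \<beta>0"
  \<comment> \<open>The Euler characteristic vanishes, so bases in degrees zero and one can be
    indexed by the same set.\<close>
  have p: "card \<beta>1 = p"
    using chi V0.dim_basis[OF \<beta>0] V1.dim_basis[OF \<beta>1] by (simp add: chi_dR_def p_def)
  obtain \<kappa> where \<kappa>: "bij_betw \<kappa> {..<p} \<beta>0"
    using ex_bij_betw_nat_finite[OF \<beta>0(1)] by (auto simp: p_def atLeast0LessThan)
  obtain X where X: "bij_betw X {..<p} \<beta>1"
    using ex_bij_betw_nat_finite[OF \<beta>1(1)] p by (auto simp: atLeast0LessThan)
  note q = quot_dmod_simps[OF C.M.abelian_group_axioms nabla_image_subgroup, folded H1_dR_def]
  note q_smult = quot_module(2)[OF const_scalars_module nabla_image_subgroup nabla_image_smult, folded H1_dR_def]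
  define \<pi> where "\<pi> x = ?N +>\<^bsub>const_scalars H\<^esub> x" for x
  have add_\<pi>: "add_hom (const_scalars H) (H1_dR H) \<pi>"
    unfolding \<pi>_def by (rule add_homI) (rule q(1), assumption, rule q(3)[symmetric])
  \<comment> \<open>Representatives of the basis classes in degree one are chosen as elements of
    \<open>H\<close> itself.\<close>
  have Xc: "\<forall>j\<in>{..<p}. \<exists>c. c \<in> carrier H \<and> X j = \<pi> c"
  proof
    fix j assume "j \<in> {..<p}"
    then have "X j \<in> carrier (H1_dR H)"
      using X \<beta>1 by (auto simp: V1.basis_def bij_betw_def)
    from q(2)[OF this] show "\<exists>c. c \<in> carrier H \<and> X j = \<pi> c" by (auto simp: \<pi>_def)
  qed
  obtain c where c: "\<forall>j\<in>{..<p}. c j \<in> carrier H \<and> X j = \<pi> (c j)"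
    using bchoice[OF Xc] by (elim exE) (rule that)
  show ?thesis
  proof (rule that)
    show \<kappa>H: "\<kappa> j \<in> carrier H \<and> nabla H (\<kappa> j) = \<zero>\<^bsub>H\<^esub>" if "j < p" for j
    proof -
      have "\<kappa> j \<in> carrier (H0_dR H)" using that \<kappa> \<beta>0 by (auto simp: V0.basis_def bij_betw_def)
      then show ?thesis by (simp add: H0_dR_simps)
    qed
    show "c j \<in> carrier H" if "j < p" for j using c that by simp
    show "\<forall>j<p. \<mu> j = 0" if \<mu>: "(\<Sum>j<p. sc (\<mu> j) (\<Theta> (\<kappa> j))) = 0" for \<mu>
    proof (rule ccontr)
      assume "\<not> (\<forall>j<p. \<mu> j = 0)"
      then obtain j where j: "j < p" and nz: "\<mu> j \<noteq> 0" by blast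
      define a where "a v = \<mu> (inv_into {..<p} \<kappa> v)" for v
      have a\<kappa>: "a (\<kappa> i) = \<mu> i" if "i < p" for i
        using that \<kappa> by (simp add: a_def bij_betw_def inv_into_f_f)
      have \<beta>c: "\<beta>0 \<subseteq> carrier (H0_dR H)" using \<beta>0 by (simp add: V0.basis_def)
      have \<beta>H: "v \<in> carrier H" if "v \<in> \<beta>0" for v using \<beta>c that by (auto simp: H0_dR_simps)
      have cl: "(\<lambda>v. a v \<odot>\<^bsub>H0_dR H\<^esub> v) \<in> \<beta>0 \<rightarrow> carrier (H0_dR H)"
        using \<beta>c V0.smult_closed by auto
      have "\<Theta> (V0.lincomb a \<beta>0) = finsum class_ring (\<lambda>v. \<Theta> (a v \<odot>\<^bsub>H0_dR H\<^esub> v)) \<beta>0"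
        unfolding V0.lincomb_def
        by (rule add_hom_finsum[OF V0.M.abelian_group_axioms ag add_0 \<beta>0(1) cl])
      also have "\<dots> = (\<Sum>v\<in>\<beta>0. sc (a v) (\<Theta> v))"
        unfolding class_ring_simps H0_dR_simps using sc \<beta>H by (intro sum.cong) auto
      also have "\<dots> = (\<Sum>i<p. sc (a (\<kappa> i)) (\<Theta> (\<kappa> i)))"
        by (rule sum.reindex_bij_betw[OF \<kappa>, symmetric])
      also have "\<dots> = 0" using \<mu> by (simp add: a\<kappa> cong: sum.cong_simp)
      also have "\<dots> = \<Theta> \<zero>\<^bsub>H\<^esub>"
        using add_hom_zero[OF C.M.abelian_group_axioms ag add_C] by simp
      finally have "V0.lincomb a \<beta>0 = \<zero>\<^bsub>H\<^esub>"
        using inj V0.lincomb_closed[OF \<beta>c, of a] by (auto simp: inj_on_def H0_dR_simps)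
      then have "V0.lin_dep \<beta>0"
        using \<beta>0(1) \<kappa> j nz a\<kappa>[OF j]
        by (intro V0.lin_dep_crit[of \<beta>0 \<beta>0 a "\<kappa> j"]) (auto simp: H0_dR_simps bij_betw_def)
      then show False using \<beta>0(2) by (simp add: V0.basis_def)
    qed
    show "\<exists>\<mu>. \<exists>y\<in>carrier H. \<Theta> x = (\<Sum>j<p. sc (\<mu> j) (\<Theta> (c j))) + \<Theta> (nabla H y)" if x: "x \<in> carrier H" for x
    proof -
      have \<beta>c: "\<beta>1 \<subseteq> carrier (H1_dR H)" using \<beta>1 by (simp add: V1.basis_def)
      have "\<pi> x \<in> V1.span \<beta>1" using add_hom_closed[OF C.M.abelian_group_axioms V1.M.abelian_group_axioms add_\<pi>, of x] x \<beta>1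
        by (simp add: V1.basis_def)
      then obtain a where a: "\<pi> x = V1.lincomb a \<beta>1"
        unfolding V1.finite_span[OF \<beta>1(1) \<beta>c] by blast
      define z where "z = finsum (const_scalars H) (\<lambda>j. a (X j) \<odot>\<^bsub>const_scalars H\<^esub> c j) {..<p}"
      have cl: "(\<lambda>j. a (X j) \<odot>\<^bsub>const_scalars H\<^esub> c j) \<in> {..<p} \<rightarrow> carrier (const_scalars H)"
        using c const by auto
      then have z: "z \<in> carrier (const_scalars H)" unfolding z_def by (rule C.finsum_closed)
      have "\<pi> z = finsum (H1_dR H) (\<lambda>j. \<pi> (a (X j) \<odot>\<^bsub>const_scalars H\<^esub> c j)) {..<p}"
        unfolding z_def by (rule add_hom_finsum[OF C.M.abelian_group_axioms V1.M.abelian_group_axioms add_\<pi> _ cl]) simp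
      also have "\<dots> = finsum (H1_dR H) (\<lambda>j. a (X j) \<odot>\<^bsub>H1_dR H\<^esub> X j) {..<p}"
      proof (rule V1.finsum_cong')
        show "(\<lambda>j. a (X j) \<odot>\<^bsub>H1_dR H\<^esub> X j) \<in> {..<p} \<rightarrow> carrier (H1_dR H)"
          using X \<beta>c V1.smult_closed by (auto simp: bij_betw_def)
        show "\<pi> (a (X j) \<odot>\<^bsub>const_scalars H\<^esub> c j) = a (X j) \<odot>\<^bsub>H1_dR H\<^esub> X j" if "j \<in> {..<p}" for j
          using c that q_smult[of "a (X j)" "c j"] by (simp add: \<pi>_def)
      qed simp
      also have "\<dots> = finsum (H1_dR H) (\<lambda>Y. a Y \<odot>\<^bsub>H1_dR H\<^esub> Y) (X ` {..<p})"
        using X \<beta>c V1.smult_closed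
        by (intro V1.M.add.finprod_reindex[symmetric]) (auto simp: bij_betw_def)
      also have "\<dots> = \<pi> x" using X a by (simp add: bij_betw_def V1.lincomb_def)
      finally have "x \<ominus>\<^bsub>const_scalars H\<^esub> z \<in> ?N"
        using C.M.a_coset_eq_iff[OF nabla_image_subgroup, of x z] x z by (simp add: \<pi>_def)
      then obtain y where y: "y \<in> carrier H" "x \<ominus>\<^bsub>const_scalars H\<^esub> z = nabla H y" by blast
      have "x = nabla H y \<oplus>\<^bsub>H\<^esub> z"
        using C.diff_eq_iff[of x z "nabla H y"] x y z nabla_closed[OF H y(1)] by simp
      then have "\<Theta> x = \<Theta> (nabla H y) + \<Theta> z" using add[of "nabla H y" z] y z nabla_closed[OF H y(1)] by simp
      moreover have "\<Theta> z = (\<Sum>j<p. sc (a (X j)) (\<Theta> (c j)))"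
      proof -
        have "\<Theta> z = finsum class_ring (\<lambda>j. \<Theta> (a (X j) \<odot>\<^bsub>const_scalars H\<^esub> c j)) {..<p}"
          unfolding z_def by (rule add_hom_finsum[OF C.M.abelian_group_axioms ag add_C _ cl]) simp
        also have "\<dots> = (\<Sum>j<p. sc (a (X j)) (\<Theta> (c j)))"
        proof -
          have "\<Theta> (fls_const b \<odot>\<^bsub>H\<^esub> c j) = sc b (\<Theta> (c j))" if "j < p" for b j
            using c that by (intro sc) simp
          then show ?thesis unfolding class_ring_simps const_scalars_simps by (intro sum.cong refl) simp
        qed
        finally show ?thesis .
      qed
      ultimately show ?thesis using y by (auto simp: add.commute intro!: exI[of _ "\<lambda>j. a (X j)"])
    qed
  qed
qed

end

section \<open>Comparison of Hom over the disk and over Laurent series\<close>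

text \<open>Containing all monomials lets the subring absorb the finite-rank corrections of the
  connection; exponent zero gives the constants.\<close>

locale laurent_scalar_extension = scalar_extension S fls_deriv
  for S :: "'k::field_char_0 fls set" +
  assumes monomial: "fls_const c * fls_X_intpow j \<in> S"
begin

lemma const: "fls_const c \<in> S"
  using monomial[of c 0] by simp

text \<open>The three conclusions are surjectivity in degree zero, injectivity in degree one and
  surjectivity in degree one of the map from Hom over \<open>R\<close> to Hom over \<open>A\<close>.
  Both spaces are turned into spaces of matrices by means of the dual bases, where the index
  argument for connections over Laurent series applies.\<close>

lemma hom_comparison:
  fixes M :: "('k fls, 'm) dmodule" and N :: "('k fls, 'n) dmodule"
  assumes M: "dmod R fls_deriv M" and N: "dmod R fls_deriv N"
    and dbM: "dual_basis R M m x s" and dbN: "dual_basis R N n y t"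
    and fd: "finite_dim_dR (internal_hom R M N)" and chi: "chi_dR (internal_hom R M N) = 0"
  shows "g \<in> dmod_hom A (ext M) (ext N) \<Longrightarrow> \<exists>f\<in>dmod_hom R M N. ext_hom M N f = g"
    and "f \<in> lin_maps R M N \<Longrightarrow> g \<in> lin_maps A (ext M) (ext N) \<Longrightarrow>
      ext_hom M N f = conn A (ext M) (ext N) g \<Longrightarrow> \<exists>\<psi>\<in>lin_maps R M N. f = conn R M N \<psi>"
    and "g \<in> lin_maps A (ext M) (ext N) \<Longrightarrow> \<exists>f\<in>lin_maps R M N. \<exists>\<psi>\<in>lin_maps A (ext M) (ext N).
      g = ext_hom M N f \<oplus>\<^bsub>internal_hom A (ext M) (ext N)\<^esub> conn A (ext M) (ext N) \<psi>"
proof -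
  let ?D = fls_deriv
  define H where "H = internal_hom R M N"
  define H' where "H' = internal_hom A (ext M) (ext N)"
  have dM': "dmod A ?D (ext M)" and dN': "dmod A ?D (ext N)" by (rule dmod_ext[OF M] dmod_ext[OF N])+
  have dH: "dmod R ?D H" and dH': "dmod A ?D H'"
    unfolding H_def H'_def
    by (rule internal_hom_dmod[OF M N d_funcset(1)] internal_hom_dmod[OF dM' dN' d_funcset(2)])+
  interpret N: Module.module R N by (rule dmod_module[OF N])
  interpret M': Module.module A "ext M" by (rule dmod_module[OF dM'])
  interpret N': Module.module A "ext N" by (rule dmod_module[OF dN'])
  interpret H: Module.module R H by (rule dmod_module[OF dH])
  interpret H': Module.module A H' by (rule dmod_module[OF dH'])
  have cH: "carrier H = lin_maps R M N" and cH': "carrier H' = lin_maps A (ext M) (ext N)"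
    by (simp_all add: H_def H'_def internal_hom_simps)
  obtain s' where s': "dual_basis A (ext M) m (\<lambda>j. pure M 1 (x j)) s'"
    and s's: "\<And>j a z. j < m \<Longrightarrow> z \<in> carrier M \<Longrightarrow> s' j (pure M a z) = a * s j z"
    by (rule dual_basis_ext[OF M dbM]) blast
  obtain t' where t': "dual_basis A (ext N) n (\<lambda>j. pure N 1 (y j)) t'"
    and t't: "\<And>j a z. j < n \<Longrightarrow> z \<in> carrier N \<Longrightarrow> t' j (pure N a z) = a * t j z"
    by (rule dual_basis_ext[OF N dbN]) blast
  have x: "x j \<in> carrier M" "pure M 1 (x j) \<in> carrier (ext M)" if "j < m" for j
    using dbM that by (simp_all add: dual_basis_def pure_closed[OF M])
  have y: "y i \<in> carrier N" "pure N 1 (y i) \<in> carrier (ext N)" if "i < n" for i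
    using dbN that by (simp_all add: dual_basis_def pure_closed[OF N])
  have t'_add: "t' i (X \<oplus>\<^bsub>ext N\<^esub> Y) = t' i X + t' i Y"
    if "i < n" "X \<in> carrier (ext N)" "Y \<in> carrier (ext N)" for i X Y
    using t' that by (simp add: dual_basis_def)
  have t'_smult: "t' i (a \<odot>\<^bsub>ext N\<^esub> X) = a * t' i X" if "i < n" "X \<in> carrier (ext N)" for i X a
    using t' that by (simp add: dual_basis_def)
  note t'_simps = t'_add t'_smult
  \<comment> \<open>The matrix of \<open>f\<close> in the two dual bases, padded by zeros so that
    all matrices share one type with globally defined addition and scaling. The matrix determines
    \<open>f\<close>, but only a subspace of matrices need occur, since the generators may satisfy
    relations.\<close>
  define mat where "mat f = (\<lambda>(i, j). if i < n \<and> j < m then t' i (f (pure M 1 (x j))) else 0)"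
    for f :: "('k fls \<times> 'm \<Rightarrow>\<^sub>0 int) set \<Rightarrow> ('k fls \<times> 'n \<Rightarrow>\<^sub>0 int) set"
  define sc where "sc a v = (\<lambda>k. a * v k)" for a :: "'k fls" and v :: "nat \<times> nat \<Rightarrow> 'k fls"
  interpret V: vector_space sc
    by unfold_locales (auto simp: sc_def fun_eq_iff algebra_simps)
  have cl': "f z \<in> carrier (ext N)" if "f \<in> carrier H'" "z \<in> carrier (ext M)" for f z
    using that by (auto simp: cH' lin_maps_closed)
  have mat_add: "mat (f \<oplus>\<^bsub>H'\<^esub> g) = mat f + mat g" if "f \<in> carrier H'" "g \<in> carrier H'" for f g
    using that by (auto simp: mat_def fun_eq_iff H'_def internal_hom_simps(2-) x cl'[unfolded H'_def] t'_simps)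
  have mat_smult: "mat (a \<odot>\<^bsub>H'\<^esub> f) = sc a (mat f)" if "f \<in> carrier H'" for f a
    using that by (auto simp: mat_def sc_def fun_eq_iff H'_def internal_hom_simps(2-) x cl'[unfolded H'_def] t'_simps)
  have mat_inj: "inj_on mat (carrier H')"
  proof (rule inj_onI)
    fix f g assume fg: "f \<in> carrier H'" "g \<in> carrier H'" and eq: "mat f = mat g"
    have fx: "f (pure M 1 (x j)) = g (pure M 1 (x j))" if j: "j < m" for j
    proof -
      have ext: "Z = finsum (ext N) (\<lambda>i. t' i Z \<odot>\<^bsub>ext N\<^esub> pure N 1 (y i)) {..<n}" if "Z \<in> carrier (ext N)" for Z
        using t' that unfolding dual_basis_def by blast
      have "t' i (f (pure M 1 (x j))) = t' i (g (pure M 1 (x j)))" if "i < n" for i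
        using fun_cong[OF eq, of "(i, j)"] that j by (simp add: mat_def)
      then have "finsum (ext N) (\<lambda>i. t' i (f (pure M 1 (x j))) \<odot>\<^bsub>ext N\<^esub> pure N 1 (y i)) {..<n} =
          finsum (ext N) (\<lambda>i. t' i (g (pure M 1 (x j))) \<odot>\<^bsub>ext N\<^esub> pure N 1 (y i)) {..<n}"
        using y by (intro N'.finsum_cong') auto
      then show ?thesis using ext[OF cl'[OF fg(1) x(2)[OF j]]] ext[OF cl'[OF fg(2) x(2)[OF j]]] by simp
    qed
    show "f = g"
    proof (rule lin_maps_eqI)
      show "f \<in> lin_maps A (ext M) (ext N)" "g \<in> lin_maps A (ext M) (ext N)" using fg by (simp_all add: cH')
      fix Z assume Z: "Z \<in> carrier (ext M)"
      note e = dual_basis_expand[OF M'.module_axioms N'.module_axioms s' _ Z]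
      have "finsum (ext N) (\<lambda>j. s' j Z \<odot>\<^bsub>ext N\<^esub> f (pure M 1 (x j))) {..<m} =
          finsum (ext N) (\<lambda>j. s' j Z \<odot>\<^bsub>ext N\<^esub> g (pure M 1 (x j))) {..<m}"
        using fx fg x by (intro N'.finsum_cong') (auto simp: cl')
      then show "f Z = g Z" using e[of f] e[of g] fg by (simp add: cH')
    qed
  qed
  define V where "V = mat ` carrier H'"
  define nab where "nab v = mat (nabla H' (inv_into (carrier H') mat v))" for v
  have nab_mat: "nab (mat f) = mat (nabla H' f)" if "f \<in> carrier H'" for f
    using that by (simp add: nab_def inv_into_f_f[OF mat_inj])
  define \<Theta> where "\<Theta> f = mat (ext_hom M N f)" for f
  have ext_H': "ext_hom M N f \<in> carrier H'" if "f \<in> carrier H" for f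
    using ext_hom_lin[OF M N] that by (simp add: cH cH')
  have \<Theta>_add: "\<Theta> (f \<oplus>\<^bsub>H\<^esub> g) = \<Theta> f + \<Theta> g" if "f \<in> carrier H" "g \<in> carrier H" for f g
    using ext_hom_plus[OF M N, of f g] that mat_add[OF ext_H' ext_H', of f g] by (simp add: \<Theta>_def H_def H'_def internal_hom_simps(1))
  have \<Theta>_smult: "\<Theta> (c \<odot>\<^bsub>H\<^esub> f) = sc c (\<Theta> f)" if "c \<in> S" "f \<in> carrier H" for c f
    using ext_hom_smult[OF M N, of c f] that mat_smult[OF ext_H', of f c] by (simp add: \<Theta>_def H_def H'_def internal_hom_simps(1))
  have ext_conn: "ext_hom M N (nabla H f) = nabla H' (ext_hom M N f)" if "f \<in> carrier H" for f
    using ext_hom_conn[OF M N, of f] that by (simp add: H_def H'_def internal_hom_simps(1))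
  have \<Theta>_nabla: "nab (\<Theta> f) = \<Theta> (nabla H f)" if "f \<in> carrier H" for f
    using nab_mat[OF ext_H'[OF that]] ext_conn[OF that] by (simp add: \<Theta>_def)
  have \<Theta>_inj: "inj_on \<Theta> (carrier H)"
  proof (rule inj_onI)
    fix f g assume fg: "f \<in> carrier H" "g \<in> carrier H" "\<Theta> f = \<Theta> g"
    then have "ext_hom M N f = ext_hom M N g" using mat_inj ext_H' by (simp add: \<Theta>_def inj_on_def)
    then show "f = g" using ext_hom_inj[OF M N dbN] fg by (simp add: cH)
  qed
  define VR where "VR = \<Theta> ` carrier H"
  \<comment> \<open>For \<open>k\<close> the pair of \<open>i\<close> and \<open>j\<close>, the map
    of rank one with functional \<open>s j\<close> and value \<open>y i\<close>. These maps are
    defined over \<open>R\<close> and provide the generating set inside \<open>VR\<close>.\<close>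
  define g where "g k = (\<lambda>z\<in>carrier M. s (snd k) z \<odot>\<^bsub>N\<^esub> y (fst k))" for k :: "nat \<times> nat"
  have g: "g k \<in> carrier H" if "k \<in> {..<n} \<times> {..<m}" for k
    unfolding cH g_def
    by (rule lin_mapsI[OF _ _ _ dmod_module[OF M]])
       (use that dbM y in \<open>auto simp: dual_basis_def N.smult_l_distr[simplified] N.smult_assoc1[simplified]\<close>)
  have \<Theta>g: "\<Theta> (g (i, j)) (k, l) = s j (x l) * t k (y i)" if "i < n" "j < m" "k < n" "l < m" for i j k l
  proof -
    have "g (i, j) \<in> lin_maps R M N" using g[of "(i, j)"] that by (simp add: cH)
    then have "\<Theta> (g (i, j)) (k, l) = t' k (pure N 1 (g (i, j) (x l)))"
      using that x by (simp add: \<Theta>_def mat_def ext_hom_pure[OF M N])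
    also have "\<dots> = t k (s j (x l) \<odot>\<^bsub>N\<^esub> y i)"
      using that x y dbM by (subst t't) (auto simp: g_def dual_basis_def)
    also have "\<dots> = s j (x l) * t k (y i)" using that x y dbM dbN by (simp add: dual_basis_def)
    finally show ?thesis .
  qed
  \<comment> \<open>Expanding the argument in the dual basis of \<open>M\<close> and the value in
    that of \<open>N\<close> writes \<open>f\<close> as a combination of the rank-one maps with its
    own matrix entries as coefficients.\<close>
  have expand: "mat f = (\<Sum>k\<in>{..<n} \<times> {..<m}. sc (mat f k) (\<Theta> (g k)))" if f: "f \<in> carrier H'" for f
  proof
    fix kl :: "nat \<times> nat"
    obtain k l where kl: "kl = (k, l)" by (cases kl)
    have sum_apply: "(\<Sum>k\<in>I. F k) kl = (\<Sum>k\<in>I. F k kl)" for F :: "nat \<times> nat \<Rightarrow> nat \<times> nat \<Rightarrow> 'k fls" and I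
      by (induction I rule: infinite_finite_induct) auto
    show "mat f kl = (\<Sum>k\<in>{..<n} \<times> {..<m}. sc (mat f k) (\<Theta> (g k))) kl"
    proof (cases "k < n \<and> l < m")
      case True
      then have k: "k < n" and l: "l < m" by auto
      have f': "f \<in> lin_maps A (ext M) (ext N)" using f by (simp add: cH')
      have "mat f kl = t' k (f (pure M 1 (x l)))" using k l by (simp add: kl mat_def)
      also have "\<dots> = (\<Sum>j<m. s' j (pure M 1 (x l)) * t' k (f (pure M 1 (x j))))"
        by (rule functional_expand[OF M'.module_axioms s', where u = "\<lambda>z. t' k (f z)"])
           (use k l x f in \<open>auto simp: lin_maps_add[OF f'] lin_maps_smult[OF f'] cl' t'_simps\<close>)
      also have "\<dots> = (\<Sum>j<m. s j (x l) * (\<Sum>i<n. t' i (f (pure M 1 (x j))) * t k (y i)))"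
      proof (rule sum.cong[OF refl])
        fix j assume j: "j \<in> {..<m}"
        have "t' k (f (pure M 1 (x j))) = (\<Sum>i<n. t' i (f (pure M 1 (x j))) * t' k (pure N 1 (y i)))"
          by (rule functional_expand[OF N'.module_axioms t'])
             (use k j x f in \<open>auto simp: cl' t'_simps\<close>)
        also have "\<dots> = (\<Sum>i<n. t' i (f (pure M 1 (x j))) * t k (y i))"
          using k y by (intro sum.cong refl) (simp add: t't)
        finally show "s' j (pure M 1 (x l)) * t' k (f (pure M 1 (x j))) =
            s j (x l) * (\<Sum>i<n. t' i (f (pure M 1 (x j))) * t k (y i))"
          using j l x by (simp add: s's)
      qed
      also have "\<dots> = (\<Sum>j<m. \<Sum>i<n. mat f (i, j) * \<Theta> (g (i, j)) (k, l))"
        unfolding sum_distrib_left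
        by (intro sum.cong refl) (use k l in \<open>simp add: \<Theta>g mat_def mult_ac\<close>)
      also have "\<dots> = (\<Sum>i<n. \<Sum>j<m. mat f (i, j) * \<Theta> (g (i, j)) (k, l))" by (rule sum.swap)
      also have "\<dots> = (\<Sum>(i, j)\<in>{..<n} \<times> {..<m}. mat f (i, j) * \<Theta> (g (i, j)) (k, l))"
        by (rule sum.cartesian_product)
      finally show ?thesis unfolding sum_apply by (simp add: sc_def kl case_prod_unfold)
    next
      case False
      then have "mat h kl = 0" for h by (auto simp: kl mat_def)
      then show ?thesis unfolding sum_apply by (simp add: sc_def \<Theta>_def)
    qed
  qed
  interpret L: laurent_connection sc V VR "\<Theta> ` g ` ({..<n} \<times> {..<m})" nab
  proof unfold_locales
    show "V.subspace V"
      unfolding V.subspace_def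
    proof (intro conjI ballI allI)
      have "mat \<zero>\<^bsub>H'\<^esub> = 0" using mat_add[of "\<zero>\<^bsub>H'\<^esub>" "\<zero>\<^bsub>H'\<^esub>"] by simp
      then show "0 \<in> V" unfolding V_def by (metis H'.M.zero_closed image_eqI)
      show "v + w \<in> V" if "v \<in> V" "w \<in> V" for v w
        using that by (auto simp: V_def mat_add[symmetric])
      show "sc a v \<in> V" if "v \<in> V" for a v
        using that by (auto simp: V_def mat_smult[symmetric] H'.smult_closed[simplified])
    qed
    show "nab v \<in> V" if "v \<in> V" for v
      using that nabla_closed[OF dH'] by (auto simp: V_def nab_mat)
    show "nab (v + w) = nab v + nab w" if "v \<in> V" "w \<in> V" for v w
    proof -
      from that obtain f h where fh: "f \<in> carrier H'" "v = mat f" "h \<in> carrier H'" "w = mat h" by (auto simp: V_def)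
      then have "nab (v + w) = mat (nabla H' (f \<oplus>\<^bsub>H'\<^esub> h))" by (simp add: mat_add[symmetric] nab_mat)
      also have "\<dots> = nab v + nab w" using fh nabla_closed[OF dH'] by (simp add: nabla_add[OF dH'] mat_add nab_mat)
      finally show ?thesis .
    qed
    show "nab (sc a v) = sc (?D a) v + sc a (nab v)" if "v \<in> V" for a v
    proof -
      from that obtain f where f: "f \<in> carrier H'" "v = mat f" by (auto simp: V_def)
      have "a \<odot>\<^bsub>H'\<^esub> f \<in> carrier H'" "?D a \<odot>\<^bsub>H'\<^esub> f \<in> carrier H'" "nabla H' f \<in> carrier H'"
        "a \<odot>\<^bsub>H'\<^esub> nabla H' f \<in> carrier H'"
        using f nabla_closed[OF dH'] H'.smult_closed[simplified] by auto
      then have "nab (sc a v) = mat (?D a \<odot>\<^bsub>H'\<^esub> f \<oplus>\<^bsub>H'\<^esub> a \<odot>\<^bsub>H'\<^esub> nabla H' f)"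
        using f nabla_smult[OF dH', of a f] by (simp add: mat_smult[symmetric] nab_mat)
      also have "\<dots> = sc (?D a) v + sc a (nab v)"
        using f \<open>?D a \<odot>\<^bsub>H'\<^esub> f \<in> carrier H'\<close> \<open>a \<odot>\<^bsub>H'\<^esub> nabla H' f \<in> carrier H'\<close> \<open>nabla H' f \<in> carrier H'\<close>
        by (simp add: mat_add mat_smult nab_mat)
      finally show ?thesis .
    qed
    show "VR \<subseteq> V" using ext_H' by (auto simp: VR_def V_def \<Theta>_def)
    have "\<Theta> \<zero>\<^bsub>H\<^esub> = 0" using \<Theta>_add[of "\<zero>\<^bsub>H\<^esub>" "\<zero>\<^bsub>H\<^esub>"] by simp
    then show "0 \<in> VR" unfolding VR_def by (metis H.M.zero_closed image_eqI)
    show "v + w \<in> VR" if "v \<in> VR" "w \<in> VR" for v w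
      using that by (auto simp: VR_def \<Theta>_add[symmetric])
    show "sc (fls_const c * fls_X_intpow j) v \<in> VR" if "v \<in> VR" for c j v
      using that monomial[of c j] H.smult_closed[of "fls_const c * fls_X_intpow j"]
      by (auto simp: VR_def \<Theta>_smult[OF monomial, symmetric])
    show "nab v \<in> VR" if "v \<in> VR" for v
      using that nabla_closed[OF dH] by (auto simp: VR_def \<Theta>_nabla)
    show "finite (\<Theta> ` g ` ({..<n} \<times> {..<m}))" by simp
    show "\<Theta> ` g ` ({..<n} \<times> {..<m}) \<subseteq> VR" using g by (auto simp: VR_def)
    show "V \<subseteq> V.span (\<Theta> ` g ` ({..<n} \<times> {..<m}))"
    proof
      fix v assume "v \<in> V"
      then obtain f where f: "f \<in> carrier H'" "v = mat f" by (auto simp: V_def)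
      have "v = (\<Sum>k\<in>{..<n} \<times> {..<m}. sc (mat f k) (\<Theta> (g k)))" unfolding f(2) by (rule expand[OF f(1)])
      also have "\<dots> \<in> V.span (\<Theta> ` g ` ({..<n} \<times> {..<m}))"
        by (intro V.span_sum V.span_scale V.span_base) auto
      finally show "v \<in> V.span (\<Theta> ` g ` ({..<n} \<times> {..<m}))" .
    qed
  qed
  obtain p :: nat and \<kappa> c where \<kappa>: "\<And>j. j < p \<Longrightarrow> \<kappa> j \<in> carrier H \<and> nabla H (\<kappa> j) = \<zero>\<^bsub>H\<^esub>"
    and indep: "\<And>\<mu>. (\<Sum>j<p. sc (fls_const (\<mu> j)) (\<Theta> (\<kappa> j))) = 0 \<Longrightarrow> \<forall>j<p. \<mu> j = 0"
    and c: "\<And>j. j < p \<Longrightarrow> c j \<in> carrier H"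
    and gen: "\<And>f. f \<in> carrier H \<Longrightarrow>
      \<exists>\<mu>. \<exists>h\<in>carrier H. \<Theta> f = (\<Sum>j<p. sc (fls_const (\<mu> j)) (\<Theta> (c j))) + \<Theta> (nabla H h)"
  proof (rule euler_characteristic_zero[OF dH const])
    show "finite_dim_dR H" "chi_dR H = 0" using fd chi by (simp_all add: H_def)
    show "inj_on \<Theta> (carrier H)" by (rule \<Theta>_inj)
    show "\<Theta> (f \<oplus>\<^bsub>H\<^esub> h) = \<Theta> f + \<Theta> h" if "f \<in> carrier H" "h \<in> carrier H" for f h
      using that by (rule \<Theta>_add)
    show "\<Theta> (fls_const c \<odot>\<^bsub>H\<^esub> f) = (\<lambda>c. sc (fls_const c)) c (\<Theta> f)" if "f \<in> carrier H" for c f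
      using \<Theta>_smult[OF const that] by simp
  next
    fix p :: nat and \<kappa> c
    assume *: "\<And>j. j < p \<Longrightarrow> \<kappa> j \<in> carrier H \<and> nabla H (\<kappa> j) = \<zero>\<^bsub>H\<^esub>"
      "\<And>\<mu>. (\<Sum>j<p. (\<lambda>c. sc (fls_const c)) (\<mu> j) (\<Theta> (\<kappa> j))) = 0 \<Longrightarrow> \<forall>j<p. \<mu> j = 0"
      "\<And>j. j < p \<Longrightarrow> c j \<in> carrier H"
      "\<And>f. f \<in> carrier H \<Longrightarrow>
        \<exists>\<mu>. \<exists>h\<in>carrier H. \<Theta> f = (\<Sum>j<p. (\<lambda>c. sc (fls_const c)) (\<mu> j) (\<Theta> (c j))) + \<Theta> (nabla H h)"
    show thesis by (rule that[OF *])
  qed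
  have \<Theta>0: "\<Theta> \<zero>\<^bsub>H\<^esub> = 0" using \<Theta>_add[of "\<zero>\<^bsub>H\<^esub>" "\<zero>\<^bsub>H\<^esub>"] by simp
  have cmp1: "\<Theta> (\<kappa> j) \<in> VR" if "j < p" for j using \<kappa>[OF that] by (auto simp: VR_def)
  have cmp2: "nab (\<Theta> (\<kappa> j)) = 0" if "j < p" for j using \<kappa>[OF that] by (simp add: \<Theta>_nabla \<Theta>0)
  have cmp3: "\<Theta> (c j) \<in> VR" if "j < p" for j using c[OF that] by (auto simp: VR_def)
  have cmp4: "\<exists>\<mu>. \<exists>h\<in>VR. v = (\<Sum>j<p. sc (fls_const (\<mu> j)) (\<Theta> (c j))) + nab h" if "v \<in> VR" for v
  proof -
    from that obtain f where f: "f \<in> carrier H" "v = \<Theta> f" by (auto simp: VR_def)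
    from gen[OF f(1)] obtain \<mu> h where "h \<in> carrier H"
      "\<Theta> f = (\<Sum>j<p. sc (fls_const (\<mu> j)) (\<Theta> (c j))) + \<Theta> (nabla H h)" by blast
    then show ?thesis using f by (intro exI[of _ \<mu>] bexI[of _ "\<Theta> h"]) (auto simp: \<Theta>_nabla VR_def)
  qed
  note cmp = L.comparison[of p "\<lambda>j. \<Theta> (\<kappa> j)" "\<lambda>j. \<Theta> (c j)", OF cmp1 cmp2 indep cmp3 cmp4]
  have comparison: "v \<in> V \<Longrightarrow> nab v = 0 \<Longrightarrow> v \<in> VR"
    "v \<in> V \<Longrightarrow> nab v \<in> VR \<Longrightarrow> \<exists>z\<in>VR. nab z = nab v"
    "v \<in> V \<Longrightarrow> \<exists>z\<in>VR. \<exists>w\<in>V. v = z + nab w" for v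
    by (rule cmp; assumption)+
  have mat0: "mat \<zero>\<^bsub>H'\<^esub> = 0" using mat_add[of "\<zero>\<^bsub>H'\<^esub>" "\<zero>\<^bsub>H'\<^esub>"] by simp
  have hom_iff: "f \<in> dmod_hom R M N \<longleftrightarrow> f \<in> carrier H \<and> nabla H f = \<zero>\<^bsub>H\<^esub>" for f
    using dmod_hom_iff_conn[OF M N] by (simp add: H_def internal_hom_simps)
  have hom_iff': "f \<in> dmod_hom A (ext M) (ext N) \<longleftrightarrow> f \<in> carrier H' \<and> nabla H' f = \<zero>\<^bsub>H'\<^esub>" for f
    using dmod_hom_iff_conn[OF dM' dN'] by (simp add: H'_def internal_hom_simps)
  show "\<exists>f\<in>dmod_hom R M N. ext_hom M N f = g" if "g \<in> dmod_hom A (ext M) (ext N)" for g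
  proof -
    from that have g: "g \<in> carrier H'" "nabla H' g = \<zero>\<^bsub>H'\<^esub>" by (simp_all add: hom_iff')
    then have "mat g \<in> V" "nab (mat g) = 0" by (simp_all add: V_def nab_mat mat0)
    then have "mat g \<in> VR" by (rule comparison(1))
    then obtain f where f: "f \<in> carrier H" "mat g = \<Theta> f" by (auto simp: VR_def)
    then have fg: "g = ext_hom M N f" using mat_inj g ext_H' by (simp add: \<Theta>_def inj_on_def)
    \<comment> \<open>Horizontality descends to \<open>f\<close> because \<Theta> is injective and
      commutes with the connections.\<close>
    have "\<Theta> (nabla H f) = \<Theta> \<zero>\<^bsub>H\<^esub>" using \<Theta>_nabla[OF f(1)] f \<open>nab (mat g) = 0\<close> by (simp add: \<Theta>0)
    then have "nabla H f = \<zero>\<^bsub>H\<^esub>" using \<Theta>_inj nabla_closed[OF dH f(1)] by (simp add: inj_on_def)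
    with f fg show ?thesis by (auto simp: hom_iff)
  qed
  show "\<exists>\<psi>\<in>lin_maps R M N. f = conn R M N \<psi>"
    if f: "f \<in> lin_maps R M N" and g: "g \<in> lin_maps A (ext M) (ext N)" and eq: "ext_hom M N f = conn A (ext M) (ext N) g" for f g
  proof -
    have fH: "f \<in> carrier H" and gH: "g \<in> carrier H'" using f g by (simp_all add: cH cH')
    have "nab (mat g) = \<Theta> f" using nab_mat[OF gH] eq by (simp add: \<Theta>_def H'_def)
    then have "\<exists>z\<in>VR. nab z = nab (mat g)"
      using gH fH by (intro comparison(2)) (auto simp: V_def VR_def)
    then obtain \<psi> where \<psi>: "\<psi> \<in> carrier H" "nab (\<Theta> \<psi>) = \<Theta> f" using \<open>nab (mat g) = \<Theta> f\<close> by (auto simp: VR_def)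
    then have "f = nabla H \<psi>" using \<Theta>_inj fH nabla_closed[OF dH \<psi>(1)] by (simp add: \<Theta>_nabla inj_on_def)
    then have "f = conn R M N \<psi>" unfolding H_def .
    then show ?thesis using \<psi>(1)[unfolded cH] by (rule bexI)
  qed
  show "\<exists>f\<in>lin_maps R M N. \<exists>\<psi>\<in>lin_maps A (ext M) (ext N).
      g = ext_hom M N f \<oplus>\<^bsub>internal_hom A (ext M) (ext N)\<^esub> conn A (ext M) (ext N) \<psi>"
    if "g \<in> lin_maps A (ext M) (ext N)" for g
  proof -
    have gH: "g \<in> carrier H'" using that by (simp add: cH')
    then have "\<exists>z\<in>VR. \<exists>w\<in>V. mat g = z + nab w" by (intro comparison(3)) (simp add: V_def)
    then obtain f \<psi> where f: "f \<in> carrier H" and \<psi>: "\<psi> \<in> carrier H'" and "mat g = \<Theta> f + nab (mat \<psi>)"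
      by (auto simp: VR_def V_def)
    then have "mat g = mat (ext_hom M N f \<oplus>\<^bsub>H'\<^esub> nabla H' \<psi>)"
      using ext_H'[OF f] nabla_closed[OF dH' \<psi>] by (simp add: \<Theta>_def nab_mat mat_add)
    then have "g = ext_hom M N f \<oplus>\<^bsub>H'\<^esub> nabla H' \<psi>"
      using mat_inj gH ext_H'[OF f] nabla_closed[OF dH' \<psi>] by (simp add: inj_on_def)
    then show ?thesis unfolding H'_def using f[unfolded cH] \<psi>[unfolded cH'] by blast
  qed
qed

end

section \<open>Extension groups\<close>

text \<open>The Yoneda class indexed by a linear map rather than by a chosen extension; this is how
  an element of the cokernel of the connection on Hom is turned into an element of the extension
  group.\<close>

definition cocycle_class ::
  "'r ring \<Rightarrow> ('r \<Rightarrow> 'r) \<Rightarrow> ('r, 'm) dmodule \<Rightarrow> ('r, 'n) dmodule \<Rightarrow> ('m \<Rightarrow> 'n) \<Rightarrow>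
   ('r, 'n, 'n \<times> 'm, 'm) extension set" where
  "cocycle_class R d M N \<phi> = {x \<in> extensions R d M N. cocycle R M x \<phi>}"

text \<open>Being equivalent to an extension amounts to admitting one of its cocycles. The middle
  term on the left may have any type, which covers Baer sums and scalar extensions.\<close>

lemma ext_class_eq:
  assumes x: "short_exact R d N E M i p" "cocycle R M (E, i, p) \<phi>" and \<phi>: "\<phi> \<in> lin_maps R M N"
  shows "ext_class R d M N (E, i, p) = cocycle_class R d M N \<phi>"
  using ext_equiv_iff_cocycle[OF x(1) _ x(2) \<phi>]
  by (auto simp: ext_class_def cocycle_class_def extensions_def)

context
  fixes R :: "'r ring" and d :: "'r \<Rightarrow> 'r" and M :: "('r, 'm) dmodule" and N :: "('r, 'n) dmodule"
  assumes M: "dmod R d M" and N: "dmod R d N" and d: "d \<in> carrier R \<rightarrow> carrier R"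
begin

lemma twistE:
  assumes "\<phi> \<in> lin_maps R M N"
  obtains E :: "('r, 'n \<times> 'm) dmodule" and i p
  where "twist M N \<phi> = (E, i, p)" "short_exact R d N E M i p" "cocycle R M (E, i, p) \<phi>"
  using twist_short_exact[OF M N assms d] by (cases "twist M N \<phi>") auto

text \<open>The cocycles of a single extension form one coset of the image of the connection; the
  twisted product provides an extension in which \<phi> and \<phi>' can be compared.\<close>

lemma cocycle_class_eq_iff:
  assumes \<phi>: "\<phi> \<in> lin_maps R M N" "\<phi>' \<in> lin_maps R M N"
  shows "cocycle_class R d M N \<phi> = cocycle_class R d M N \<phi>' \<longleftrightarrow>
    (\<exists>\<psi>\<in>lin_maps R M N. \<forall>y\<in>carrier M. \<phi>' y = \<phi> y \<oplus>\<^bsub>N\<^esub> conn R M N \<psi> y)"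
proof -
  obtain E :: "('r, 'n \<times> 'm) dmodule" and i p where x: "short_exact R d N E M i p" "cocycle R M (E, i, p) \<phi>"
    by (rule twistE[OF \<phi>(1)])
  interpret short_exact_sequence R d N E M i p by unfold_locales (rule x)
  show ?thesis unfolding cocycle_iff[OF x(2) \<phi>, symmetric]
  proof
    assume "cocycle_class R d M N \<phi> = cocycle_class R d M N \<phi>'"
    moreover have "(E, i, p) \<in> cocycle_class R d M N \<phi>" using x by (simp add: cocycle_class_def extensions_def)
    ultimately show "cocycle R M (E, i, p) \<phi>'" by (simp add: cocycle_class_def)
  next
    assume "cocycle R M (E, i, p) \<phi>'"
    then show "cocycle_class R d M N \<phi> = cocycle_class R d M N \<phi>'"
      using ext_class_eq[OF x \<phi>(1)] ext_class_eq[OF x(1) _ \<phi>(2)] by simp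
  qed
qed

text \<open>The product in \<open>Ext\<close> is a union over representatives and collapses to a
  single class only if there are representatives.\<close>

lemma cocycle_class_nonempty: "\<phi> \<in> lin_maps R M N \<Longrightarrow> cocycle_class R d M N \<phi> \<noteq> {}"
  by (rule twistE) (auto simp: cocycle_class_def extensions_def)

text \<open>Projectivity of \<open>M\<close> provides linear sections and hence a cocycle for each
  extension; twisted products realise every linear map.\<close>

lemma Ext_carrier:
  assumes db: "dual_basis R M n x s"
  shows "carrier (Ext R d M N) = cocycle_class R d M N ` lin_maps R M N"
proof (intro equalityI subsetI)
  fix X assume "X \<in> carrier (Ext R d M N)"
  then obtain E :: "('r, 'n \<times> 'm) dmodule" and i p where X: "X = ext_class R d M N (E, i, p)" and x: "short_exact R d N E M i p"
    by (auto simp: Ext_def extensions_def)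
  interpret short_exact_sequence R d N E M i p by unfold_locales (rule x)
  obtain \<phi> where "\<phi> \<in> lin_maps R M N" "cocycle R M (E, i, p) \<phi>"
    by (rule cocycle_exists[OF db d])
  then show "X \<in> cocycle_class R d M N ` lin_maps R M N"
    unfolding X using ext_class_eq[OF x] by blast
next
  fix X assume "X \<in> cocycle_class R d M N ` lin_maps R M N"
  then obtain \<phi> where \<phi>: "\<phi> \<in> lin_maps R M N" "X = cocycle_class R d M N \<phi>" by blast
  obtain E :: "('r, 'n \<times> 'm) dmodule" and i p where x: "short_exact R d N E M i p" "cocycle R M (E, i, p) \<phi>"
    by (rule twistE[OF \<phi>(1)])
  have "X = ext_class R d M N (E, i, p)" unfolding \<phi>(2) by (rule ext_class_eq[OF x \<phi>(1), symmetric])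
  moreover have "(E, i, p) \<in> extensions R d M N" using x by (simp add: extensions_def)
  ultimately show "X \<in> carrier (Ext R d M N)" by (simp add: Ext_def)
qed

text \<open>All Baer sums of representatives share the cocycle \<open>\<phi>\<close> plus
  \<open>\<phi>'\<close>, so the union runs over copies of one class.\<close>

lemma Ext_mult:
  assumes \<phi>: "\<phi> \<in> lin_maps R M N" "\<phi>' \<in> lin_maps R M N"
  shows "cocycle_class R d M N \<phi> \<otimes>\<^bsub>Ext R d M N\<^esub> cocycle_class R d M N \<phi>' =
    cocycle_class R d M N (\<phi> \<oplus>\<^bsub>internal_hom R M N\<^esub> \<phi>')"
proof -
  have "ext_class R d M N (baer_sum M N x y) = cocycle_class R d M N (\<phi> \<oplus>\<^bsub>internal_hom R M N\<^esub> \<phi>')"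
    if "x \<in> cocycle_class R d M N \<phi>" "y \<in> cocycle_class R d M N \<phi>'" for x y
  proof -
    obtain E i p where x: "x = (E, i, p)" by (cases x) auto
    obtain E' i' p' where y: "y = (E', i', p')" by (cases y) auto
    obtain B j q where B: "baer_sum M N x y = (B, j, q)" by (cases "baer_sum M N x y") auto
    from baer_sum_cocycle[of R d N E M i p \<phi> E' i' p' \<phi>', OF _ _ _ _ \<phi> d] that B
    have "short_exact R d N B M j q" "cocycle R M (B, j, q) (\<phi> \<oplus>\<^bsub>internal_hom R M N\<^esub> \<phi>')"
      by (simp_all add: x y cocycle_class_def extensions_def internal_hom_simps)
    then show ?thesis unfolding B
      using lin_maps_plus[OF \<phi> dmod_module[OF M] dmod_module[OF N]]
      by (intro ext_class_eq) (simp_all add: internal_hom_simps)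
  qed
  then have "(\<Union>x\<in>cocycle_class R d M N \<phi>. \<Union>y\<in>cocycle_class R d M N \<phi>'. ext_class R d M N (baer_sum M N x y)) =
      (\<Union>x\<in>cocycle_class R d M N \<phi>. \<Union>y\<in>cocycle_class R d M N \<phi>'. cocycle_class R d M N (\<phi> \<oplus>\<^bsub>internal_hom R M N\<^esub> \<phi>'))"
    by (intro SUP_cong refl)
  also have "\<dots> = cocycle_class R d M N (\<phi> \<oplus>\<^bsub>internal_hom R M N\<^esub> \<phi>')"
    using cocycle_class_nonempty[OF \<phi>(1)] cocycle_class_nonempty[OF \<phi>(2)] by auto
  finally show ?thesis by (simp add: Ext_def)
qed

end

section \<open>Scalar extension of extensions\<close>

context scalar_extension
begin

lemma ext_hom_dmod_hom:
  assumes M: "dmod R d M" and N: "dmod R d N" and f: "f \<in> dmod_hom R M N"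
  shows "ext_hom M N f \<in> dmod_hom A (ext M) (ext N)"
proof -
  note f = dmod_homD[OF f]
  note lin = ext_hom_lin[OF M N f(1)]
  have "ext_hom M N f (nabla (ext M) X) = nabla (ext N) (ext_hom M N f X)" if "X \<in> carrier (ext M)" for X
    using that
  proof (induction rule: ext_induct[OF M, consumes 1, case_names pure add])
    case (pure a x)
    then show ?case
      by (simp add: nabla_pure[OF M] nabla_pure[OF N] lin_maps_add[OF lin] pure_closed[OF M] nabla_closed[OF M]
          ext_hom_pure[OF M N f(1)] f(2))
  next
    case (add X Y)
    then show ?case
      by (simp add: nabla_add[OF dmod_ext[OF M]] nabla_add[OF dmod_ext[OF N]] lin_maps_add[OF lin]
          nabla_closed[OF dmod_ext[OF M]] lin_maps_closed[OF lin])
  qed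
  with lin show ?thesis by (simp add: dmod_hom_def)
qed

text \<open>The linear section and the retraction extend to the tensor products, and a linearly
  split sequence stays exact. The cocycle is extended along with them.\<close>

lemma ext_short_exact:
  assumes x: "short_exact R d N E M i p" "cocycle R M (E, i, p) \<phi>" and \<phi>: "\<phi> \<in> lin_maps R M N"
  shows "short_exact A d (ext N) (ext E) (ext M) (ext_hom N E i) (ext_hom E M p)"
    and "cocycle A (ext M) (ext E, ext_hom N E i, ext_hom E M p) (ext_hom M N \<phi>)"
proof -
  interpret short_exact_sequence R d N E M i p by unfold_locales (rule x)
  from x(2) obtain \<sigma> where \<sigma>: "\<sigma> \<in> lin_maps R M E" and p\<sigma>: "\<And>y. y \<in> carrier M \<Longrightarrow> p (\<sigma> y) = y"
    and n\<sigma>: "\<And>y. y \<in> carrier M \<Longrightarrow> nabla E (\<sigma> y) = i (\<phi> y) \<oplus>\<^bsub>E\<^esub> \<sigma> (nabla M y)"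
    unfolding cocycle_def by auto
  obtain \<rho> where \<rho>: "\<rho> \<in> lin_maps R E N" "\<And>e. e \<in> carrier E \<Longrightarrow> e = i (\<rho> e) \<oplus>\<^bsub>E\<^esub> \<sigma> (p e)"
    "\<And>x. x \<in> carrier N \<Longrightarrow> \<rho> (i x) = x"
  proof (rule section_retraction[OF \<sigma> p\<sigma>])
    fix \<rho> assume *: "\<rho> \<in> lin_maps R E N" "\<And>e. e \<in> carrier E \<Longrightarrow> e = i (\<rho> e) \<oplus>\<^bsub>E\<^esub> \<sigma> (p e)"
      "\<And>x. x \<in> carrier N \<Longrightarrow> \<rho> (i x) = x"
    show thesis by (rule that[OF *])
  qed
  note D = dmods(1) dmods(2) dmods(3)
  note D' = dmod_ext[OF D(1)] dmod_ext[OF D(2)] dmod_ext[OF D(3)]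
  interpret N': Module.module A "ext N" by (rule dmod_module[OF D'(1)])
  interpret E': Module.module A "ext E" by (rule dmod_module[OF D'(2)])
  interpret M': Module.module A "ext M" by (rule dmod_module[OF D'(3)])
  let ?i = "ext_hom N E i" and ?p = "ext_hom E M p" and ?\<sigma> = "ext_hom M E \<sigma>" and ?\<rho> = "ext_hom E N \<rho>"
    and ?\<phi> = "ext_hom M N \<phi>"
  note lin = ext_hom_lin[OF D(1,2) i_lin] ext_hom_lin[OF D(2,3) p_lin] ext_hom_lin[OF D(3,2) \<sigma>]
    ext_hom_lin[OF D(2,1) \<rho>(1)] ext_hom_lin[OF D(3,1) \<phi>]
  note pures = ext_hom_pure[OF D(1,2) i_lin] ext_hom_pure[OF D(2,3) p_lin] ext_hom_pure[OF D(3,2) \<sigma>]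
    ext_hom_pure[OF D(2,1) \<rho>(1)] ext_hom_pure[OF D(3,1) \<phi>]
    pure_closed[OF D(1)] pure_closed[OF D(2)] pure_closed[OF D(3)]
  note cl = i_simps(1) p_simps(1) lin_maps_closed[OF \<sigma>] lin_maps_closed[OF \<rho>(1)] lin_maps_closed[OF \<phi>]
  note lins = lin_maps_closed[OF lin(1)] lin_maps_closed[OF lin(2)] lin_maps_closed[OF lin(3)]
    lin_maps_closed[OF lin(4)] lin_maps_closed[OF lin(5)]
    lin_maps_add[OF lin(1)] lin_maps_add[OF lin(2)] lin_maps_add[OF lin(3)]
    lin_maps_add[OF lin(4)] lin_maps_add[OF lin(5)]
  have pure_0: "pure M a \<zero>\<^bsub>M\<^esub> = \<zero>\<^bsub>ext M\<^esub>" for a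
    by (rule add_hom_zero[OF dmod_abelian_group[OF D(3)] dmod_abelian_group[OF D'(3)] pure_add_hom[OF D(3)]])
  have pi: "?p (?i X) = \<zero>\<^bsub>ext M\<^esub>" if "X \<in> carrier (ext N)" for X
    using that
    by (induction rule: ext_induct[OF D(1), consumes 1, case_names pure add]) (simp_all add: pures lins cl p_i pure_0)
  have \<rho>i: "?\<rho> (?i X) = X" if "X \<in> carrier (ext N)" for X
    using that
    by (induction rule: ext_induct[OF D(1), consumes 1, case_names pure add]) (simp_all add: pures lins cl \<rho>(3))
  have p\<sigma>': "?p (?\<sigma> X) = X" if "X \<in> carrier (ext M)" for X
    using that
    by (induction rule: ext_induct[OF D(3), consumes 1, case_names pure add]) (simp_all add: pures lins cl p\<sigma>)
  have dec: "X = ?i (?\<rho> X) \<oplus>\<^bsub>ext E\<^esub> ?\<sigma> (?p X)" if "X \<in> carrier (ext E)" for X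
    using that
  proof (induction rule: ext_induct[OF D(2), consumes 1, case_names pure add])
    case (pure a e)
    have "pure E a e = pure E a (i (\<rho> e) \<oplus>\<^bsub>E\<^esub> \<sigma> (p e))" by (rule arg_cong[OF \<rho>(2)[OF pure]])
    also have "\<dots> = pure E a (i (\<rho> e)) \<oplus>\<^bsub>ext E\<^esub> pure E a (\<sigma> (p e))"
      using pure by (simp add: pure_add_right[OF D(2)] cl)
    also have "\<dots> = ?i (?\<rho> (pure E a e)) \<oplus>\<^bsub>ext E\<^esub> ?\<sigma> (?p (pure E a e))"
      using pure by (simp add: pures cl)
    finally show ?case .
  next
    case (add X Y)
    have "X \<oplus>\<^bsub>ext E\<^esub> Y = (?i (?\<rho> X) \<oplus>\<^bsub>ext E\<^esub> ?\<sigma> (?p X)) \<oplus>\<^bsub>ext E\<^esub> (?i (?\<rho> Y) \<oplus>\<^bsub>ext E\<^esub> ?\<sigma> (?p Y))"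
      using add(3,4) by simp
    also have "\<dots> = ?i (?\<rho> (X \<oplus>\<^bsub>ext E\<^esub> Y)) \<oplus>\<^bsub>ext E\<^esub> ?\<sigma> (?p (X \<oplus>\<^bsub>ext E\<^esub> Y))"
      using add(1,2) by (simp add: lins E'.a_ac)
    finally show ?case .
  qed
  show "short_exact A d (ext N) (ext E) (ext M) ?i ?p"
    unfolding short_exact_def
  proof (intro conjI D' ext_hom_dmod_hom[OF D(1,2) i_hom] ext_hom_dmod_hom[OF D(2,3) p_hom])
    show "inj_on ?i (carrier (ext N))" by (rule inj_on_inverseI[of _ ?\<rho>]) (rule \<rho>i)
    show "?i ` carrier (ext N) = {e \<in> carrier (ext E). ?p e = \<zero>\<^bsub>ext M\<^esub>}"
    proof (intro equalityI subsetI)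
      fix X assume "X \<in> {e \<in> carrier (ext E). ?p e = \<zero>\<^bsub>ext M\<^esub>}"
      then have X: "X \<in> carrier (ext E)" "?p X = \<zero>\<^bsub>ext M\<^esub>" by auto
      have "?\<sigma> \<zero>\<^bsub>ext M\<^esub> = \<zero>\<^bsub>ext E\<^esub>" by (rule lin_maps_zero[OF M'.module_axioms E'.module_axioms lin(3)])
      then have "X = ?i (?\<rho> X)" using dec[OF X(1)] X by (simp add: lins)
      then show "X \<in> ?i ` carrier (ext N)" using X lins(4) by blast
    qed (auto simp: lins pi)
    show "?p ` carrier (ext E) = carrier (ext M)"
    proof (intro equalityI subsetI)
      fix X assume "X \<in> carrier (ext M)"
      then show "X \<in> ?p ` carrier (ext E)" using p\<sigma>'[of X] lins(3)[of X] by (metis image_eqI)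
    qed (auto simp: lins)
  qed
  have n\<sigma>': "nabla (ext E) (?\<sigma> X) = ?i (?\<phi> X) \<oplus>\<^bsub>ext E\<^esub> ?\<sigma> (nabla (ext M) X)" if "X \<in> carrier (ext M)" for X
    using that
  proof (induction rule: ext_induct[OF D(3), consumes 1, case_names pure add])
    case (pure a y)
    then show ?case
      by (simp add: pures cl nabla_pure[OF D(2)] nabla_pure[OF D(3)] n\<sigma> pure_add_right[OF D(2)] lins
          nabla_closed[OF D(3)] E'.a_ac)
  next
    case (add X Y)
    then show ?case
      by (simp add: lins nabla_add[OF D'(2)] nabla_add[OF D'(3)] nabla_closed[OF D'(3)] E'.a_ac)
  qed
  show "cocycle A (ext M) (ext E, ?i, ?p) ?\<phi>"
    unfolding cocycle_def prod.case by (rule bexI[OF _ lin(3)]) (simp add: p\<sigma>' n\<sigma>')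
qed

text \<open>A class depends only on its cocycle, so on extension groups scalar extension is the map
  that \<open>ext_hom\<close> induces on the cokernels of the connections.\<close>

lemma ext_base_change_class:
  assumes M: "dmod R d M" and N: "dmod R d N" and \<phi>: "\<phi> \<in> lin_maps R M N"
  shows "ext_base_change A R d M N (cocycle_class R d M N \<phi>) =
    cocycle_class A d (ext M) (ext N) (ext_hom M N \<phi>)"
proof -
  have "ext_class A d (ext M) (ext N) (ext E, ext_hom N E i, ext_hom E M p) =
      cocycle_class A d (ext M) (ext N) (ext_hom M N \<phi>)"
    if "(E, i, p) \<in> cocycle_class R d M N \<phi>" for E i p
    using that ext_short_exact[OF _ _ \<phi>] ext_hom_lin[OF M N \<phi>]
    by (intro ext_class_eq) (auto simp: cocycle_class_def extensions_def)
  then have "ext_base_change A R d M N (cocycle_class R d M N \<phi>) =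
      (\<Union>x\<in>cocycle_class R d M N \<phi>. cocycle_class A d (ext M) (ext N) (ext_hom M N \<phi>))"
    unfolding ext_base_change_def by (intro SUP_cong refl) (auto split: prod.split)
  then show ?thesis using cocycle_class_nonempty[OF M N d_funcset(1) \<phi>] by simp
qed

end

section \<open>Transport of structure\<close>

text \<open>The structure of the middle term is carried along an injection \<open>g\<close> into
  another type, with the same cocycle. This is needed because a twisted product lives on a product
  type, whereas the category is a set of modules over one type.\<close>

lemma short_exact_transport:
  fixes R :: "'r ring" and E :: "('r, 'e) dmodule" and g :: "'e \<Rightarrow> 'f"
    and N :: "('r, 'n) dmodule" and M :: "('r, 'm) dmodule"
  assumes x: "short_exact R d N E M i p" "cocycle R M (E, i, p) \<phi>" and g: "inj_on g (carrier E)"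
    and d: "d \<in> carrier R \<rightarrow> carrier R" and \<phi>: "\<phi> \<in> lin_maps R M N"
  obtains E' :: "('r, 'f) dmodule" and i' p' where "short_exact R d N E' M i' p'" "cocycle R M (E', i', p') \<phi>"
proof -
  interpret short_exact_sequence R d N E M i p by unfold_locales (rule x)
  define k where "k = inv_into (carrier E) g"
  define E' :: "('r, 'f) dmodule" where "E' = \<lparr>carrier = g ` carrier E, monoid.mult = undefined, one = undefined,
    ring.zero = g \<zero>\<^bsub>E\<^esub>, ring.add = (\<lambda>x y. g (k x \<oplus>\<^bsub>E\<^esub> k y)), module.smult = (\<lambda>a x. g (a \<odot>\<^bsub>E\<^esub> k x)),
    nabla = (\<lambda>x. g (nabla E (k x)))\<rparr>"
  have kg: "k (g e) = e" if "e \<in> carrier E" for e using that g by (simp add: k_def inv_into_f_f)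
  have E'_simps: "carrier E' = g ` carrier E" "\<zero>\<^bsub>E'\<^esub> = g \<zero>\<^bsub>E\<^esub>" "x \<oplus>\<^bsub>E'\<^esub> y = g (k x \<oplus>\<^bsub>E\<^esub> k y)"
    "a \<odot>\<^bsub>E'\<^esub> x = g (a \<odot>\<^bsub>E\<^esub> k x)" "nabla E' x = g (nabla E (k x))" for x y a
    by (simp_all add: E'_def)
  have "abelian_group E'"
  proof (rule abelian_groupI)
    fix z assume "z \<in> carrier E'"
    then obtain e where "e \<in> carrier E" "z = g e" by (auto simp: E'_simps)
    then show "\<exists>y\<in>carrier E'. y \<oplus>\<^bsub>E'\<^esub> z = \<zero>\<^bsub>E'\<^esub>"
      by (intro bexI[of _ "g (\<ominus>\<^bsub>E\<^esub> e)"]) (auto simp: E'_simps kg E.l_neg)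
  qed (auto simp: E'_simps kg E.a_ac)
  then have E'_mod: "Module.module R E'"
    by (intro moduleI N.is_cring)
       (auto simp: E'_simps kg E.smult_l_distr E.smult_r_distr E.smult_assoc1)
  have dE': "dmod R d E'"
    unfolding dmod_def
  proof (intro conjI ballI funcsetI E'_mod)
    fix z assume "z \<in> carrier E'"
    then obtain e where e: "e \<in> carrier E" "z = g e" by (auto simp: E'_simps)
    then show "nabla E' z \<in> carrier E'" by (simp add: E'_simps kg nabla_simps)
    show "nabla E' (a \<odot>\<^bsub>E'\<^esub> z) = d a \<odot>\<^bsub>E'\<^esub> z \<oplus>\<^bsub>E'\<^esub> a \<odot>\<^bsub>E'\<^esub> nabla E' z" if a: "a \<in> carrier R" for a
      using e a funcset_mem[OF d a] by (simp add: E'_simps kg nabla_simps nabla_smult[OF dmods(2)])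
    fix w assume "w \<in> carrier E'"
    then obtain f where "f \<in> carrier E" "w = g f" by (auto simp: E'_simps)
    with e show "nabla E' (z \<oplus>\<^bsub>E'\<^esub> w) = nabla E' z \<oplus>\<^bsub>E'\<^esub> nabla E' w"
      by (simp add: E'_simps kg nabla_simps)
  qed
  define i' where "i' = (\<lambda>x\<in>carrier N. g (i x))"
  define p' where "p' = (\<lambda>z\<in>carrier E'. p (k z))"
  have i': "i' \<in> dmod_hom R N E'"
    unfolding dmod_hom_def i'_def
    using lin_mapsI[OF _ _ _ N.module_axioms, of "\<lambda>x. g (i x)" E']
    by (auto simp: E'_simps kg i_simps i_nabla nabla_simps)
  have p': "p' \<in> dmod_hom R E' M"
  proof -
    have "p' \<in> lin_maps R E' M"
      unfolding p'_def by (rule lin_mapsI[OF _ _ _ E'_mod]) (auto simp: E'_simps kg p_simps)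
    then show ?thesis unfolding dmod_hom_def by (auto simp: p'_def E'_simps kg p_nabla nabla_simps)
  qed
  have "short_exact R d N E' M i' p'"
    unfolding short_exact_def
  proof (intro conjI dmods dE' i' p')
    show "inj_on i' (carrier N)"
      using i_inj g i_simps(1) by (auto simp: i'_def inj_on_def)
    have "i' ` carrier N = g ` (i ` carrier N)" by (auto simp: i'_def)
    also have "\<dots> = {z \<in> carrier E'. p' z = \<zero>\<^bsub>M\<^esub>}"
      unfolding i_image by (auto simp: p'_def E'_simps kg inj_on_eq_iff[OF g])
    finally show "i' ` carrier N = {z \<in> carrier E'. p' z = \<zero>\<^bsub>M\<^esub>}" .
    have "p' ` carrier E' = p ` carrier E" by (force simp: p'_def E'_simps kg)
    then show "p' ` carrier E' = carrier M" by (simp add: p_image)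
  qed
  moreover
  from x(2) obtain \<sigma> where \<sigma>: "\<sigma> \<in> lin_maps R M E" and p\<sigma>: "\<And>y. y \<in> carrier M \<Longrightarrow> p (\<sigma> y) = y"
    and n\<sigma>: "\<And>y. y \<in> carrier M \<Longrightarrow> nabla E (\<sigma> y) = i (\<phi> y) \<oplus>\<^bsub>E\<^esub> \<sigma> (nabla M y)"
    unfolding cocycle_def by auto
  have "(\<lambda>y\<in>carrier M. g (\<sigma> y)) \<in> lin_maps R M E'"
    by (rule lin_mapsI[OF _ _ _ M.module_axioms])
       (simp_all add: E'_simps kg lin_maps_closed[OF \<sigma>] lin_maps_add[OF \<sigma>] lin_maps_smult[OF \<sigma>])
  then have "cocycle R M (E', i', p') \<phi>"
    unfolding cocycle_def prod.case
    by (rule bexI[rotated])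
       (use \<phi> in \<open>simp add: E'_simps kg p'_def i'_def lin_maps_closed[OF \<sigma>] lin_maps_closed[OF \<phi>] p\<sigma> n\<sigma>
         nabla_simps i_simps\<close>)
  ultimately show ?thesis by (rule that)
qed


lemma dmod_hom_inverse:
  assumes M: "dmod R d M" and N: "dmod R d N" and f: "f \<in> dmod_hom R M N" "bij_betw f (carrier M) (carrier N)"
  shows "(\<lambda>y\<in>carrier N. inv_into (carrier M) f y) \<in> dmod_hom R N M"
proof -
  interpret M: Module.module R M using M by (rule dmod_module)
  interpret N: Module.module R N using N by (rule dmod_module)
  let ?g = "inv_into (carrier M) f"
  note flin = dmod_homD(1)[OF f(1)] and fnab = dmod_homD(2)[OF f(1)]
  have g: "?g y \<in> carrier M" "f (?g y) = y" if "y \<in> carrier N" for y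
    using that f(2) by (auto simp: bij_betw_def inv_into_into f_inv_into_f)
  have eq: "?g y = x" if "x \<in> carrier M" "f x = y" for x y
    using that f(2) by (auto simp: bij_betw_def inv_into_f_f)
  have "(\<lambda>y\<in>carrier N. ?g y) \<in> lin_maps R N M"
    by (rule lin_mapsI[OF _ _ _ N.module_axioms])
       (auto simp: g lin_maps_add[OF flin] lin_maps_smult[OF flin] intro!: eq)
  moreover have "?g (nabla N y) = nabla M (?g y)" if "y \<in> carrier N" for y
    using that by (intro eq) (simp_all add: g nabla_closed[OF M] fnab)
  ultimately show ?thesis by (simp add: dmod_hom_def nabla_closed[OF N])
qed

lemma dmod_hom_compose:
  assumes M: "dmod R d M" and f: "f \<in> dmod_hom R M N" and g: "g \<in> dmod_hom R N P"
  shows "(\<lambda>x\<in>carrier M. g (f x)) \<in> dmod_hom R M P"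
  using lin_maps_compose[OF dmod_homD(1)[OF f] dmod_homD(1)[OF g] dmod_module[OF M]]
    dmod_homD(2)[OF f] dmod_homD(2)[OF g] lin_maps_closed[OF dmod_homD(1)[OF f]]
  by (simp add: dmod_hom_def nabla_closed[OF M])

lemma short_exact_iso:
  assumes x: "short_exact R d N E M i p" and N': "dmod R d N'" and M': "dmod R d M'"
    and a: "a \<in> dmod_hom R N' N" "bij_betw a (carrier N') (carrier N)"
    and b: "b \<in> dmod_hom R M M'" "bij_betw b (carrier M) (carrier M')"
  shows "short_exact R d N' E M' (\<lambda>x\<in>carrier N'. i (a x)) (\<lambda>e\<in>carrier E. b (p e))"
proof -
  interpret short_exact_sequence R d N E M i p by unfold_locales (rule x)
  have bz: "b y = \<zero>\<^bsub>M'\<^esub> \<longleftrightarrow> y = \<zero>\<^bsub>M\<^esub>" if "y \<in> carrier M" for y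
    using that b(2) lin_maps_zero[OF modules(3) dmod_module[OF M'] dmod_homD(1)[OF b(1)]]
    by (metis M.M.zero_closed bij_betw_imp_inj_on inj_onD)
  show ?thesis
    unfolding short_exact_def
  proof (intro conjI N' dmods M' dmod_hom_compose[OF N' a(1) i_hom] dmod_hom_compose[OF dmods(2) p_hom b(1)])
    show "inj_on (\<lambda>x\<in>carrier N'. i (a x)) (carrier N')"
    proof (rule inj_onI)
      fix x y assume xy: "x \<in> carrier N'" "y \<in> carrier N'"
        "(\<lambda>x\<in>carrier N'. i (a x)) x = (\<lambda>x\<in>carrier N'. i (a x)) y"
      have "a x = a y"
        by (rule inj_onD[OF i_inj]) (use xy lin_maps_closed[OF dmod_homD(1)[OF a(1)]] in simp_all)
      then show "x = y" using xy a(2) by (simp add: bij_betw_def inj_on_def)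
    qed
    have "(\<lambda>x\<in>carrier N'. i (a x)) ` carrier N' = i ` (a ` carrier N')" by auto
    also have "\<dots> = {e \<in> carrier E. p e = \<zero>\<^bsub>M\<^esub>}" using a(2) i_image by (simp add: bij_betw_def)
    also have "\<dots> = {e \<in> carrier E. (\<lambda>e\<in>carrier E. b (p e)) e = \<zero>\<^bsub>M'\<^esub>}"
      by (auto simp: bz p_simps(1))
    finally show "(\<lambda>x\<in>carrier N'. i (a x)) ` carrier N' = {e \<in> carrier E. (\<lambda>e\<in>carrier E. b (p e)) e = \<zero>\<^bsub>M'\<^esub>}" .
    have "(\<lambda>e\<in>carrier E. b (p e)) ` carrier E = b ` (p ` carrier E)" by auto
    then show "(\<lambda>e\<in>carrier E. b (p e)) ` carrier E = carrier M'" using b(2) p_image by (simp add: bij_betw_def)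
  qed
qed

text \<open>An infinite type absorbs its square. The other alternative is the case of zero modules,
  whose product has at most one element.\<close>

lemma ex_inj_on_Times:
  assumes "infinite (UNIV :: 'a set) \<or> (card X \<le> 1 \<and> card Y \<le> 1 \<and> finite X \<and> finite Y)"
  shows "\<exists>g :: 'a \<times> 'a \<Rightarrow> 'a. inj_on g (X \<times> Y)"
  using assms
proof
  assume "infinite (UNIV :: 'a set)"
  then have "|(UNIV :: 'a set) \<times> (UNIV :: 'a set)| =o |UNIV :: 'a set|" by (rule card_of_Times_same_infinite)
  then obtain g where "bij_betw g ((UNIV :: 'a set) \<times> (UNIV :: 'a set)) (UNIV :: 'a set)" unfolding card_of_ordIso[symmetric] by (elim exE) (rule that)
  then have "inj_on g (X \<times> Y)" by (auto simp: bij_betw_def intro: inj_on_subset)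
  then show ?thesis by blast
next
  assume *: "card X \<le> 1 \<and> card Y \<le> 1 \<and> finite X \<and> finite Y"
  have "inj_on fst (X \<times> Y)"
    using * by (auto simp: inj_on_def card_le_Suc0_iff_eq[simplified] dest: card_le_Suc0_iff_eq[THEN iffD1, rotated])
  then show ?thesis by blast
qed

section \<open>The ring of functions on the punctured disk\<close>

definition punctured_functions :: "('k::field \<Rightarrow> real) \<Rightarrow> ereal \<Rightarrow> 'k fls set" where
  "punctured_functions v r = {fps_to_fls f * fls_X_inv ^ n | f n. f \<in> disk_functions v r}"

lemma punctured_ring_eq: "punctured_ring v r = subring_of (punctured_functions v r)"
  by (simp add: punctured_ring_def punctured_functions_def subring_of_def)

text \<open>The ultrametric inequality bounds sums of ones by 1, and -1 has absolute value 1 because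
  its square is 1.\<close>

lemma complete_nonarch_abs_of_int:
  assumes v: "complete_nonarch_abs (v :: 'k::field \<Rightarrow> real)"
  shows "v (of_int m) \<le> 1"
proof -
  have nonneg: "0 \<le> v x" and zero: "v x = 0 \<longleftrightarrow> x = 0" and mult: "v (x * y) = v x * v y"
    and add: "v (x + y) \<le> max (v x) (v y)" for x y
    using v by (simp_all add: complete_nonarch_abs_def)
  have one: "v 1 = 1" using mult[of 1 1] zero[of 1] by simp
  have "v (- 1) * v (- 1) = 1" using mult[of "- 1" "- 1"] one by simp
  then have neg_one: "v (- 1) = 1"
    using nonneg[of "- 1"] by (metis abs_of_nonneg abs_square_eq_1 power2_eq_square)
  have nat: "v (of_nat n) \<le> 1" for n
  proof (induction n)
    case 0 show ?case using zero[of 0] by simp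
  next
    case (Suc n) then show ?case using add[of 1 "of_nat n"] one by simp
  qed
  show ?thesis
  proof (cases m)
    case (neg n)
    then have "of_int m = (- 1 :: 'k) * of_nat (Suc n)" by simp
    then have "v (of_int m) = v (of_nat (Suc n))" by (simp only: mult neg_one mult_1)
    with nat[of "Suc n"] show ?thesis by simp
  qed (simp add: nat)
qed

text \<open>Differentiation multiplies coefficients by integers, whose absolute value is at most 1,
  so it preserves convergence on every closed disk. A monomial has only one coefficient to
  consider.\<close>

lemma punctured_functions_extension:
  fixes v :: "'k::field_char_0 \<Rightarrow> real"
  assumes v: "complete_nonarch_abs v"
  shows "laurent_scalar_extension (punctured_functions v r)"
proof unfold_locales
  have nonneg: "0 \<le> v x" and mult: "v (x * y) = v x * v y" and zero: "v 0 = 0" for x y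
    using v by (simp_all add: complete_nonarch_abs_def)
  show "fls_deriv (a + b) = fls_deriv a + fls_deriv b" for a b :: "'k fls" by simp
  show "fls_deriv (a * b) = fls_deriv a * b + a * fls_deriv b" for a b :: "'k fls" by simp
  show "fls_deriv a \<in> punctured_functions v r" if "a \<in> punctured_functions v r" for a
  proof -
    from that obtain f n where f: "f \<in> disk_functions v r" and a: "a = fps_to_fls f * fls_X_inv ^ n"
      by (auto simp: punctured_functions_def)
    \<comment> \<open>The derivative of \<open>f\<close> divided by the \<open>n\<close>-th power of
      the variable is this \<open>g\<close> divided by the next power: the coefficient of index
      \<open>i\<close> sits at exponent \<open>i - n\<close>, which differentiation brings
      down.\<close>
    define g where "g = Abs_fps (\<lambda>i. of_int (int i - int n) * fps_nth f i)"
    have "g \<in> disk_functions v r"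
      unfolding disk_functions_def
    proof (intro CollectI allI impI)
      fix \<rho> :: real assume \<rho>: "0 < \<rho>" "ereal \<rho> < r"
      then have lim: "(\<lambda>i. v (fps_nth f i) * \<rho> ^ i) \<longlonglongrightarrow> 0" using f by (simp add: disk_functions_def)
      show "(\<lambda>i. v (fps_nth g i) * \<rho> ^ i) \<longlonglongrightarrow> 0"
      proof (rule tendsto_sandwich[OF _ _ tendsto_const lim])
        have "v (fps_nth g i) * \<rho> ^ i \<le> v (fps_nth f i) * \<rho> ^ i" for i
        proof (rule mult_right_mono)
          show "v (fps_nth g i) \<le> v (fps_nth f i)"
            using mult_right_mono[OF complete_nonarch_abs_of_int[OF v, of "int i - int n"] nonneg[of "fps_nth f i"]]
            by (simp add: g_def mult)
        qed (use \<rho> in simp)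
        then show "\<forall>\<^sub>F i in sequentially. v (fps_nth g i) * \<rho> ^ i \<le> v (fps_nth f i) * \<rho> ^ i" by simp
        show "\<forall>\<^sub>F i in sequentially. 0 \<le> v (fps_nth g i) * \<rho> ^ i" using nonneg \<rho> by simp
      qed
    qed
    moreover have "fls_deriv a = fps_to_fls g * fls_X_inv ^ Suc n"
      unfolding a fls_X_inv_power_times_conv_shift
      by (auto simp: fls_eq_iff g_def add_ac)
    ultimately show ?thesis unfolding punctured_functions_def by blast
  qed
  show "fls_const c * fls_X_intpow j \<in> punctured_functions v r" for c :: 'k and j
  proof -
    \<comment> \<open>Truncation by \<open>nat\<close> treats both signs at once: a nonnegative
      exponent goes into the power series, a negative one into the power of the inverse
      variable.\<close>
    define f where "f = fps_const c * fps_X ^ nat j"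
    have "f \<in> disk_functions v r"
      unfolding disk_functions_def
    proof (intro CollectI allI impI)
      fix \<rho> :: real
      have "\<forall>\<^sub>F i in sequentially. v (fps_nth f i) * \<rho> ^ i = 0"
        using eventually_gt_at_top[of "nat j"] by eventually_elim (simp add: f_def fps_X_power_mult_right_nth zero)
      then show "(\<lambda>i. v (fps_nth f i) * \<rho> ^ i) \<longlonglongrightarrow> 0" by (rule tendsto_eventually)
    qed
    moreover have "fls_const c * fls_X_intpow j = fps_to_fls f * fls_X_inv ^ nat (- j)"
      by (auto simp: fls_eq_iff f_def fls_X_inv_power_times_conv_shift fls_X_intpow_times_conv_shift fps_X_power_iff)
    ultimately show ?thesis unfolding punctured_functions_def by blast
  qed
qed

section \<open>Extensions over the disk and over Laurent series\<close>

context laurent_scalar_extension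
begin

text \<open>Multiples of a nonzero element by distinct constants are distinct, as nonzero constants
  are invertible in the ring, and K is infinite.\<close>

lemma infinite_module:
  assumes M: "dmod R fls_deriv (M :: ('k fls, 'm) dmodule)" and x: "x \<in> carrier M" "x \<noteq> \<zero>\<^bsub>M\<^esub>"
  shows "infinite (UNIV :: 'm set)"
proof
  interpret M: Module.module R M by (rule dmod_module[OF M])
  assume "finite (UNIV :: 'm set)"
  then have "finite (range (\<lambda>c. fls_const c \<odot>\<^bsub>M\<^esub> x))" by (rule finite_subset[rotated]) simp
  moreover have "inj (\<lambda>c. fls_const c \<odot>\<^bsub>M\<^esub> x)"
  proof (rule injI)
    fix a b assume eq: "fls_const a \<odot>\<^bsub>M\<^esub> x = fls_const b \<odot>\<^bsub>M\<^esub> x"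
    have "fls_const (a - b) \<odot>\<^bsub>M\<^esub> x \<oplus>\<^bsub>M\<^esub> fls_const b \<odot>\<^bsub>M\<^esub> x = \<zero>\<^bsub>M\<^esub> \<oplus>\<^bsub>M\<^esub> fls_const b \<odot>\<^bsub>M\<^esub> x"
      using M.smult_l_distr[of "fls_const (a - b)" "fls_const b" x] const x eq M.smult_closed[of "fls_const b" x]
      by (simp add: fls_plus_const)
    then have 0: "fls_const (a - b) \<odot>\<^bsub>M\<^esub> x = \<zero>\<^bsub>M\<^esub>"
      using x const M.smult_closed[of _ x] by (simp add: M.add.right_cancel)
    show "a = b"
    proof (rule ccontr)
      assume "a \<noteq> b"
      then have "fls_const (inverse (a - b)) * fls_const (a - b) = 1" by simp
      then have "x = fls_const (inverse (a - b)) \<odot>\<^bsub>M\<^esub> (fls_const (a - b) \<odot>\<^bsub>M\<^esub> x)"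
        using M.smult_assoc1[of "fls_const (inverse (a - b))" "fls_const (a - b)" x] M.smult_one[of x] const x by simp
      then show False using 0 x const by simp
    qed
  qed
  ultimately show False using finite_imageD[of "\<lambda>c. fls_const c \<odot>\<^bsub>M\<^esub> x" UNIV] infinite_UNIV_char_0[where 'a = 'k] by blast
qed

text \<open>Cocycle classes identify both extension groups with cokernels of the connections on Hom.\<close>

lemma ext_base_change_iso:
  assumes M: "dmod R fls_deriv M" and N: "dmod R fls_deriv N"
    and dbM: "dual_basis R M m x s" and dbN: "dual_basis R N n y t"
    and fd: "finite_dim_dR (internal_hom R M N)" and chi: "chi_dR (internal_hom R M N) = 0"
  shows "ext_base_change A R fls_deriv M N \<in> iso (Ext R fls_deriv M N) (Ext A fls_deriv (ext M) (ext N))"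
proof -
  let ?D = fls_deriv
  obtain s' where dbM': "dual_basis A (ext M) m (\<lambda>j. pure M 1 (x j)) s'"
    by (rule dual_basis_ext[OF M dbM]) blast
  note M' = dmod_ext[OF M] and N' = dmod_ext[OF N]
  note cmp = hom_comparison[OF M N dbM dbN fd chi]
  interpret N: Module.module R N by (rule dmod_module[OF N])
  interpret N': Module.module A "ext N" by (rule dmod_module[OF N'])
  interpret H: Module.module R "internal_hom R M N" by (rule internal_hom_module[OF dmod_module[OF M] dmod_module[OF N]])
  have Hc: "f \<oplus>\<^bsub>internal_hom R M N\<^esub> g \<in> lin_maps R M N" if "f \<in> lin_maps R M N" "g \<in> lin_maps R M N" for f g
    using that H.M.a_closed[of f g] by (simp add: internal_hom_simps(1))
  note carrier = Ext_carrier[OF M N d_funcset(1) dbM] Ext_carrier[OF M' N' d_funcset(2) dbM']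
  note mult = Ext_mult[OF M N d_funcset(1)] Ext_mult[OF M' N' d_funcset(2)]
  note bc = ext_base_change_class[OF M N]
  note lin = ext_hom_lin[OF M N]
  have hom: "ext_base_change A R ?D M N \<in> hom (Ext R ?D M N) (Ext A ?D (ext M) (ext N))"
    by (rule homI) (auto simp: carrier mult bc lin Hc ext_hom_plus[OF M N])
  have inj: "inj_on (ext_base_change A R ?D M N) (carrier (Ext R ?D M N))"
  proof (rule inj_onI)
    fix X Y assume "X \<in> carrier (Ext R ?D M N)" "Y \<in> carrier (Ext R ?D M N)"
      and eq: "ext_base_change A R ?D M N X = ext_base_change A R ?D M N Y"
    then obtain f g where f: "f \<in> lin_maps R M N" "X = cocycle_class R ?D M N f"
      and g: "g \<in> lin_maps R M N" "Y = cocycle_class R ?D M N g" by (auto simp: carrier)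
    from eq obtain \<psi> where \<psi>: "\<psi> \<in> lin_maps A (ext M) (ext N)"
      and *: "\<And>Z. Z \<in> carrier (ext M) \<Longrightarrow> ext_hom M N g Z = ext_hom M N f Z \<oplus>\<^bsub>ext N\<^esub> conn A (ext M) (ext N) \<psi> Z"
      using cocycle_class_eq_iff[OF M' N' d_funcset(2) lin[OF f(1)] lin[OF g(1)]] by (auto simp: f(2) g(2) bc f(1) g(1))
    \<comment> \<open>The difference of the two cocycles becomes exact over K((T)); injectivity in
      degree one makes it exact over the disk.\<close>
    define h where "h = (\<lambda>z\<in>carrier M. g z \<ominus>\<^bsub>N\<^esub> f z)"
    have h: "h \<in> lin_maps R M N" unfolding h_def by (rule lin_maps_minus[OF g(1) f(1) dmod_module[OF M] dmod_module[OF N]])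
    have gh: "g = f \<oplus>\<^bsub>internal_hom R M N\<^esub> h"
      by (rule lin_maps_eqI[OF g(1) Hc[OF f(1) h]])
         (simp add: internal_hom_simps h_def lin_maps_closed[OF f(1)] lin_maps_closed[OF g(1)])
    have "ext_hom M N h = conn A (ext M) (ext N) \<psi>"
    proof (rule lin_maps_eqI[OF lin[OF h] conn_closed[OF M' N' d_funcset(2) \<psi>]])
      fix Z assume Z: "Z \<in> carrier (ext M)"
      have "ext_hom M N f Z \<oplus>\<^bsub>ext N\<^esub> ext_hom M N h Z = ext_hom M N g Z"
        unfolding gh ext_hom_plus[OF M N f(1) h] using Z by (simp add: internal_hom_simps)
      then show "ext_hom M N h Z = conn A (ext M) (ext N) \<psi> Z"
        using *[OF Z] Z lin_maps_closed[OF lin[OF f(1)] Z] lin_maps_closed[OF lin[OF h] Z]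
          lin_maps_closed[OF conn_closed[OF M' N' d_funcset(2) \<psi>] Z] by (simp add: N'.a_comm[of "ext_hom M N f Z"])
    qed
    from cmp(2)[OF h \<psi> this] obtain \<psi>' where "\<psi>' \<in> lin_maps R M N" "h = conn R M N \<psi>'" by blast
    then show "X = Y"
      unfolding f(2) g(2) cocycle_class_eq_iff[OF M N d_funcset(1) f(1) g(1)]
      by (intro bexI[of _ \<psi>']) (simp_all add: gh internal_hom_simps(3))
  qed
  have "ext_base_change A R ?D M N ` carrier (Ext R ?D M N) = carrier (Ext A ?D (ext M) (ext N))"
  proof (intro equalityI subsetI)
    fix X assume "X \<in> carrier (Ext A ?D (ext M) (ext N))"
    then obtain g where g: "g \<in> lin_maps A (ext M) (ext N)" "X = cocycle_class A ?D (ext M) (ext N) g"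
      by (auto simp: carrier)
    \<comment> \<open>Surjectivity in degree one: up to an exact term the cocycle is extended from
      one over the disk.\<close>
    from cmp(3)[OF g(1)] obtain f \<psi> where f: "f \<in> lin_maps R M N" and \<psi>: "\<psi> \<in> lin_maps A (ext M) (ext N)"
      and eq: "g = ext_hom M N f \<oplus>\<^bsub>internal_hom A (ext M) (ext N)\<^esub> conn A (ext M) (ext N) \<psi>" by blast
    have "cocycle_class A ?D (ext M) (ext N) (ext_hom M N f) = X"
      unfolding g(2) cocycle_class_eq_iff[OF M' N' d_funcset(2) lin[OF f] g(1)]
      using \<psi> by (intro bexI[of _ \<psi>]) (simp_all add: eq internal_hom_simps(3))
    then show "X \<in> ext_base_change A R ?D M N ` carrier (Ext R ?D M N)"
      unfolding carrier using f by (intro image_eqI[of _ _ "cocycle_class R ?D M N f"]) (simp_all add: bc)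
  qed (use hom in \<open>auto simp: hom_def\<close>)
  with hom inj show ?thesis by (simp add: iso_def bij_betw_def)
qed

text \<open>With the outer terms replaced by \<open>ext N\<close> and \<open>ext M\<close>, the
  extension has a cocycle that differs by an exact one from a cocycle over the disk. The twisted
  product with the latter, moved to the type of \<open>M\<close> and \<open>N\<close>, restricts to
  an extension equivalent to the given one.\<close>

lemma extension_in_essential_image:
  fixes M N :: "('k fls, 'm) dmodule"
  assumes M: "dmod R fls_deriv M" and N: "dmod R fls_deriv N"
    and dbM: "dual_basis R M m x s" and dbN: "dual_basis R N n y t"
    and fd: "finite_dim_dR (internal_hom R M N)" and chi: "chi_dR (internal_hom R M N) = 0"
    and E: "short_exact A fls_deriv N' E M' i p"
    and a: "dmod_isomorphic A (ext N) N'" and b: "dmod_isomorphic A (ext M) M'"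
  obtains T :: "('k fls, 'm) dmodule" and j q
  where "short_exact R fls_deriv N T M j q" "dmod_isomorphic A (ext T) E"
proof -
  let ?D = fls_deriv
  note cmp = hom_comparison[OF M N dbM dbN fd chi]
  have dM': "dmod A ?D M'" using E by (simp add: short_exact_def)
  obtain f where f: "f \<in> dmod_hom A (ext N) N'" "bij_betw f (carrier (ext N)) (carrier N')"
    using a by (auto simp: dmod_isomorphic_def)
  obtain g where g: "g \<in> dmod_hom A (ext M) M'" "bij_betw g (carrier (ext M)) (carrier M')"
    using b by (auto simp: dmod_isomorphic_def)
  have g': "bij_betw (\<lambda>y\<in>carrier M'. inv_into (carrier (ext M)) g y) (carrier M') (carrier (ext M))"
    using bij_betw_inv_into[OF g(2)] by (rule bij_betw_cong[THEN iffD1, rotated]) simp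
  define i' where "i' = (\<lambda>x\<in>carrier (ext N). i (f x))"
  define p' where "p' = (\<lambda>e\<in>carrier E. (\<lambda>y\<in>carrier M'. inv_into (carrier (ext M)) g y) (p e))"
  have E': "short_exact A ?D (ext N) E (ext M) i' p'"
    unfolding i'_def p'_def
    by (rule short_exact_iso[OF E dmod_ext[OF N] dmod_ext[OF M] f dmod_hom_inverse[OF dmod_ext[OF M] dM' g] g'])
  interpret E': short_exact_sequence A ?D "ext N" E "ext M" i' p' by unfold_locales (rule E')
  obtain s' where dbM': "dual_basis A (ext M) m (\<lambda>j. pure M 1 (x j)) s'"
    by (rule dual_basis_ext[OF M dbM]) blast
  obtain \<phi>' where \<phi>': "\<phi>' \<in> lin_maps A (ext M) (ext N)" "cocycle A (ext M) (E, i', p') \<phi>'"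
    by (rule E'.cocycle_exists[OF dbM' d_funcset(2)])
  from cmp(3)[OF \<phi>'(1)] obtain \<phi> \<psi> where \<phi>: "\<phi> \<in> lin_maps R M N" and \<psi>: "\<psi> \<in> lin_maps A (ext M) (ext N)"
    and eq: "\<phi>' = ext_hom M N \<phi> \<oplus>\<^bsub>internal_hom A (ext M) (ext N)\<^esub> conn A (ext M) (ext N) \<psi>" by blast
  obtain T0 :: "('k fls, 'm \<times> 'm) dmodule" and j0 q0 where tw: "twist M N \<phi> = (T0, j0, q0)"
    and T0: "short_exact R ?D N T0 M j0 q0" "cocycle R M (T0, j0, q0) \<phi>"
    by (rule twistE[OF M N d_funcset(1) \<phi>])
  have T0c: "carrier T0 = carrier N \<times> carrier M" using tw by (auto simp: twist_def prod_dmod_def)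
  \<comment> \<open>A nonzero module is infinite, so over a finite carrier type only zero modules
    exist. This leaves the two cases in which a product of carriers embeds into the type.\<close>
  have trivial: "carrier X = {\<zero>\<^bsub>X\<^esub>}" if "finite (UNIV :: 'm set)" "dmod R ?D X" for X :: "('k fls, 'm) dmodule"
  proof -
    interpret X: Module.module R X using that(2) by (rule dmod_module)
    show ?thesis using infinite_module[OF that(2)] that(1) by auto
  qed
  have "\<exists>h :: 'm \<times> 'm \<Rightarrow> 'm. inj_on h (carrier N \<times> carrier M)"
    by (rule ex_inj_on_Times) (use trivial[OF _ M] trivial[OF _ N] in force)
  then obtain h :: "'m \<times> 'm \<Rightarrow> 'm" where h: "inj_on h (carrier T0)" unfolding T0c by blast
  obtain T :: "('k fls, 'm) dmodule" and j q where T: "short_exact R ?D N T M j q" "cocycle R M (T, j, q) \<phi>"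
    by (rule short_exact_transport[OF T0 h d_funcset(1) \<phi>])
  note T' = ext_short_exact[OF T \<phi>]
  interpret T': short_exact_sequence A ?D "ext N" "ext T" "ext M" "ext_hom N T j" "ext_hom T M q"
    by unfold_locales (rule T')
  \<comment> \<open>Changing the section of \<open>ext T\<close> by \<psi> adds the missing exact
    term, so \<open>ext T\<close> and \<open>E\<close> admit a common cocycle and are
    equivalent.\<close>
  have "cocycle A (ext M) (ext T, ext_hom N T j, ext_hom T M q) \<phi>'"
    unfolding T'.cocycle_iff[OF T'(2) ext_hom_lin[OF M N \<phi>] \<phi>'(1)]
    using \<psi> by (intro bexI[of _ \<psi>]) (simp_all add: eq internal_hom_simps(3))
  then have "ext_equiv A (ext M) (ext N) (ext T, ext_hom N T j, ext_hom T M q) (E, i', p')"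
    using ext_equiv_iff_cocycle[OF T'(1) E' _ \<phi>'(1)] \<phi>'(2) by simp
  then have "dmod_isomorphic A (ext T) E" by (auto simp: ext_equiv_def dmod_isomorphic_def)
  with T(1) show ?thesis by (rule that)
qed

end

section \<open>Restriction from the punctured disk to the formal punctured disk\<close>

theorem corollary4p1p24:
  fixes v :: "'k::field_char_0 \<Rightarrow> real"
    and r :: ereal
    and C :: "('k fls, 'm) dmodule set"
  assumes "complete_nonarch_abs v"
    and "0 < r"
    and "\<And>F. F \<in> C \<Longrightarrow> diff_eq v r F"
    and "\<And>F G. F \<in> C \<Longrightarrow> G \<in> C \<Longrightarrow>
           free_module (punctured_ring v r) (internal_hom (punctured_ring v r) F G)"
    and "\<And>F G. F \<in> C \<Longrightarrow> G \<in> C \<Longrightarrow>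
           finite_dim_dR (internal_hom (punctured_ring v r) F G)"
    and "\<And>F G. F \<in> C \<Longrightarrow> G \<in> C \<Longrightarrow>
           chi_dR (internal_hom (punctured_ring v r) F G) = 0"
  shows "(\<forall>F\<in>C. dmod class_ring fls_deriv (Res v r F)) \<and>
    (\<forall>F\<in>C. \<forall>G\<in>C. bij_betw (Res_hom v r F G)
        (dmod_hom (punctured_ring v r) F G)
        (dmod_hom class_ring (Res v r F) (Res v r G))) \<and>
    (\<forall>F\<in>C. \<forall>G\<in>C.
        ext_base_change class_ring (punctured_ring v r) fls_deriv F G \<in>
          iso (Ext (punctured_ring v r) fls_deriv F G)
              (Ext class_ring fls_deriv (Res v r F) (Res v r G))) \<and>
    (stable_by_extensions (punctured_ring v r) fls_deriv C \<longrightarrow>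
       stable_by_extensions class_ring fls_deriv
         (essential_image class_ring (punctured_ring v r) fls_deriv C
            :: ('k fls, 'y) dmodule set))"
proof -
  interpret laurent_scalar_extension "punctured_functions v r"
    by (rule punctured_functions_extension) fact
  have R: "punctured_ring v r = R" by (rule punctured_ring_eq)
  \<comment> \<open>A \<open>dmod\<close> includes the commutative ring structure on its scalars, so
    the closure properties of the functions on the punctured disk come with each member of
    \<open>C\<close>.\<close>
  have dmod: "dmod R fls_deriv F" if "F \<in> C" for F
    using assms(3)[OF that] by (simp add: diff_eq_def R)
  have db: "\<exists>n x s. dual_basis R F n x s" if "F \<in> C" for F
    using assms(3)[OF that] fg_projective_dual_basis[OF dmod_module[OF dmod[OF that]]] by (simp add: diff_eq_def R)
  note fd = assms(5)[unfolded R] and chi = assms(6)[unfolded R]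
  show ?thesis unfolding R
  proof (intro conjI ballI impI)
    show "dmod A fls_deriv (ext F)" if "F \<in> C" for F by (rule dmod_ext[OF dmod[OF that]])
  next
    fix F G assume FG: "F \<in> C" "G \<in> C"
    obtain m x s where dbF: "dual_basis R F m x s" using db[OF FG(1)] by blast
    obtain n y t where dbG: "dual_basis R G n y t" using db[OF FG(2)] by blast
    note F = dmod[OF FG(1)] and G = dmod[OF FG(2)]
    note hyps = F G dbF dbG fd[OF FG] chi[OF FG]
    show "bij_betw (ext_hom F G) (dmod_hom R F G) (dmod_hom A (ext F) (ext G))"
      unfolding bij_betw_def
    proof
      \<comment> \<open>Faithfulness holds for all linear maps, horizontal or not, because
        \<open>G\<close> embeds into its scalar extension.\<close>
      show "inj_on (ext_hom F G) (dmod_hom R F G)"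
        by (rule inj_onI) (rule ext_hom_inj[OF F G dbG dmod_homD(1) dmod_homD(1)])
      show "ext_hom F G ` dmod_hom R F G = dmod_hom A (ext F) (ext G)"
        using ext_hom_dmod_hom[OF F G] hom_comparison(1)[OF hyps] by blast
    qed
    show "ext_base_change A R fls_deriv F G \<in> iso (Ext R fls_deriv F G) (Ext A fls_deriv (ext F) (ext G))"
      by (rule ext_base_change_iso[OF hyps])
  next
    assume stable: "stable_by_extensions R fls_deriv C"
    show "stable_by_extensions A fls_deriv (essential_image A R fls_deriv C :: ('k fls, 'y) dmodule set)"
      unfolding stable_by_extensions_def
    proof (intro allI impI, elim conjE)
      fix N' E M' :: "('k fls, 'y) dmodule" and i p
      assume E: "short_exact A fls_deriv N' E M' i p"
        and "N' \<in> essential_image A R fls_deriv C" "M' \<in> essential_image A R fls_deriv C"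
      then obtain F G where F: "F \<in> C" "dmod_isomorphic A (ext F) M'" and G: "G \<in> C" "dmod_isomorphic A (ext G) N'"
        by (auto simp: essential_image_def)
      obtain m x s where dbF: "dual_basis R F m x s" using db[OF F(1)] by blast
      obtain n y t where dbG: "dual_basis R G n y t" using db[OF G(1)] by blast
      \<comment> \<open>The quotient comes from \<open>F\<close> and the subobject from
        \<open>G\<close>, so Hom from \<open>F\<close> to \<open>G\<close> governs the
        extension.\<close>
      obtain T :: "('k fls, 'm) dmodule" and j q where "short_exact R fls_deriv G T F j q" "dmod_isomorphic A (ext T) E"
        by (rule extension_in_essential_image[OF dmod[OF F(1)] dmod[OF G(1)] dbF dbG
              fd[OF F(1) G(1)] chi[OF F(1) G(1)] E G(2) F(2)])
      moreover have "dmod A fls_deriv E" using E by (simp add: short_exact_def)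
      ultimately show "E \<in> essential_image A R fls_deriv C"
        using stable F(1) G(1) unfolding stable_by_extensions_def essential_image_def by blast
    qed
  qed
qed

end
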